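(* Let $K/F$ be a finite Galois extension of local nonarchimedean fields with rings of integers $\mathcal{O}_K$, $\mathcal{O}_F$, let $\mathfrak{p}$ be the maximal ideal of $\mathcal{O}_F$, let $\sigma\in \mathrm{Gal}(K/F)$, and let $f\in \mathcal{O}_K[t;\sigma]$ be monic of degree $m$. Let $\Lambda=\mathcal{O}_K[t;\sigma]/\mathcal{O}_K[t;\sigma]f$ be the natural order of the Petit algebra $S_f=K[t;\sigma]/K[t;\sigma]f$, let $\Psi$ be the reduction map from $\Lambda$ to $S_{\overline f}=(\mathcal{O}_K/\mathfrak{p}\mathcal{O}_K)[t;\overline\sigma]/(\mathcal{O}_K/\mathfrak{p}\mathcal{O}_K)[t;\overline\sigma]\overline f$, also regarded as a map on $\Lambda/\mathfrak{p}\Lambda$, and let $\rho:\Lambda\to \Lambda/\mathfrak{p}\Lambda\to\Psi(\Lambda/\mathfrak{p}\Lambda)$ be the canonical projection composed with $\Psi$. Let $\mathcal{I}=\Lambda g$ be a principal left ideal of $\Lambda$ generated by a monic polynomial $g$, such that $\mathfrak{p}\subset\mathcal{I}$. Then $\mathcal{I}/\mathfrak{p}\Lambda$ is a non-zero principal left ideal of $\Lambda/\mathfrak{p}\Lambda$ generated by $g+\mathfrak{p}\Lambda$, and $\Psi(\mathcal{I}/\mathfrak{p}\Lambda)$ is a principal left ideal of $S_{\overline f}$ generated by the monic polynomial $\overline g$. Thus $\Psi(\mathcal{I}/\mathfrak{p}\Lambda)$ corresponds to a cyclic $(\overline f,\overline\sigma)$-code $\mathcal{C}$ over $\mathcal{O}_K/\mathfrak{p}\mathcal{O}_K$;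 that is, $\Psi(\mathcal{I}/\mathfrak{p}\Lambda)$ is an $\mathcal{O}_K/\mathfrak{p}\mathcal{O}_K$-module isomorphic to a submodule of $(\mathcal{O}_K/\mathfrak{p}\mathcal{O}_K)^m$ and corresponds to a cyclic $(\overline f,\overline\sigma)$-code of length $m$ and dimension $m-\deg(\overline g)$. Let $\mathcal{C}$ be this cyclic $(\overline f,\overline\sigma)$-code and put $L=\rho^{-1}(\mathcal{C})$. Then: (i) $L$ is an $\mathcal{O}_F$-lattice, of finite rank $M=m[\mathcal{O}_K:\mathcal{O}_F]$ as an $\mathcal{O}_F$-module, with embedding into $F^M$ canonically determined by considering the algebra $S_f$. (ii) If the fields are $p$-adic fields (finite extensions of $\mathbb{Q}_p$), then $L$ is a $\mathbb{Z}_p$-lattice of finite rank $N=m[\mathcal{O}_K:\mathbb{Z}_p]$, with embedding into $\mathbb{Q}_p^N$ canonically determined by considering $S_f$. (iii) If the fields are fields of Laurent series over finite fields and $F=\mathbb{F}_q(\!(u)\!)$, then $L$ is an $\mathbb{F}_q[\![u]\!]$-lattice in $\mathbb{F}_q(\!(u)\!)^N$ of finite rank $N=m[\mathcal{O}_K:\mathbb{F}_q[\![u]\!]]$.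
   Context: Skew polynomials: for a unital associative ring $S$ and an injective ring endomorphism $\sigma$ of $S$, $S[t;\sigma]$ is the ring of polynomials $\sum a_it^i$ with $a_i\in S$, termwise addition, and multiplication determined by $ta=\sigma(a)t$ for $a\in S$. Petit algebras: let $f\in S[t;\sigma]$ be monic of degree $m$. Every $h\in S[t;\sigma]$ can be written uniquely as $h=qf+r$ with $\deg r<m$; write $r=h \bmod_r f$. The set of skew polynomials of degree less than $m$, with the usual addition and the multiplication $g\circ h=(gh)\bmod_r f$, is a unital, in general nonassociative, ring, denoted $S_f$ or $S[t;\sigma]/S[t;\sigma]f$. (The same notation is used for $\overline\sigma$ on $\mathcal{O}_K/\mathfrak{p}\mathcal{O}_K$.) Natural order: for monic $f\in\mathcal{O}_K[t;\sigma]$ of degree $m$, the subring $\Lambda=\mathcal{O}_K\oplus\mathcal{O}_Kt\oplus\dots\oplus\mathcal{O}_Kt^{m-1}$ of $S_f=K[t;\sigma]/K[t;\sigma]f$, which is the Petit ring $\mathcal{O}_K[t;\sigma]/\mathcal{O}_K[t;\sigma]f$, is called the natural order. Reduction: $\overline\sigma$ is the ring homomorphism of $\mathcal{O}_K/\mathfrak{p}\mathcal{O}_K$ induced by $\sigma$; for $g=\sum a_it^i\in \mathcal{O}_K[t;\sigma]$, $\overline g=\sum\overline{a_i}t^i$ with $\overline{a_i}=a_i+\mathfrak{p}\mathcal{O}_K$. The map $\Psi:\Lambda\to S_{\overline f}$, $g\mapsto\overline g$, is a surjective ring homomorphism with kernel $\mathfrak{p}\Lambda$; the induced isomorphism $\Lambda/\mathfrak{p}\Lambda\to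 S_{\overline f}$ is also denoted $\Psi$. A principal left ideal of a nonassociative ring $\Lambda$ generated by $g\in\Lambda$ is a left ideal of the form $\Lambda g=\{h\circ g : h\in\Lambda\}$. Codes: let $S$ be a commutative unital ring, $\sigma$ an injective ring endomorphism of $S$ and $f\in S[t;\sigma]$ monic of degree $m$. A linear code of length $m$ over $S$ is a submodule of $S^m$. A cyclic $(f,\sigma)$-code $\mathcal{C}\subset S^m$ is a set consisting of the vectors $(a_0,\dots,a_{m-1})$ obtained from all the elements $h=\sum_{i=0}^{m-1}a_it^i$ in a principal left ideal $S_fg$ of $S_f$, where $g$ is a monic right divisor of $f$. The dimension of such a code is its rank as an $S$-module. Elements $\sum_{i=0}^{m-1}a_it^i$ of $S_{\overline f}$ are identified with vectors $(a_0,\dots,a_{m-1})$ over $\mathcal{O}_K/\mathfrak{p}\mathcal{O}_K$; under this identification $\rho^{-1}(\mathcal{C})$ is the set of $x\in\Lambda$ with $\rho(x)\in\Psi(\mathcal{I}/\mathfrak{p}\Lambda)$. Lattices: for a Noetherian integral domain $R$ with quotient field $E$ and a finite-dimensional unital $E$-algebra $A$, an $R$-lattice in $A$ is a finitely generated $R$-submodule of $A$ containing an $E$-basis of $A$. For rings $R\subset R'$ with $R'$ free of finite rank as an $R$-module, $[R':R]$ denotes that rank.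
   Formalization: The claims that C is a cyclic code (generated by the reduction of g) and has dimension m − deg(ḡ) are proved only when ḡ right-divides f̄; without this the dimension claim fails, e.g. K=F, σ=id, f=t²−1, g=t. *)

theory Defs
  imports
    "HOL-Algebra.Algebra"
    "HOL-Algebra.Algebraic_Closure_Type"
    "HOL-Computational_Algebra.Formal_Laurent_Series"
    Complex_Main
begin

section \<open>Nonarchimedean local fields\<close>

definition is_nonarch_abs :: "('a, 'k) ring_scheme \<Rightarrow> ('a \<Rightarrow> real) \<Rightarrow> bool" where
  "is_nonarch_abs E \<nu> \<longleftrightarrow>
     (\<forall>x\<in>carrier E. 0 \<le> \<nu> x \<and> (\<nu> x = 0 \<longleftrightarrow> x = \<zero>\<^bsub>E\<^esub>)) \<and>
     (\<forall>x\<in>carrier E. \<forall>y\<in>carrier E. \<nu> (x \<otimes>\<^bsub>E\<^esub> y) = \<nu> x * \<nu> y) \<and>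
     (\<forall>x\<in>carrier E. \<forall>y\<in>carrier E. \<nu> (x \<oplus>\<^bsub>E\<^esub> y) \<le> max (\<nu> x) (\<nu> y))"

definition is_complete_abs :: "('a, 'k) ring_scheme \<Rightarrow> ('a \<Rightarrow> real) \<Rightarrow> bool" where
  "is_complete_abs E \<nu> \<longleftrightarrow>
     (\<forall>s::nat \<Rightarrow> 'a.
        (\<forall>n. s n \<in> carrier E) \<and>
        (\<forall>\<epsilon>>0. \<exists>n0. \<forall>i\<ge>n0. \<forall>j\<ge>n0. \<nu> (s i \<ominus>\<^bsub>E\<^esub> s j) < \<epsilon>) \<longrightarrow>
        (\<exists>l\<in>carrier E. (\<lambda>n. \<nu> (s n \<ominus>\<^bsub>E\<^esub> l)) \<longlonglongrightarrow> 0))"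

definition val_ring :: "('a, 'k) ring_scheme \<Rightarrow> ('a \<Rightarrow> real) \<Rightarrow> 'a set" where
  "val_ring E \<nu> = {x \<in> carrier E. \<nu> x \<le> 1}"

definition max_ideal :: "('a, 'k) ring_scheme \<Rightarrow> ('a \<Rightarrow> real) \<Rightarrow> 'a set" where
  "max_ideal E \<nu> = {x \<in> carrier E. \<nu> x < 1}"

text \<open>Complete with respect to a nontrivial discrete absolute value, with finite residue field.\<close>

definition nonarch_local_field :: "('a, 'k) ring_scheme \<Rightarrow> ('a \<Rightarrow> real) \<Rightarrow> bool" where
  "nonarch_local_field E \<nu> \<longleftrightarrow>
     Ring.field E \<and> is_nonarch_abs E \<nu> \<and> is_complete_abs E \<nu> \<and>
     (\<exists>\<pi>\<in>carrier E. 0 < \<nu> \<pi> \<and> \<nu> \<pi> < 1 \<and>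
        (\<forall>x\<in>carrier E. x \<noteq> \<zero>\<^bsub>E\<^esub> \<longrightarrow> (\<exists>k::int. \<nu> x = \<nu> \<pi> powi k))) \<and>
     finite (carrier ((E\<lparr>carrier := val_ring E \<nu>\<rparr>) Quot (max_ideal E \<nu>)))"

definition Gal :: "('a, 'k) ring_scheme \<Rightarrow> 'a set \<Rightarrow> ('a \<Rightarrow> 'a) set" where
  "Gal K F = {\<tau> \<in> ring_iso K K. \<forall>x\<in>F. \<tau> x = x}"

definition finite_galois :: "('a, 'k) ring_scheme \<Rightarrow> 'a set \<Rightarrow> bool" where
  "finite_galois K F \<longleftrightarrow>
     subfield F K \<and> ring.finite_dimension K F (carrier K) \<and>
     {x \<in> carrier K. \<forall>\<tau>\<in>Gal K F. \<tau> x = x} = F"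

text \<open>
  The subfield \<open>Q\<close> of \<open>K\<close> is the field of \<open>p\<close>-adic numbers, that is, a completion of the rational
  numbers: \<open>\<nu>\<close> is (a power of) the \<open>p\<close>-adic absolute value on the integers, the fractions of
  integers are dense in \<open>Q\<close>, and \<open>Q\<close> is complete.  The condition on integers forces
  characteristic 0.
\<close>

definition is_padic_numbers :: "nat \<Rightarrow> ('a, 'k) ring_scheme \<Rightarrow> ('a \<Rightarrow> real) \<Rightarrow> 'a set \<Rightarrow> bool" where
  "is_padic_numbers p K \<nu> Q \<longleftrightarrow>
     subfield Q K \<and>
     (\<exists>c. 0 < c \<and> c < 1 \<and>
        (\<forall>n::int. n \<noteq> 0 \<longrightarrow> \<nu> (add_pow K n \<one>\<^bsub>K\<^esub>) = c ^ multiplicity (int p) n)) \<and>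
     (\<forall>x\<in>Q. \<forall>\<epsilon>>0. \<exists>(a::int) (b::int). b \<noteq> 0 \<and>
        \<nu> (x \<ominus>\<^bsub>K\<^esub> (add_pow K a \<one>\<^bsub>K\<^esub> \<otimes>\<^bsub>K\<^esub> inv\<^bsub>K\<^esub> (add_pow K b \<one>\<^bsub>K\<^esub>))) < \<epsilon>) \<and>
     is_nonarch_abs (K\<lparr>carrier := Q\<rparr>) \<nu> \<and>
     is_complete_abs (K\<lparr>carrier := Q\<rparr>) \<nu>"

text \<open>
  An identification of the valued field \<open>E\<close> with the field of Laurent series over the finite
  field \<open>'c\<close> with its \<open>u\<close>-adic absolute value.
\<close>

definition is_laurent_iso ::
    "('c::{Fields.field,finite} fls \<Rightarrow> 'a) \<Rightarrow> ('a, 'k) ring_scheme \<Rightarrow> ('a \<Rightarrow> real) \<Rightarrow> bool" where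
  "is_laurent_iso \<phi> E \<nu> \<longleftrightarrow>
     \<phi> \<in> ring_iso ring_of_type_algebra E \<and>
     (\<exists>c. 0 < c \<and> c < 1 \<and> (\<forall>x. x \<noteq> 0 \<longrightarrow> \<nu> (\<phi> x) = c powi fls_subdegree x))"


section \<open>Skew polynomials and Petit algebras\<close>

text \<open>
  As in \<^theory>\<open>HOL-Algebra.UnivPoly\<close>, a polynomial is its coefficient function, and the degree
  \<^const>\<open>deg\<close> of the zero polynomial is 0.  The multiplication is determined by
  \<open>(a t\<^sup>i) (b t\<^sup>j) = a \<sigma>\<^sup>i(b) t\<^sup>i\<^sup>+\<^sup>j\<close>.
\<close>

definition const_poly :: "('s, 'k) ring_scheme \<Rightarrow> 's \<Rightarrow> nat \<Rightarrow> 's" where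
  "const_poly S a = (\<lambda>i. if i = 0 then a else \<zero>\<^bsub>S\<^esub>)"

definition skew_poly_ring :: "('s, 'k) ring_scheme \<Rightarrow> ('s \<Rightarrow> 's) \<Rightarrow> (nat \<Rightarrow> 's) ring" where
  "skew_poly_ring S \<sigma> =
     \<lparr>carrier = up S,
      monoid.mult = (\<lambda>p q n. \<Oplus>\<^bsub>S\<^esub>i\<in>{..n}. p i \<otimes>\<^bsub>S\<^esub> (\<sigma> ^^ i) (q (n - i))),
      one = const_poly S \<one>\<^bsub>S\<^esub>,
      ring.zero = (\<lambda>i. \<zero>\<^bsub>S\<^esub>),
      add = (\<lambda>p q i. p i \<oplus>\<^bsub>S\<^esub> q i)\<rparr>"

definition monic_poly :: "('s, 'k) ring_scheme \<Rightarrow> (nat \<Rightarrow> 's) \<Rightarrow> bool" where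
  "monic_poly S h \<longleftrightarrow> h \<in> up S \<and> h (deg S h) = \<one>\<^bsub>S\<^esub>"

definition right_divides ::
    "('s, 'k) ring_scheme \<Rightarrow> ('s \<Rightarrow> 's) \<Rightarrow> (nat \<Rightarrow> 's) \<Rightarrow> (nat \<Rightarrow> 's) \<Rightarrow> bool" where
  "right_divides S \<sigma> g f \<longleftrightarrow>
     (\<exists>q\<in>carrier (skew_poly_ring S \<sigma>). f = q \<otimes>\<^bsub>skew_poly_ring S \<sigma>\<^esub> g)"

definition polys_below :: "('s, 'k) ring_scheme \<Rightarrow> nat \<Rightarrow> (nat \<Rightarrow> 's) set" where
  "polys_below S m = {r \<in> up S. \<forall>i\<ge>m. r i = \<zero>\<^bsub>S\<^esub>}"

definition mod_r ::
    "('s, 'k) ring_scheme \<Rightarrow> ('s \<Rightarrow> 's) \<Rightarrow> (nat \<Rightarrow> 's) \<Rightarrow> (nat \<Rightarrow> 's) \<Rightarrow> nat \<Rightarrow> 's" where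
  "mod_r S \<sigma> f h =
     (THE r. r \<in> polys_below S (deg S f) \<and>
        (\<exists>q\<in>carrier (skew_poly_ring S \<sigma>).
           h = (q \<otimes>\<^bsub>skew_poly_ring S \<sigma>\<^esub> f) \<oplus>\<^bsub>skew_poly_ring S \<sigma>\<^esub> r))"

text \<open>The scalar multiplication makes the Petit algebra a left \<open>S\<close>-module.\<close>

definition petit ::
    "('s, 'k) ring_scheme \<Rightarrow> ('s \<Rightarrow> 's) \<Rightarrow> (nat \<Rightarrow> 's) \<Rightarrow> ('s, nat \<Rightarrow> 's) module" where
  "petit S \<sigma> f =
     \<lparr>carrier = polys_below S (deg S f),
      monoid.mult = (\<lambda>g h. mod_r S \<sigma> f (g \<otimes>\<^bsub>skew_poly_ring S \<sigma>\<^esub> h)),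
      one = const_poly S \<one>\<^bsub>S\<^esub>,
      ring.zero = (\<lambda>i. \<zero>\<^bsub>S\<^esub>),
      add = (\<lambda>p q i. p i \<oplus>\<^bsub>S\<^esub> q i),
      module.smult = (\<lambda>a p i. a \<otimes>\<^bsub>S\<^esub> p i)\<rparr>"

text \<open>For nonassociative rings, so multiplicative closure is all that is asked for.\<close>

definition left_ideal :: "'x set \<Rightarrow> ('x, 'k) ring_scheme \<Rightarrow> bool" where
  "left_ideal J A \<longleftrightarrow>
     subgroup J (add_monoid A) \<and> (\<forall>a\<in>carrier A. \<forall>x\<in>J. a \<otimes>\<^bsub>A\<^esub> x \<in> J)"

definition principal_left_ideal :: "('x, 'k) ring_scheme \<Rightarrow> 'x \<Rightarrow> 'x set \<Rightarrow> bool" where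
  "principal_left_ideal A g J \<longleftrightarrow>
     g \<in> carrier A \<and> left_ideal J A \<and> J = {h \<otimes>\<^bsub>A\<^esub> g | h. h \<in> carrier A}"


section \<open>Reduction\<close>

text \<open>
  The quotient \<open>\<Lambda>/\<pp>\<Lambda>\<close> below is the library's \<^const>\<open>FactRing\<close>, whose operations on cosets make
  sense without associativity.
\<close>

definition ideal_times :: "'s set \<Rightarrow> ('s, 'x, 'k) module_scheme \<Rightarrow> 'x set" where
  "ideal_times P A = generate (add_monoid A) {a \<odot>\<^bsub>A\<^esub> x | a x. a \<in> P \<and> x \<in> carrier A}"

definition induced_map :: "('s, 'k) ring_scheme \<Rightarrow> 's set \<Rightarrow> ('s \<Rightarrow> 's) \<Rightarrow> 's set \<Rightarrow> 's set" where
  "induced_map S P \<sigma> B = (\<Union>b\<in>B. P +>\<^bsub>S\<^esub> \<sigma> b)"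

definition reduce_poly :: "('s, 'k) ring_scheme \<Rightarrow> 's set \<Rightarrow> (nat \<Rightarrow> 's) \<Rightarrow> nat \<Rightarrow> 's set" where
  "reduce_poly S P g = (\<lambda>i. P +>\<^bsub>S\<^esub> g i)"

text \<open>The map on cosets induced by \<open>h\<close>, which is constant on the cosets it is used for.\<close>

definition on_cosets :: "('x \<Rightarrow> 'y) \<Rightarrow> 'x set \<Rightarrow> 'y" where
  "on_cosets h B = the_elem (h ` B)"


section \<open>Modules, bases and lattices\<close>

definition lin_comb ::
    "('x, 'k) ring_scheme \<Rightarrow> ('s \<Rightarrow> 'x \<Rightarrow> 'x) \<Rightarrow> nat \<Rightarrow> (nat \<Rightarrow> 's) \<Rightarrow> (nat \<Rightarrow> 'x) \<Rightarrow> 'x" where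
  "lin_comb A act n c b = (\<Oplus>\<^bsub>A\<^esub>i\<in>{..<n}. act (c i) (b i))"

definition is_basis :: "'s set \<Rightarrow> ('s, 'x, 'k) module_scheme \<Rightarrow> nat \<Rightarrow> (nat \<Rightarrow> 'x) \<Rightarrow> bool" where
  "is_basis R A n b \<longleftrightarrow>
     (\<forall>i<n. b i \<in> carrier A) \<and>
     (\<forall>x\<in>carrier A. \<exists>!c. c \<in> {..<n} \<rightarrow>\<^sub>E R \<and> x = lin_comb A (module.smult A) n c b)"

definition free_of_rank :: "'s set \<Rightarrow> ('s, 'x, 'k) module_scheme \<Rightarrow> nat \<Rightarrow> bool" where
  "free_of_rank R A n \<longleftrightarrow> (\<exists>b. is_basis R A n b)"

definition fin_gen :: "'s set \<Rightarrow> ('s, 'x, 'k) module_scheme \<Rightarrow> bool" where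
  "fin_gen R A \<longleftrightarrow>
     (\<exists>n b. (\<forall>i<n. b i \<in> carrier A) \<and>
        (\<forall>x\<in>carrier A. \<exists>c\<in>{..<n} \<rightarrow>\<^sub>E R. x = lin_comb A (module.smult A) n c b))"

definition linear_iso ::
    "('s, 'k) ring_scheme \<Rightarrow> ('s, 'x, 'l) module_scheme \<Rightarrow> ('s, 'y, 'm) module_scheme \<Rightarrow>
     ('x \<Rightarrow> 'y) \<Rightarrow> bool" where
  "linear_iso E A B \<theta> \<longleftrightarrow>
     bij_betw \<theta> (carrier A) (carrier B) \<and>
     (\<forall>x\<in>carrier A. \<forall>y\<in>carrier A. \<theta> (x \<oplus>\<^bsub>A\<^esub> y) = \<theta> x \<oplus>\<^bsub>B\<^esub> \<theta> y) \<and>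
     (\<forall>a\<in>carrier E. \<forall>x\<in>carrier A. \<theta> (a \<odot>\<^bsub>A\<^esub> x) = a \<odot>\<^bsub>B\<^esub> \<theta> x)"

definition self_module :: "('s, 'k) ring_scheme \<Rightarrow> ('s, 's) module" where
  "self_module S =
     \<lparr>carrier = carrier S, monoid.mult = monoid.mult S, one = \<one>\<^bsub>S\<^esub>, ring.zero = \<zero>\<^bsub>S\<^esub>,
      add = add S, module.smult = monoid.mult S\<rparr>"

text \<open>The free module \<open>S\<^sup>n\<close>, with componentwise operations.\<close>

definition vec :: "('s, 'k) ring_scheme \<Rightarrow> nat \<Rightarrow> ('s, nat \<Rightarrow> 's) module" where
  "vec S n =
     \<lparr>carrier = {..<n} \<rightarrow>\<^sub>E carrier S,
      monoid.mult = (\<lambda>v w. \<lambda>i\<in>{..<n}. v i \<otimes>\<^bsub>S\<^esub> w i),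
      one = (\<lambda>i\<in>{..<n}. \<one>\<^bsub>S\<^esub>),
      ring.zero = (\<lambda>i\<in>{..<n}. \<zero>\<^bsub>S\<^esub>),
      add = (\<lambda>v w. \<lambda>i\<in>{..<n}. v i \<oplus>\<^bsub>S\<^esub> w i),
      module.smult = (\<lambda>a v. \<lambda>i\<in>{..<n}. a \<otimes>\<^bsub>S\<^esub> v i)\<rparr>"

definition pull_scalars :: "('t \<Rightarrow> 's) \<Rightarrow> ('s, 'x) module \<Rightarrow> ('t, 'x) module" where
  "pull_scalars \<phi> A =
     \<lparr>carrier = carrier A, monoid.mult = monoid.mult A, one = \<one>\<^bsub>A\<^esub>, ring.zero = \<zero>\<^bsub>A\<^esub>,
      add = add A, module.smult = (\<lambda>a. module.smult A (\<phi> a))\<rparr>"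

definition unital_algebra :: "('s, 'k) ring_scheme \<Rightarrow> ('s, 'x, 'l) module_scheme \<Rightarrow> bool" where
  "unital_algebra E A \<longleftrightarrow>
     Module.module E A \<and>
     \<one>\<^bsub>A\<^esub> \<in> carrier A \<and>
     (\<forall>x\<in>carrier A. \<one>\<^bsub>A\<^esub> \<otimes>\<^bsub>A\<^esub> x = x \<and> x \<otimes>\<^bsub>A\<^esub> \<one>\<^bsub>A\<^esub> = x) \<and>
     (\<forall>x\<in>carrier A. \<forall>y\<in>carrier A. x \<otimes>\<^bsub>A\<^esub> y \<in> carrier A) \<and>
     (\<forall>x\<in>carrier A. \<forall>y\<in>carrier A. \<forall>z\<in>carrier A.
        (x \<oplus>\<^bsub>A\<^esub> y) \<otimes>\<^bsub>A\<^esub> z = (x \<otimes>\<^bsub>A\<^esub> z) \<oplus>\<^bsub>A\<^esub> (y \<otimes>\<^bsub>A\<^esub> z) \<and>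
        z \<otimes>\<^bsub>A\<^esub> (x \<oplus>\<^bsub>A\<^esub> y) = (z \<otimes>\<^bsub>A\<^esub> x) \<oplus>\<^bsub>A\<^esub> (z \<otimes>\<^bsub>A\<^esub> y)) \<and>
     (\<forall>a\<in>carrier E. \<forall>x\<in>carrier A. \<forall>y\<in>carrier A.
        (a \<odot>\<^bsub>A\<^esub> x) \<otimes>\<^bsub>A\<^esub> y = a \<odot>\<^bsub>A\<^esub> (x \<otimes>\<^bsub>A\<^esub> y) \<and>
        x \<otimes>\<^bsub>A\<^esub> (a \<odot>\<^bsub>A\<^esub> y) = a \<odot>\<^bsub>A\<^esub> (x \<otimes>\<^bsub>A\<^esub> y))"

text \<open>
  \<open>L\<close> is an \<open>R\<close>-lattice in the finite-dimensional unital \<open>E\<close>-algebra \<open>A\<close>, where \<open>R \<subseteq> E\<close> is a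
  Noetherian domain with quotient field \<open>E\<close>.  These standing requirements are part of the
  predicate; finite dimension follows from the last conjunct.
\<close>

definition is_lattice ::
    "'s set \<Rightarrow> ('s, 'k) ring_scheme \<Rightarrow> ('s, 'x, 'l) module_scheme \<Rightarrow> 'x set \<Rightarrow> bool" where
  "is_lattice R E A L \<longleftrightarrow>
     Ring.field E \<and> subring R E \<and> noetherian_domain (E\<lparr>carrier := R\<rparr>) \<and>
     (\<forall>x\<in>carrier E. \<exists>a\<in>R. \<exists>b\<in>R - {\<zero>\<^bsub>E\<^esub>}. x \<otimes>\<^bsub>E\<^esub> b = a) \<and>
     unital_algebra E A \<and>
     submodule L (E\<lparr>carrier := R\<rparr>) A \<and>
     fin_gen R (A\<lparr>carrier := L\<rparr>) \<and>
     (\<exists>n b. is_basis (carrier E) A n b \<and> (\<forall>i<n. b i \<in> L))"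

text \<open>
  The algebra \<open>A\<close> determines an embedding of \<open>L\<close> into \<open>E\<^sup>N\<close> as a lattice: coordinates of \<open>A\<close> over
  \<open>E\<close> exist, and whichever are chosen, they carry \<open>L\<close> to a lattice in \<open>E\<^sup>N\<close>.
\<close>

definition embeds_as_lattice ::
    "'s set \<Rightarrow> ('s, 'k) ring_scheme \<Rightarrow> ('s, 'x, 'l) module_scheme \<Rightarrow> 'x set \<Rightarrow> nat \<Rightarrow> bool" where
  "embeds_as_lattice R E A L N \<longleftrightarrow>
     (\<exists>\<theta>. linear_iso E A (vec E N) \<theta>) \<and>
     (\<forall>\<theta>. linear_iso E A (vec E N) \<theta> \<longrightarrow> is_lattice R E (vec E N) (\<theta> ` L))"

definition full_lattice_of_rank ::
    "'s set \<Rightarrow> ('s, 'k) ring_scheme \<Rightarrow> ('s, 'x, 'l) module_scheme \<Rightarrow> 'x set \<Rightarrow> nat \<Rightarrow> bool" where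
  "full_lattice_of_rank R E A L N \<longleftrightarrow>
     is_lattice R E A L \<and> free_of_rank R (A\<lparr>carrier := L\<rparr>) N \<and> embeds_as_lattice R E A L N"


section \<open>Codes\<close>

definition coords :: "nat \<Rightarrow> (nat \<Rightarrow> 's) \<Rightarrow> nat \<Rightarrow> 's" where
  "coords m h = restrict h {..<m}"

definition linear_code :: "('s, 'k) ring_scheme \<Rightarrow> nat \<Rightarrow> (nat \<Rightarrow> 's) set \<Rightarrow> bool" where
  "linear_code S m C \<longleftrightarrow> submodule C S (vec S m)"

text \<open>The code of length \<open>deg f\<close> generated by the monic right divisor \<open>g\<close> of \<open>f\<close>.\<close>

definition cyclic_code_gen_by ::
    "('s, 'k) ring_scheme \<Rightarrow> ('s \<Rightarrow> 's) \<Rightarrow> (nat \<Rightarrow> 's) \<Rightarrow> (nat \<Rightarrow> 's) \<Rightarrow> (nat \<Rightarrow> 's) set \<Rightarrow> bool" where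
  "cyclic_code_gen_by S \<sigma> f g C \<longleftrightarrow>
     monic_poly S g \<and> right_divides S \<sigma> g f \<and>
     (\<exists>J. principal_left_ideal (petit S \<sigma> f) g J \<and> C = coords (deg S f) ` J)"

definition cyclic_code ::
    "('s, 'k) ring_scheme \<Rightarrow> ('s \<Rightarrow> 's) \<Rightarrow> (nat \<Rightarrow> 's) \<Rightarrow> (nat \<Rightarrow> 's) set \<Rightarrow> bool" where
  "cyclic_code S \<sigma> f C \<longleftrightarrow> (\<exists>g. cyclic_code_gen_by S \<sigma> f g C)"

definition code_dimension :: "('s, 'k) ring_scheme \<Rightarrow> nat \<Rightarrow> (nat \<Rightarrow> 's) set \<Rightarrow> nat \<Rightarrow> bool" where
  "code_dimension S m C k \<longleftrightarrow> free_of_rank (carrier S) ((vec S m)\<lparr>carrier := C\<rparr>) k"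

end

theory Submission
  imports Defs
begin

text \<open>
  Right division by the monic \<open>f\<close> commutes with reduction, so reduction is a homomorphism of Petit
  rings, with kernel \<open>\<pp>\<Lambda>\<close>, and carries principal left ideals to principal left ideals.

  Let \<open>E\<close> be a complete field with nontrivial absolute value inside \<open>F\<close>, with valuation ring \<open>R\<close> and
  uniformizer \<open>\<varpi>\<close>.  As \<open>\<O>\<^sub>K/\<varpi>\<O>\<^sub>K\<close> is finite, a minimal generating set of it over \<open>R\<close> lifts, by
  successive approximation, to an \<open>R\<close>-basis of \<open>\<O>\<^sub>K\<close>, which is also an \<open>E\<close>-basis of \<open>K\<close>.  For \<open>E = F\<close>
  this gives \<open>\<sigma>(\<O>\<^sub>K) \<subseteq> \<O>\<^sub>K\<close>.  Since \<open>\<varpi>\<Lambda> \<subseteq> L \<subseteq> \<Lambda>\<close>, a triangular choice of vectors is at the same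
  time an \<open>R\<close>-basis of \<open>L\<close> and an \<open>E\<close>-basis of \<open>S\<^sub>f\<close>.  The three lattice statements are the cases
  where \<open>E\<close> is \<open>F\<close>, the \<open>p\<close>-adic numbers, and a field of Laurent series.
\<close>


section \<open>Skew polynomials and division with remainder\<close>

text \<open>Two products have to be handled without associativity. That of S_f need not satisfy it.
  For skew polynomials it is established only for left factors that are scalars or t, and everything
  else is reduced to these by peeling off the left factor. The coefficient rings are K, O_K and
  O_K/pO_K. The last one has zero divisors when K/F is ramified, so arguments about degrees rest on
  the modulus being monic, never on cancellation. The field E is attached to K by an embedding
  \<phi> instead of being a subset, because in the Laurent series case the scalars form a type of
  their own. For subfields \<phi> is the identity function. That \<sigma> preserves O_K is derived
  from a finite generating set of O_K over O_F, so the arithmetic of the extension has to come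
  before \<Lambda> can even be treated as a Petit ring.\<close>

locale skew_polynomials = S?: cring S for S (structure) +
  fixes \<sigma>
  assumes sigma_hom: "\<sigma> \<in> ring_hom S S"
begin

abbreviation skew_mult (infixl \<open>\<star>\<close> 70) where
  "p \<star> q \<equiv> p \<otimes>\<^bsub>skew_poly_ring S \<sigma>\<^esub> q"

lemma skew_mult_coeff:
  "(p \<star> q) n = (\<Oplus>i\<in>{..n}. p i \<otimes> (\<sigma> ^^ i) (q (n - i)))"
  by (simp add: skew_poly_ring_def)

lemma skew_carrier: "carrier (skew_poly_ring S \<sigma>) = up S"
  and skew_add: "p \<oplus>\<^bsub>skew_poly_ring S \<sigma>\<^esub> q = (\<lambda>i. p i \<oplus> q i)"
  by (simp_all add: skew_poly_ring_def)

lemma sigma_pow_hom: "\<sigma> ^^ i \<in> ring_hom S S"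
proof (induction i)
  case 0
  show ?case by (auto intro!: ring_hom_memI)
next
  case (Suc i)
  then show ?case
    using ring_hom_trans[OF Suc sigma_hom] by (simp add: comp_def)
qed

lemma sigma_pow_closed [simp]: "x \<in> carrier S \<Longrightarrow> (\<sigma> ^^ i) x \<in> carrier S"
  using sigma_pow_hom ring_hom_closed by metis

lemma sigma_pow_mult:
    "x \<in> carrier S \<Longrightarrow> y \<in> carrier S \<Longrightarrow> (\<sigma> ^^ i) (x \<otimes> y) = (\<sigma> ^^ i) x \<otimes> (\<sigma> ^^ i) y"
  and sigma_pow_add:
    "x \<in> carrier S \<Longrightarrow> y \<in> carrier S \<Longrightarrow> (\<sigma> ^^ i) (x \<oplus> y) = (\<sigma> ^^ i) x \<oplus> (\<sigma> ^^ i) y"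
  and sigma_pow_one: "(\<sigma> ^^ i) \<one> = \<one>"
  using sigma_pow_hom[of i] by (auto simp: ring_hom_def)

lemma sigma_pow_zero: "(\<sigma> ^^ i) \<zero> = \<zero>"
  using ring_hom_zero[OF sigma_pow_hom] ring_axioms by blast

lemma sigma_closed [simp]: "x \<in> carrier S \<Longrightarrow> \<sigma> x \<in> carrier S"
  using sigma_pow_closed[of x 1] by simp

lemma sigma_zero: "\<sigma> \<zero> = \<zero>"
  using sigma_pow_zero[of 1] by simp

lemma sigma_pow_fixed: "\<sigma> a = a \<Longrightarrow> (\<sigma> ^^ i) a = a"
  by (induction i) auto

lemma up_coeff_closed [simp]: "p \<in> up S \<Longrightarrow> p n \<in> carrier S"
  by (rule mem_upD)

lemma up_bound: "p \<in> up S \<Longrightarrow> \<exists>n. \<forall>i\<ge>n. p i = \<zero>"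
  using bound_upD[of p] by (metis Suc_le_eq bound.bound)

lemma up_intro: "(\<And>i. p i \<in> carrier S) \<Longrightarrow> (\<And>i. i \<ge> n \<Longrightarrow> p i = \<zero>) \<Longrightarrow> p \<in> up S"
  by (rule mem_upI) (auto intro!: exI[of _ n] bound.intro)

lemma up_zero [simp]: "(\<lambda>i. \<zero>) \<in> up S"
  by (rule up_intro[of _ 0]) auto

text \<open>The exponents that occur are at most a - 1 and b - 1, so the product stops at a + b - 2;
  hence the bound \<open>n + 1 \<ge> a + b\<close>.\<close>

lemma skew_mult_coeff_zero:
  assumes "p \<in> up S" "q \<in> up S" "\<And>i. i \<ge> a \<Longrightarrow> p i = \<zero>" "\<And>i. i \<ge> b \<Longrightarrow> q i = \<zero>" "n + 1 \<ge> a + b"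
  shows "(p \<star> q) n = \<zero>"
proof -
  have "p i \<otimes> (\<sigma> ^^ i) (q (n - i)) = \<zero>" if "i \<le> n" for i
  proof (cases "i \<ge> a")
    case True
    then show ?thesis using assms by simp
  next
    case False
    then have "n - i \<ge> b" using assms(5) that by linarith
    then show ?thesis using assms by (simp add: sigma_pow_zero)
  qed
  then have "(p \<star> q) n = (\<Oplus>i\<in>{..n}. \<zero>)"
    unfolding skew_mult_coeff by (intro finsum_cong') auto
  then show ?thesis by simp
qed

lemma skew_mult_closed [simp]:
  assumes "p \<in> up S" "q \<in> up S"
  shows "p \<star> q \<in> up S"
proof -
  obtain a b where "\<forall>i\<ge>a. p i = \<zero>" "\<forall>i\<ge>b. q i = \<zero>"
    using up_bound assms by metis
  then show ?thesis
    using assms by (intro up_intro[of _ "a + b"]) (auto simp: skew_mult_coeff intro!: skew_mult_coeff_zero[of _ _ a b, unfolded skew_mult_coeff])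
qed

lemma skew_distrib_right:
  assumes "p \<in> up S" "q \<in> up S" "r \<in> up S"
  shows "(\<lambda>i. p i \<oplus> q i) \<star> r = (\<lambda>i. (p \<star> r) i \<oplus> (q \<star> r) i)"
proof
  fix n
  have "((\<lambda>i. p i \<oplus> q i) \<star> r) n =
      (\<Oplus>i\<in>{..n}. (p i \<otimes> (\<sigma> ^^ i) (r (n - i))) \<oplus> (q i \<otimes> (\<sigma> ^^ i) (r (n - i))))"
    unfolding skew_mult_coeff using assms by (intro finsum_cong') (auto simp: l_distr)
  then show "((\<lambda>i. p i \<oplus> q i) \<star> r) n = (p \<star> r) n \<oplus> (q \<star> r) n"
    using assms by (simp add: finsum_addf skew_mult_coeff)
qed

lemma skew_distrib_left:
  assumes "p \<in> up S" "q \<in> up S" "r \<in> up S"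
  shows "r \<star> (\<lambda>i. p i \<oplus> q i) = (\<lambda>i. (r \<star> p) i \<oplus> (r \<star> q) i)"
proof
  fix n
  have "(r \<star> (\<lambda>i. p i \<oplus> q i)) n =
      (\<Oplus>i\<in>{..n}. (r i \<otimes> (\<sigma> ^^ i) (p (n - i))) \<oplus> (r i \<otimes> (\<sigma> ^^ i) (q (n - i))))"
    unfolding skew_mult_coeff using assms
    by (intro finsum_cong') (auto simp: r_distr sigma_pow_add)
  then show "(r \<star> (\<lambda>i. p i \<oplus> q i)) n = (r \<star> p) n \<oplus> (r \<star> q) n"
    using assms by (simp add: finsum_addf skew_mult_coeff)
qed

lemma skew_smult_left:
  assumes "a \<in> carrier S" "p \<in> up S" "q \<in> up S"
  shows "(\<lambda>i. a \<otimes> p i) \<star> q = (\<lambda>i. a \<otimes> (p \<star> q) i)"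
proof
  fix n
  have "((\<lambda>i. a \<otimes> p i) \<star> q) n = (\<Oplus>i\<in>{..n}. a \<otimes> (p i \<otimes> (\<sigma> ^^ i) (q (n - i))))"
    unfolding skew_mult_coeff using assms by (intro finsum_cong') (auto simp: m_assoc)
  then show "((\<lambda>i. a \<otimes> p i) \<star> q) n = a \<otimes> (p \<star> q) n"
    using assms by (simp add: finsum_rdistr skew_mult_coeff)
qed

lemma skew_smult_right:
  assumes "a \<in> carrier S" "\<sigma> a = a" "p \<in> up S" "q \<in> up S"
  shows "p \<star> (\<lambda>i. a \<otimes> q i) = (\<lambda>i. a \<otimes> (p \<star> q) i)"
proof
  fix n
  have "(p \<star> (\<lambda>i. a \<otimes> q i)) n = (\<Oplus>i\<in>{..n}. a \<otimes> (p i \<otimes> (\<sigma> ^^ i) (q (n - i))))"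
    unfolding skew_mult_coeff using assms
    by (intro finsum_cong') (auto simp: m_lcomm sigma_pow_mult sigma_pow_fixed)
  then show "(p \<star> (\<lambda>i. a \<otimes> q i)) n = a \<otimes> (p \<star> q) n"
    using assms by (simp add: finsum_rdistr skew_mult_coeff)
qed

lemma skew_mult_zero_left: "q \<in> up S \<Longrightarrow> (\<lambda>i. \<zero>) \<star> q = (\<lambda>i. \<zero>)"
  using skew_smult_left[of \<zero> "\<lambda>i. \<zero>" q] by simp

lemma finsum_single_index:
  assumes "k \<in> A" "finite A" "h \<in> A \<rightarrow> carrier S" "\<And>i. i \<in> A \<Longrightarrow> i \<noteq> k \<Longrightarrow> h i = \<zero>"
  shows "(\<Oplus>i\<in>A. h i) = h k"
proof -
  have "(\<Oplus>i\<in>A. h i) = (\<Oplus>i\<in>A. if k = i then h i else \<zero>)"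
    using assms by (intro finsum_cong') (auto simp: Pi_def)
  then show ?thesis
    using finsum_singleton[OF assms(1,2), of h] assms(3) by simp
qed

text \<open>Only the pair of exponents (d, m) contributes. For monic \<open>q\<close> the twisted
  factor is the image of 1, which is 1, so the leading coefficient of \<open>p\<close> survives even
  over a ring with zero divisors.\<close>

lemma skew_mult_coeff_top:
  assumes "p \<in> up S" "q \<in> up S" "\<And>i. i > d \<Longrightarrow> p i = \<zero>" "\<And>i. i > m \<Longrightarrow> q i = \<zero>"
  shows "(p \<star> q) (d + m) = p d \<otimes> (\<sigma> ^^ d) (q m)"
proof -
  have "p i \<otimes> (\<sigma> ^^ i) (q (d + m - i)) = \<zero>" if "i \<le> d + m" "i \<noteq> d" for i
  proof (cases "i > d")
    case True
    then show ?thesis using assms by simp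
  next
    case False
    then have "d + m - i > m" using that by simp
    then show ?thesis using assms by (simp add: sigma_pow_zero)
  qed
  then show ?thesis
    unfolding skew_mult_coeff
    using finsum_single_index[of d "{..d+m}" "\<lambda>i. p i \<otimes> (\<sigma> ^^ i) (q (d + m - i))"] assms
    by auto
qed

definition term_poly :: "'a \<Rightarrow> nat \<Rightarrow> nat \<Rightarrow> 'a" where
  "term_poly a k = (\<lambda>i. if i = k then a else \<zero>)"

lemma term_poly_closed [simp]: "a \<in> carrier S \<Longrightarrow> term_poly a k \<in> up S"
  by (rule up_intro[of _ "Suc k"]) (auto simp: term_poly_def)

lemma term_mult_coeff:
  assumes "a \<in> carrier S" "q \<in> up S"
  shows "(term_poly a k \<star> q) n = (if k \<le> n then a \<otimes> (\<sigma> ^^ k) (q (n - k)) else \<zero>)"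
proof (cases "k \<le> n")
  case True
  then show ?thesis
    unfolding skew_mult_coeff
    using finsum_single_index[of k "{..n}" "\<lambda>i. term_poly a k i \<otimes> (\<sigma> ^^ i) (q (n - i))"] assms
    by (auto simp: term_poly_def)
next
  case False
  then have "(term_poly a k \<star> q) n = (\<Oplus>i\<in>{..n}. \<zero>)"
    unfolding skew_mult_coeff using assms
    by (intro finsum_cong') (auto simp: term_poly_def)
  then show ?thesis using False by simp
qed

lemma const_poly_eq_term: "const_poly S a = term_poly a 0"
  by (simp add: const_poly_def term_poly_def)

lemma const_mult: "a \<in> carrier S \<Longrightarrow> q \<in> up S \<Longrightarrow> const_poly S a \<star> q = (\<lambda>i. a \<otimes> q i)"
  by (rule ext) (simp add: const_poly_eq_term term_mult_coeff)

lemma mult_const: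
  assumes "a \<in> carrier S" "\<sigma> a = a" "p \<in> up S"
  shows "p \<star> const_poly S a = (\<lambda>i. a \<otimes> p i)"
proof
  fix n
  show "(p \<star> const_poly S a) n = a \<otimes> p n"
    unfolding skew_mult_coeff
    using finsum_single_index[of n "{..n}" "\<lambda>i. p i \<otimes> (\<sigma> ^^ i) (const_poly S a (n - i))"] assms
    by (auto simp: const_poly_def sigma_pow_zero sigma_pow_fixed m_comm)
qed

text \<open>Left multiplication by t, spelled out through the rule
  \<open>t a = \<sigma>(a) t\<close>.\<close>

definition skew_shift :: "(nat \<Rightarrow> 'a) \<Rightarrow> nat \<Rightarrow> 'a" where
  "skew_shift p = (\<lambda>i. case i of 0 \<Rightarrow> \<zero> | Suc j \<Rightarrow> \<sigma> (p j))"

lemma skew_shift_closed [simp]: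
  assumes "p \<in> up S"
  shows "skew_shift p \<in> up S"
proof -
  obtain a where "\<forall>i\<ge>a. p i = \<zero>" using up_bound assms by metis
  then show ?thesis
    using assms
    by (intro up_intro[of _ "Suc a"]) (auto simp: skew_shift_def sigma_zero split: nat.split)
qed

text \<open>This is \<open>(t p) q = t (p q)\<close>: as a homomorphism, \<sigma> passes through the
  convolution sum. Together with \<open>skew_smult_left\<close> it provides the associativity needed
  to verify the closure conditions of \<open>skew_mult_mem\<close>.\<close>

lemma skew_shift_mult:
  assumes "p \<in> up S" "q \<in> up S"
  shows "skew_shift p \<star> q = skew_shift (p \<star> q)"
proof
  interpret hom: ring_hom_cring S S \<sigma>
    using sigma_hom by (simp add: ring_hom_cring_def ring_hom_cring_axioms_def is_cring)
  fix n
  show "(skew_shift p \<star> q) n = skew_shift (p \<star> q) n"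
  proof (cases n)
    case 0
    then show ?thesis using assms by (simp add: skew_mult_coeff skew_shift_def)
  next
    case (Suc k)
    have "(skew_shift p \<star> q) n = (\<Oplus>i\<in>{..k}. \<sigma> (p i) \<otimes> \<sigma> ((\<sigma> ^^ i) (q (k - i))))"
      unfolding skew_mult_coeff Suc using assms
      by (subst finsum_Suc2) (auto simp: skew_shift_def split: nat.split)
    also have "\<dots> = \<sigma> ((p \<star> q) k)"
      using assms by (subst skew_mult_coeff, subst hom.hom_finsum) (auto simp: comp_def intro!: finsum_cong')
    finally show ?thesis by (simp add: Suc skew_shift_def)
  qed
qed

text \<open>Horner's rule: writing \<open>q = q_0 + q' t\<close> turns \<open>q p\<close> into
  \<open>q_0 p + q' (t p)\<close>, a recursion that shortens the left factor.\<close>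

lemma skew_mult_unfold:
  assumes "q \<in> up S" "p \<in> up S"
  shows "q \<star> p = (\<lambda>n. q 0 \<otimes> p n \<oplus> ((\<lambda>i. q (Suc i)) \<star> skew_shift p) n)"
proof
  fix n
  show "(q \<star> p) n = q 0 \<otimes> p n \<oplus> ((\<lambda>i. q (Suc i)) \<star> skew_shift p) n"
  proof (cases n)
    case 0
    then show ?thesis using assms by (simp add: skew_mult_coeff skew_shift_def)
  next
    case (Suc k)
    have 1: "(q \<star> p) n = (\<Oplus>i\<in>{..k}. q (Suc i) \<otimes> \<sigma> ((\<sigma> ^^ i) (p (k - i)))) \<oplus> q 0 \<otimes> p (Suc k)"
      unfolding skew_mult_coeff Suc using assms by (subst finsum_Suc2) auto
    have "((\<lambda>i. q (Suc i)) \<star> skew_shift p) n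
        = (\<Oplus>i\<in>{..k}. q (Suc i) \<otimes> (\<sigma> ^^ i) (skew_shift p (Suc k - i)))"
      unfolding skew_mult_coeff Suc using assms
      by (subst finsum_Suc) (auto simp: skew_shift_def sigma_pow_zero sigma_zero split: nat.split)
    also have "\<dots> = (\<Oplus>i\<in>{..k}. q (Suc i) \<otimes> \<sigma> ((\<sigma> ^^ i) (p (k - i))))"
      using assms
      by (intro finsum_cong') (auto simp: skew_shift_def Suc_diff_le funpow_swap1)
    finally show ?thesis using 1 assms by (simp add: Suc a_comm)
  qed
qed

text \<open>Induction on the left factor replaces associativity of the multiplication.\<close>

lemma skew_mult_mem:
  assumes W: "W \<subseteq> up S" "\<And>x y. x \<in> W \<Longrightarrow> y \<in> W \<Longrightarrow> (\<lambda>i. x i \<oplus> y i) \<in> W"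
      "\<And>a x. a \<in> carrier S \<Longrightarrow> x \<in> W \<Longrightarrow> (\<lambda>i. a \<otimes> x i) \<in> W" "\<And>x. x \<in> W \<Longrightarrow> skew_shift x \<in> W"
    and "q \<in> up S" "p \<in> W"
  shows "q \<star> p \<in> W"
proof -
  have "q \<star> p \<in> W" if "q \<in> up S" "\<forall>i\<ge>n. q i = \<zero>" "p \<in> W" for n
    using that
  proof (induction n arbitrary: q p)
    case 0
    then have q: "q = (\<lambda>i. \<zero>)" by (intro ext) simp
    have p: "p \<in> up S" using 0 W(1) by blast
    then have "q \<star> p = (\<lambda>i. \<zero> \<otimes> p i)" by (simp add: q skew_mult_zero_left)
    then show ?case using W(3)[OF zero_closed 0(3)] by (simp only:)
  next
    case (Suc n)
    have q: "(\<lambda>i. q (Suc i)) \<in> up S" "\<forall>i\<ge>n. q (Suc i) = \<zero>"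
      using Suc.prems by (auto intro!: up_intro[of _ n])
    have "(\<lambda>i. q (Suc i)) \<star> skew_shift p \<in> W"
      by (rule Suc.IH[OF q]) (use W Suc.prems in auto)
    moreover have "(\<lambda>i. q 0 \<otimes> p i) \<in> W" using W Suc.prems by auto
    ultimately show ?case
      using W(2) skew_mult_unfold[of q p] Suc.prems W(1) by auto
  qed
  then show ?thesis using up_bound assms by metis
qed

end

section \<open>Degrees of coefficient functions\<close>

lemma deg_up: "h \<in> up R \<Longrightarrow> deg R h = (LEAST n. bound \<zero>\<^bsub>R\<^esub> n h)"
  by (simp add: deg_def UP_def)

lemma (in cring) degree_props:
  assumes "h \<in> up R"
  shows "\<And>i. i > deg R h \<Longrightarrow> h i = \<zero>" "(\<exists>i. h i \<noteq> \<zero>) \<Longrightarrow> h (deg R h) \<noteq> \<zero>"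
proof -
  have "bound \<zero> (deg R h) h"
    unfolding deg_up[OF assms] using bound_upD[OF assms] by (metis LeastI_ex)
  then show 1: "\<And>i. i > deg R h \<Longrightarrow> h i = \<zero>" by (simp add: bound.bound)
  assume "\<exists>i. h i \<noteq> \<zero>"
  show "h (deg R h) \<noteq> \<zero>"
  proof
    assume z: "h (deg R h) = \<zero>"
    obtain i where i: "h i \<noteq> \<zero>" using \<open>\<exists>i. h i \<noteq> \<zero>\<close> by blast
    have "deg R h \<noteq> 0" using i 1 z by (metis neq0_conv)
    \<comment> \<open>A vanishing top coefficient would allow a bound smaller by one, against the
      minimality in the definition of the degree. The degree is positive here, so the subtraction is
      a proper one.\<close>
    have "bound \<zero> (deg R h - 1) h"
    proof
      fix j assume "deg R h - 1 < j"
      then show "h j = \<zero>" using 1[of j] z by (cases "j = deg R h") auto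
    qed
    then have "deg R h \<le> deg R h - 1" unfolding deg_up[OF assms] by (rule Least_le)
    then show False using \<open>deg R h \<noteq> 0\<close> by simp
  qed
qed

lemma (in cring) degree_eqI:
  assumes "h \<in> up R" "\<And>i. i > n \<Longrightarrow> h i = \<zero>" "h n \<noteq> \<zero>"
  shows "deg R h = n"
  unfolding deg_up[OF assms(1)] using assms
  by (intro Least_equality) (auto intro: bound.intro simp: bound_below)

section \<open>Right division by a monic polynomial\<close>

locale petit_algebra = skew_polynomials S \<sigma> for S (structure) and \<sigma> +
  fixes f m
  assumes monic: "monic_poly S f" and degree: "deg S f = m"
begin

lemma f_closed [simp]: "f \<in> up S"
  and f_above: "i > m \<Longrightarrow> f i = \<zero>"
  and f_top: "f m = \<one>"
  using monic degree degree_props(1)[of f] by (auto simp: monic_poly_def)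

abbreviation Below where "Below \<equiv> polys_below S m"

lemma below_up [simp]: "x \<in> Below \<Longrightarrow> x \<in> up S"
  and below_above: "x \<in> Below \<Longrightarrow> i \<ge> m \<Longrightarrow> x i = \<zero>"
  and below_coeff [simp]: "x \<in> Below \<Longrightarrow> x i \<in> carrier S"
  by (auto simp: polys_below_def)

lemma belowI: "(\<And>i. x i \<in> carrier S) \<Longrightarrow> (\<And>i. i \<ge> m \<Longrightarrow> x i = \<zero>) \<Longrightarrow> x \<in> Below"
  unfolding polys_below_def using up_intro[of x m] by blast

text \<open>The leading coefficient of \<open>h\<close> reappears m places higher in the product.
  Applied to \<open>f\<close> this gives uniqueness of division; applied to a monic divisor of
  \<open>f\<close> it bounds below the degrees in the ideal generated by that divisor.\<close>

lemma mult_monic_eq_zero: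
  assumes "h \<in> up S" "\<And>i. i \<ge> m \<Longrightarrow> (h \<star> f) i = \<zero>"
  shows "h = (\<lambda>i. \<zero>)"
proof (rule ccontr)
  assume "h \<noteq> (\<lambda>i. \<zero>)"
  then have "h (deg S h) \<noteq> \<zero>" using degree_props(2) assms(1) by (metis ext)
  moreover have "(h \<star> f) (deg S h + m) = h (deg S h)"
    using skew_mult_coeff_top[of h f "deg S h" m] assms(1) degree_props(1)[of h]
    by (simp add: f_above f_top sigma_pow_one)
  ultimately show False using assms(2)[of "deg S h + m"] by simp
qed

lemma division:
  assumes "h \<in> up S"
  shows "\<exists>q\<in>up S. \<exists>r\<in>Below. h = (\<lambda>i. (q \<star> f) i \<oplus> r i)"
proof -
  have "\<exists>q\<in>up S. \<exists>r\<in>Below. h = (\<lambda>i. (q \<star> f) i \<oplus> r i)"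
    if "h \<in> up S" "\<forall>i\<ge>n. h i = \<zero>" for n
    using that
  proof (induction n arbitrary: h)
    case 0
    then have "h = (\<lambda>i. ((\<lambda>i. \<zero>) \<star> f) i \<oplus> \<zero>)" by (auto simp: skew_mult_zero_left)
    then show ?case by (intro bexI[of _ "\<lambda>i. \<zero>"]) (auto intro: belowI)
  next
    case (Suc n)
    show ?case
    proof (cases "n < m")
      case True
      then have "h \<in> Below" using Suc.prems by (auto intro!: belowI)
      moreover have "h = (\<lambda>i. ((\<lambda>i. \<zero>) \<star> f) i \<oplus> h i)"
        using Suc.prems by (auto simp: skew_mult_zero_left)
      ultimately show ?thesis using up_zero by blast
    next
      case False
      \<comment> \<open>The twist does no harm: the coefficient of \<open>u \<star> f\<close> at
        \<open>n\<close> is \<open>h n\<close> times a power of \<sigma> applied to the leading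
        coefficient 1 of \<open>f\<close>, so subtracting it clears the top of
        \<open>h\<close>.\<close>
      define u where "u = term_poly (h n) (n - m)"
      define h' where "h' = (\<lambda>i. h i \<ominus> (u \<star> f) i)"
      have u: "u \<in> up S" and uf: "u \<star> f \<in> up S"
        using Suc.prems by (auto simp: u_def)
      have ufc: "(u \<star> f) i = (if n - m \<le> i then h n \<otimes> (\<sigma> ^^ (n - m)) (f (i - (n - m))) else \<zero>)" for i
        unfolding u_def using Suc.prems by (simp add: term_mult_coeff)
      have "h' i = \<zero>" if "i \<ge> n" for i
      proof (cases "i = n")
        case True
        have "n - (n - m) = m" using False by simp
        then show ?thesis
          using Suc.prems by (simp add: True h'_def ufc f_top sigma_pow_one r_neg a_minus_def)
      next
        case ne: False
        then have "i - (n - m) > m" using that False by simp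
        then show ?thesis
          using Suc.prems that ne by (simp add: h'_def ufc f_above sigma_pow_zero)
      qed
      moreover have "h' \<in> up S" unfolding h'_def using Suc.prems uf by (intro up_minus_closed) auto
      ultimately obtain q r where q: "q \<in> up S" "r \<in> Below" "h' = (\<lambda>i. (q \<star> f) i \<oplus> r i)"
        using Suc.IH[of h'] by blast
      have "h = (\<lambda>i. ((\<lambda>i. u i \<oplus> q i) \<star> f) i \<oplus> r i)"
      proof
        fix i
        have c: "h i \<in> carrier S" "(u \<star> f) i \<in> carrier S" "(q \<star> f) i \<in> carrier S" "r i \<in> carrier S"
          using Suc.prems uf q skew_mult_closed[of q f] by (auto simp del: skew_mult_closed)
        have "h i \<ominus> (u \<star> f) i = (q \<star> f) i \<oplus> r i"
          using fun_cong[OF q(3), of i] by (simp add: h'_def)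
        then have "h i = (u \<star> f) i \<oplus> ((q \<star> f) i \<oplus> r i)"
          using c by (metis a_minus_def add.inv_closed add.m_comm add.inv_solve_right' add.m_closed)
        then show "h i = ((\<lambda>i. u i \<oplus> q i) \<star> f) i \<oplus> r i"
          using u q c by (simp add: skew_distrib_right a_assoc)
      qed
      then show ?thesis
        using u q by (intro bexI[of _ "\<lambda>i. u i \<oplus> q i"] bexI[of _ r] up_add_closed) auto
    qed
  qed
  then show ?thesis using up_bound[OF assms] assms by blast
qed

text \<open>The difference of the quotients, multiplied by \<open>f\<close>, is a difference of
  remainders and therefore vanishes from degree m on; \<open>mult_monic_eq_zero\<close> then makes
  it zero.\<close>

lemma division_unique:
  assumes "q \<in> up S" "q' \<in> up S" "r \<in> Below" "r' \<in> Below"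
    and eq: "\<And>i. (q \<star> f) i \<oplus> r i = (q' \<star> f) i \<oplus> r' i"
  shows "r = r'" "q = q'"
proof -
  define d where "d = (\<lambda>i. q i \<ominus> q' i)"
  have d: "d \<in> up S" unfolding d_def using assms by (intro up_minus_closed)
  have "q = (\<lambda>i. d i \<oplus> q' i)"
    using assms(1,2) by (auto simp: d_def a_minus_def a_assoc l_neg)
  then have 1: "(q \<star> f) i = (d \<star> f) i \<oplus> (q' \<star> f) i" for i
    using skew_distrib_right[of d q' f] d assms by simp
  have c: "(d \<star> f) i \<in> carrier S" "(q' \<star> f) i \<in> carrier S" "r i \<in> carrier S" "r' i \<in> carrier S" for i
    using assms d by (auto simp: up_coeff_closed)
  have "(d \<star> f) i = \<zero>" if "i \<ge> m" for i
  proof -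
    have "(d \<star> f) i \<oplus> (q' \<star> f) i = (q' \<star> f) i"
      using eq[of i] c[of i] below_above[OF assms(3) that] below_above[OF assms(4) that] 1 by simp
    then show ?thesis using c[of i] by (metis add.r_cancel_one)
  qed
  then have z: "d = (\<lambda>i. \<zero>)" using mult_monic_eq_zero[OF d] by blast
  then have "q i = q' i" for i
    using fun_cong[OF z, of i] r_right_minus_eq[of "q i" "q' i"] assms(1,2)
    unfolding d_def by simp
  then show "q = q'" by blast
  then show "r = r'" using eq c by (metis (no_types) add.l_cancel ext)
qed

abbreviation rem where "rem \<equiv> mod_r S \<sigma> f"

lemma rem_eqI:
  assumes "q \<in> up S" "r \<in> Below" "h = (\<lambda>i. (q \<star> f) i \<oplus> r i)"
  shows "rem h = r"
  unfolding mod_r_def skew_carrier skew_add degree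
proof (rule the_equality)
  show "r \<in> Below \<and> (\<exists>q\<in>up S. h = (\<lambda>i. (q \<star> f) i \<oplus> r i))" using assms by blast
  show "r' = r" if "r' \<in> Below \<and> (\<exists>q\<in>up S. h = (\<lambda>i. (q \<star> f) i \<oplus> r' i))" for r'
    using that assms division_unique(1)[of _ q r' r] by (metis (no_types, lifting))
qed

lemma remE:
  assumes "h \<in> up S"
  obtains q where "q \<in> up S" "rem h \<in> Below" "h = (\<lambda>i. (q \<star> f) i \<oplus> rem h i)"
  using division[OF assms] rem_eqI by (metis (no_types))

lemma rem_closed [simp]: "h \<in> up S \<Longrightarrow> rem h \<in> Below"
  by (rule remE)

lemma rem_below:
  assumes "h \<in> Below"
  shows "rem h = h"
  by (rule rem_eqI[of "\<lambda>i. \<zero>"]) (use assms in \<open>auto simp: skew_mult_zero_left\<close>)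

lemma below_add: "x \<in> Below \<Longrightarrow> y \<in> Below \<Longrightarrow> (\<lambda>i. x i \<oplus> y i) \<in> Below"
  and below_smult: "a \<in> carrier S \<Longrightarrow> x \<in> Below \<Longrightarrow> (\<lambda>i. a \<otimes> x i) \<in> Below"
  and below_zero: "(\<lambda>i. \<zero>) \<in> Below"
  and below_neg: "x \<in> Below \<Longrightarrow> (\<lambda>i. \<ominus> x i) \<in> Below"
  by (auto intro!: belowI simp: below_above)

lemma rem_add:
  assumes "h \<in> up S" "k \<in> up S"
  shows "rem (\<lambda>i. h i \<oplus> k i) = (\<lambda>i. rem h i \<oplus> rem k i)"
proof -
  obtain q where q: "q \<in> up S" "rem h \<in> Below" "h = (\<lambda>i. (q \<star> f) i \<oplus> rem h i)"
    using remE assms by metis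
  obtain r where r: "r \<in> up S" "rem k \<in> Below" "k = (\<lambda>i. (r \<star> f) i \<oplus> rem k i)"
    using remE assms by metis
  have c: "(q \<star> f) i \<in> carrier S" "(r \<star> f) i \<in> carrier S" for i
    using q r by (auto simp: up_coeff_closed)
  show ?thesis
  proof (rule rem_eqI)
    show "(\<lambda>i. q i \<oplus> r i) \<in> up S" using q r by (intro up_add_closed)
    show "(\<lambda>i. rem h i \<oplus> rem k i) \<in> Below" using q r by (intro below_add)
    show "(\<lambda>i. h i \<oplus> k i) = (\<lambda>i. ((\<lambda>i. q i \<oplus> r i) \<star> f) i \<oplus> (rem h i \<oplus> rem k i))"
    proof
      fix i
      have "h i \<oplus> k i = ((q \<star> f) i \<oplus> rem h i) \<oplus> ((r \<star> f) i \<oplus> rem k i)"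
        using q(3) r(3) by metis
      then show "h i \<oplus> k i = ((\<lambda>i. q i \<oplus> r i) \<star> f) i \<oplus> (rem h i \<oplus> rem k i)"
        using q(1,2) r(1,2) c[of i] by (simp add: skew_distrib_right a_ac)
    qed
  qed
qed

text \<open>Scalars stand on the left and can be absorbed into the quotient:
  \<open>a (q f + r) = (a q) f + a r\<close>.\<close>

lemma rem_smult:
  assumes "a \<in> carrier S" "h \<in> up S"
  shows "rem (\<lambda>i. a \<otimes> h i) = (\<lambda>i. a \<otimes> rem h i)"
proof -
  obtain q where q: "q \<in> up S" "rem h \<in> Below" "h = (\<lambda>i. (q \<star> f) i \<oplus> rem h i)"
    using remE assms by metis
  have c: "(q \<star> f) i \<in> carrier S" for i
    using q by (auto simp: up_coeff_closed)
  show ?thesis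
  proof (rule rem_eqI)
    show "(\<lambda>i. a \<otimes> q i) \<in> up S" using q assms by (intro up_smult_closed)
    show "(\<lambda>i. a \<otimes> rem h i) \<in> Below" using q assms by (intro below_smult)
    show "(\<lambda>i. a \<otimes> h i) = (\<lambda>i. ((\<lambda>i. a \<otimes> q i) \<star> f) i \<oplus> a \<otimes> rem h i)"
    proof
      fix i
      have "a \<otimes> h i = a \<otimes> ((q \<star> f) i \<oplus> rem h i)"
        using q(3) by metis
      then show "a \<otimes> h i = ((\<lambda>i. a \<otimes> q i) \<star> f) i \<oplus> a \<otimes> rem h i"
        using q(1,2) c[of i] assms by (simp add: skew_smult_left r_distr)
    qed
  qed
qed

section \<open>The Petit multiplication and the module structure\<close>

abbreviation A where "A \<equiv> petit S \<sigma> f"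

lemma petit_simps:
  "carrier A = Below" "x \<otimes>\<^bsub>A\<^esub> y = rem (x \<star> y)" "\<one>\<^bsub>A\<^esub> = const_poly S \<one>" "\<zero>\<^bsub>A\<^esub> = (\<lambda>i. \<zero>)"
  "x \<oplus>\<^bsub>A\<^esub> y = (\<lambda>i. x i \<oplus> y i)" "a \<odot>\<^bsub>A\<^esub> x = (\<lambda>i. a \<otimes> x i)"
  by (simp_all add: petit_def degree)

lemma petit_module: "Module.module S A"
proof (rule moduleI)
  show "abelian_group A"
  proof (rule abelian_groupI, unfold petit_simps)
    show "\<exists>y\<in>Below. (\<lambda>i. y i \<oplus> x i) = (\<lambda>i. \<zero>)" if "x \<in> Below" for x
      using that by (intro bexI[of _ "\<lambda>i. \<ominus> x i"]) (auto simp: below_neg l_neg)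
  qed (auto simp: below_add below_zero a_ac)
qed (auto simp: petit_simps below_smult l_distr r_distr m_assoc is_cring)

lemma petit_neg:
  assumes "x \<in> Below"
  shows "\<ominus>\<^bsub>A\<^esub> x = (\<lambda>i. \<ominus> x i)"
proof -
  interpret M: Module.module S A by (rule petit_module)
  show ?thesis
    by (rule M.minus_equality)
      (use assms in \<open>auto simp: petit_simps below_neg l_neg\<close>)
qed

lemma petit_mult_closed: "x \<in> Below \<Longrightarrow> y \<in> Below \<Longrightarrow> x \<otimes>\<^bsub>A\<^esub> y \<in> Below"
  by (simp add: petit_simps)

lemma petit_distrib:
  assumes "x \<in> Below" "y \<in> Below" "z \<in> Below"
  shows "(x \<oplus>\<^bsub>A\<^esub> y) \<otimes>\<^bsub>A\<^esub> z = (x \<otimes>\<^bsub>A\<^esub> z) \<oplus>\<^bsub>A\<^esub> (y \<otimes>\<^bsub>A\<^esub> z)"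
    "z \<otimes>\<^bsub>A\<^esub> (x \<oplus>\<^bsub>A\<^esub> y) = (z \<otimes>\<^bsub>A\<^esub> x) \<oplus>\<^bsub>A\<^esub> (z \<otimes>\<^bsub>A\<^esub> y)"
  using assms by (simp_all add: petit_simps skew_distrib_left skew_distrib_right rem_add)

text \<open>In the second identity the scalar has to cross the powers of t occurring in
  \<open>x\<close>, and each crossing applies \<sigma> to it. For this reason S_f is an algebra over
  fixed scalars only, although it is a left module over all of \<open>S\<close>.\<close>

lemma petit_smult_mult:
  assumes "a \<in> carrier S" "x \<in> Below" "y \<in> Below"
  shows "(a \<odot>\<^bsub>A\<^esub> x) \<otimes>\<^bsub>A\<^esub> y = a \<odot>\<^bsub>A\<^esub> (x \<otimes>\<^bsub>A\<^esub> y)"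
    "\<sigma> a = a \<Longrightarrow> x \<otimes>\<^bsub>A\<^esub> (a \<odot>\<^bsub>A\<^esub> y) = a \<odot>\<^bsub>A\<^esub> (x \<otimes>\<^bsub>A\<^esub> y)"
  using assms by (simp_all add: petit_simps skew_smult_left skew_smult_right rem_smult)

lemma const_below: "0 < m \<Longrightarrow> a \<in> carrier S \<Longrightarrow> const_poly S a \<in> Below"
  by (rule belowI) (auto simp: const_poly_def)

text \<open>Scaling becomes left multiplication by an element of degree zero, so that a left ideal
  is automatically a submodule. With constant 1 both parts give the unit laws.\<close>

lemma petit_const_mult:
  assumes "0 < m" "a \<in> carrier S" "x \<in> Below"
  shows "const_poly S a \<otimes>\<^bsub>A\<^esub> x = a \<odot>\<^bsub>A\<^esub> x"
    "\<sigma> a = a \<Longrightarrow> x \<otimes>\<^bsub>A\<^esub> const_poly S a = a \<odot>\<^bsub>A\<^esub> x"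
  using assms by (simp_all add: petit_simps const_mult mult_const rem_below below_smult)

end



section \<open>Linear combinations, bases and lattices\<close>

lemma (in abelian_monoid) lin_comb_0: "lin_comb G act 0 c b = \<zero>"
  by (simp add: lin_comb_def)

lemma (in abelian_monoid) lin_comb_Suc:
  assumes "\<And>i. i \<le> n \<Longrightarrow> act (c i) (b i) \<in> carrier G"
  shows "lin_comb G act (Suc n) c b = act (c n) (b n) \<oplus> lin_comb G act n c b"
  unfolding lin_comb_def lessThan_Suc using assms by (subst finsum_insert) auto

lemma (in abelian_monoid) lin_comb_closed:
  assumes "\<And>i. i < n \<Longrightarrow> act (c i) (b i) \<in> carrier G"
  shows "lin_comb G act n c b \<in> carrier G"
  unfolding lin_comb_def using assms by (intro finsum_closed) auto

lemma (in abelian_monoid) lin_comb_cong: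
  assumes "\<And>i. i < n \<Longrightarrow> act (c i) (b i) \<in> carrier G"
    "\<And>i. i < n \<Longrightarrow> act (c i) (b i) = act' (c' i) (b' i)"
  shows "lin_comb G act n c b = lin_comb G act' n c' b'"
  unfolding lin_comb_def using assms by (intro finsum_cong') auto

text \<open>Coefficients, vectors and action may all differ between the two sides. The same
  statement thus covers transport along a linear map, restriction to a submodule, and pulling out a
  scalar.\<close>

lemma lin_comb_hom:
  assumes "abelian_monoid G" "abelian_monoid H"
    and hom: "\<And>x. x \<in> carrier G \<Longrightarrow> h x \<in> carrier H"
      "\<And>x y. x \<in> carrier G \<Longrightarrow> y \<in> carrier G \<Longrightarrow> h (x \<oplus>\<^bsub>G\<^esub> y) = h x \<oplus>\<^bsub>H\<^esub> h y"
      "h \<zero>\<^bsub>G\<^esub> = \<zero>\<^bsub>H\<^esub>"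
    and act: "\<And>i. i < n \<Longrightarrow> act (c i) (b i) \<in> carrier G"
      "\<And>i. i < n \<Longrightarrow> h (act (c i) (b i)) = act' (c' i) (b' i)"
  shows "h (lin_comb G act n c b) = lin_comb H act' n c' b'"
  using act
proof (induction n)
  case 0
  then show ?case using assms(1,2) by (simp add: abelian_monoid.lin_comb_0 hom)
next
  case (Suc n)
  have cl: "act' (c' i) (b' i) \<in> carrier H" if "i \<le> n" for i
    using Suc.prems[of i] hom(1) that by (metis less_Suc_eq_le)
  have "h (lin_comb G act (Suc n) c b) = h (act (c n) (b n) \<oplus>\<^bsub>G\<^esub> lin_comb G act n c b)"
    using Suc.prems by (simp add: abelian_monoid.lin_comb_Suc[OF assms(1)])
  also have "\<dots> = h (act (c n) (b n)) \<oplus>\<^bsub>H\<^esub> h (lin_comb G act n c b)"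
    using Suc.prems by (intro hom abelian_monoid.lin_comb_closed[OF assms(1)]) auto
  also have "\<dots> = lin_comb H act' (Suc n) c' b'"
    using Suc.prems Suc.IH cl by (simp add: abelian_monoid.lin_comb_Suc[OF assms(2)])
  finally show ?case .
qed

lemma pull_scalars_simps [simp]:
  "carrier (pull_scalars \<phi> A) = carrier A" "x \<otimes>\<^bsub>pull_scalars \<phi> A\<^esub> y = x \<otimes>\<^bsub>A\<^esub> y"
  "\<one>\<^bsub>pull_scalars \<phi> A\<^esub> = \<one>\<^bsub>A\<^esub>" "\<zero>\<^bsub>pull_scalars \<phi> A\<^esub> = \<zero>\<^bsub>A\<^esub>"
  "x \<oplus>\<^bsub>pull_scalars \<phi> A\<^esub> y = x \<oplus>\<^bsub>A\<^esub> y" "a \<odot>\<^bsub>pull_scalars \<phi> A\<^esub> x = \<phi> a \<odot>\<^bsub>A\<^esub> x"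
  by (simp_all add: pull_scalars_def)

lemma pull_scalars_id: "pull_scalars (\<lambda>x. x) (A :: ('s, 'x) module) = A"
  by (cases A) (simp add: pull_scalars_def)

text \<open>Unit upper triangularity is relaxed to a divisibility condition on the diagonal, so that
  the same family can be a basis of a lattice over \<open>R\<close> and of the whole space over its fraction
  field.\<close>

lemma triangular_basis:
  fixes R (structure) and M (structure)
  assumes "Module.module R M"
    and pi: "\<And>i x. i < n \<Longrightarrow> x \<in> carrier M \<Longrightarrow> \<pi> i x \<in> carrier R"
      "\<And>i x y. i < n \<Longrightarrow> x \<in> carrier M \<Longrightarrow> y \<in> carrier M \<Longrightarrow> \<pi> i (x \<oplus>\<^bsub>M\<^esub> y) = \<pi> i x \<oplus> \<pi> i y"
      "\<And>i a x. i < n \<Longrightarrow> a \<in> carrier R \<Longrightarrow> x \<in> carrier M \<Longrightarrow> \<pi> i (a \<odot>\<^bsub>M\<^esub> x) = a \<otimes> \<pi> i x"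
    and b: "\<And>i. i < n \<Longrightarrow> b i \<in> carrier M"
    and tri: "\<And>i j. j < i \<Longrightarrow> i < n \<Longrightarrow> \<pi> i (b j) = \<zero>"
    and cancel: "\<And>i c. i < n \<Longrightarrow> c \<in> carrier R \<Longrightarrow> c \<otimes> \<pi> i (b i) = \<zero> \<Longrightarrow> c = \<zero>"
    and div: "\<And>i x. i < n \<Longrightarrow> x \<in> carrier M \<Longrightarrow> (\<And>j. i < j \<Longrightarrow> j < n \<Longrightarrow> \<pi> j x = \<zero>) \<Longrightarrow>
      \<exists>c\<in>carrier R. \<pi> i x = c \<otimes> \<pi> i (b i)"
    and sep: "\<And>x. x \<in> carrier M \<Longrightarrow> (\<And>i. i < n \<Longrightarrow> \<pi> i x = \<zero>) \<Longrightarrow> x = \<zero>\<^bsub>M\<^esub>"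
  shows "is_basis (carrier R) M n b"
proof -
  interpret Module.module R M by fact
  let ?lc = "lin_comb M (module.smult M)"
  have lc: "?lc k c b \<in> carrier M" if "k \<le> n" "\<And>i. i < k \<Longrightarrow> c i \<in> carrier R" for k c
    using that b by (intro M.lin_comb_closed) auto
  have lcS: "?lc (Suc k) c b = c k \<odot>\<^bsub>M\<^esub> b k \<oplus>\<^bsub>M\<^esub> ?lc k c b"
    if "k < n" "\<And>i. i \<le> k \<Longrightarrow> c i \<in> carrier R" for k c
    using that b by (intro M.lin_comb_Suc) auto
  have pi0: "\<pi> i \<zero>\<^bsub>M\<^esub> = \<zero>" if "i < n" for i
    using pi(3)[of i \<zero> "\<zero>\<^bsub>M\<^esub>"] pi(1)[of i "\<zero>\<^bsub>M\<^esub>"] that by simp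
  have pi_lc: "\<pi> i (?lc k c b) = \<zero>" if "k \<le> i" "i < n" "\<And>i. i < k \<Longrightarrow> c i \<in> carrier R" for i k c
    using that
  proof (induction k)
    case 0
    then show ?case by (simp add: M.lin_comb_0 pi0)
  next
    case (Suc k)
    then show ?case using lc[of k c] b[of k] tri[of k i] by (simp add: lcS pi)
  qed
  \<comment> \<open>Elimination from the top: \<open>k\<close> bounds the coordinates that may be
    nonzero. A multiple of the last available vector clears the topmost one, and by
    \<open>tri\<close> it does not disturb those above.\<close>
  have ex: "\<exists>c. (\<forall>i<k. c i \<in> carrier R) \<and> x = ?lc k c b"
    if "k \<le> n" "x \<in> carrier M" "\<And>j. k \<le> j \<Longrightarrow> j < n \<Longrightarrow> \<pi> j x = \<zero>" for k x
    using that
  proof (induction k arbitrary: x)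
    case 0
    then show ?case using sep by (auto simp: M.lin_comb_0)
  next
    case (Suc k)
    obtain a where a: "a \<in> carrier R" "\<pi> k x = a \<otimes> \<pi> k (b k)"
      using div[of k x] Suc.prems by auto
    define y where "y = x \<ominus>\<^bsub>M\<^esub> a \<odot>\<^bsub>M\<^esub> b k"
    have bk: "b k \<in> carrier M" using b Suc.prems by simp
    have y: "y \<in> carrier M" unfolding y_def using Suc.prems a bk by simp
    have xy: "x = a \<odot>\<^bsub>M\<^esub> b k \<oplus>\<^bsub>M\<^esub> y"
      unfolding y_def using Suc.prems a bk
      by (metis M.add.inv_closed M.add.m_comm M.add.m_closed a_minus_def M.r_neg1 smult_closed M.a_assoc M.r_neg2)
    have pixy: "\<pi> j x = a \<otimes> \<pi> j (b k) \<oplus> \<pi> j y" if "j < n" for j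
      using that a bk y by (subst xy) (simp add: pi)
    have "\<pi> j y = \<zero>" if "k \<le> j" "j < n" for j
    proof (cases "j = k")
      case True
      have "\<pi> k y \<in> carrier R" "a \<otimes> \<pi> k (b k) \<in> carrier R" using a bk y that pi(1) True by auto
      then show ?thesis using pixy[OF that(2)] a(2) True by (metis R.add.r_cancel_one R.a_comm)
    next
      case False
      then show ?thesis
        using pixy[OF that(2)] Suc.prems(3)[of j] tri[of k j] that pi(1)[of j y] y a by simp
    qed
    then obtain c where c: "\<And>i. i < k \<Longrightarrow> c i \<in> carrier R" "y = ?lc k c b"
      using Suc.IH[of y] y Suc.prems by auto
    have "x = ?lc (Suc k) (c(k := a)) b"
    proof -
      have "?lc k (c(k := a)) b = ?lc k c b"
        using c b Suc.prems by (intro M.lin_comb_cong) auto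
      then show ?thesis using xy c a Suc.prems by (subst lcS) auto
    qed
    moreover have "\<forall>i<Suc k. (c(k := a)) i \<in> carrier R" using c(1) a by (simp add: less_Suc_eq)
    ultimately show ?case by blast
  qed
  \<comment> \<open>By \<open>pi_lc\<close> the functional of highest index sees only the last
    vector of the combination, so the coefficients vanish one after the other from the top.\<close>
  have indep: "\<forall>i<k. c i = \<zero>"
    if "k \<le> n" "\<And>i. i < k \<Longrightarrow> c i \<in> carrier R" "?lc k c b = \<zero>\<^bsub>M\<^esub>" for k c
    using that
  proof (induction k)
    case (Suc k)
    have "\<zero> = \<pi> k (?lc (Suc k) c b)" using Suc.prems by (simp add: pi0)
    also have "\<dots> = c k \<otimes> \<pi> k (b k)"
      using Suc.prems(1,2) lc[of k c] b[of k] pi_lc[of k k c] by (simp add: lcS pi)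
    finally have ck: "c k = \<zero>" using cancel[of k "c k"] Suc.prems by simp
    then have "?lc k c b = \<zero>\<^bsub>M\<^esub>"
      using Suc.prems lc[of k c] b[of k] by (simp add: lcS)
    then show ?case using Suc ck by (auto simp: less_Suc_eq)
  qed simp
  show ?thesis
    unfolding is_basis_def
  proof (intro conjI allI impI ballI)
    fix x assume x: "x \<in> carrier M"
    obtain c where c: "\<And>i. i < n \<Longrightarrow> c i \<in> carrier R" "x = ?lc n c b"
      using ex[of n x] x by auto
    show "\<exists>!c. c \<in> {..<n} \<rightarrow>\<^sub>E carrier R \<and> x = ?lc n c b"
    proof (rule ex1I[of _ "restrict c {..<n}"])
      have "?lc n (restrict c {..<n}) b = ?lc n c b"
        using c b by (intro M.lin_comb_cong) auto
      then show "restrict c {..<n} \<in> {..<n} \<rightarrow>\<^sub>E carrier R \<and> x = ?lc n (restrict c {..<n}) b"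
        using c by auto
    next
      fix e assume e: "e \<in> {..<n} \<rightarrow>\<^sub>E carrier R \<and> x = ?lc n e b"
      then have ec: "\<And>i. i < n \<Longrightarrow> e i \<in> carrier R" by auto
      have "(e i \<ominus> c i) \<odot>\<^bsub>M\<^esub> b i \<oplus>\<^bsub>M\<^esub> c i \<odot>\<^bsub>M\<^esub> b i = e i \<odot>\<^bsub>M\<^esub> b i" if "i < n" for i
        using ec[OF that] c(1)[OF that] b[OF that]
        by (simp add: smult_l_distr[symmetric] a_minus_def R.a_assoc R.l_neg)
      then have "?lc n e b = (\<Oplus>\<^bsub>M\<^esub>i\<in>{..<n}. (e i \<ominus> c i) \<odot>\<^bsub>M\<^esub> b i \<oplus>\<^bsub>M\<^esub> c i \<odot>\<^bsub>M\<^esub> b i)"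
        unfolding lin_comb_def using ec c(1) b by (intro M.finsum_cong') auto
      also have "\<dots> = ?lc n (\<lambda>i. e i \<ominus> c i) b \<oplus>\<^bsub>M\<^esub> ?lc n c b"
        unfolding lin_comb_def using ec c(1) b by (intro M.finsum_addf) auto
      finally have "?lc n (\<lambda>i. e i \<ominus> c i) b \<oplus>\<^bsub>M\<^esub> x = x"
        using e c(2) by metis
      moreover have "?lc n (\<lambda>i. e i \<ominus> c i) b \<in> carrier M"
        using ec c by (intro lc) auto
      ultimately have "?lc n (\<lambda>i. e i \<ominus> c i) b = \<zero>\<^bsub>M\<^esub>"
        using x by (metis M.add.r_cancel_one)
      then have "\<forall>i<n. e i \<ominus> c i = \<zero>"
        by (intro indep) (use ec c(1) in auto)
      then have "e i = c i" if "i < n" for i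
        using R.r_right_minus_eq ec[OF that] c(1)[OF that] that by blast
      then show "e = restrict c {..<n}"
        using e by (auto simp: PiE_def extensional_def fun_eq_iff)
    qed
  qed (use b in auto)
qed

section \<open>Transport of bases and lattices along linear isomorphisms\<close>

lemma linear_iso_zero:
  assumes "Module.module E A" "Module.module E B" "linear_iso E A B \<theta>"
  shows "\<theta> \<zero>\<^bsub>A\<^esub> = \<zero>\<^bsub>B\<^esub>"
proof -
  interpret A: Module.module E A by fact
  interpret B: Module.module E B by fact
  have "\<theta> (\<zero>\<^bsub>A\<^esub> \<oplus>\<^bsub>A\<^esub> \<zero>\<^bsub>A\<^esub>) = \<theta> \<zero>\<^bsub>A\<^esub> \<oplus>\<^bsub>B\<^esub> \<theta> \<zero>\<^bsub>A\<^esub>" "\<theta> \<zero>\<^bsub>A\<^esub> \<in> carrier B"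
    using assms(3) unfolding linear_iso_def bij_betw_def by blast+
  then show ?thesis by (metis A.M.zero_closed A.M.l_zero B.M.add.r_cancel_one')
qed

lemma is_basis_image:
  assumes mod: "Module.module E A" "Module.module E B" and iso: "linear_iso E A B \<theta>"
    and R: "R \<subseteq> carrier E" and basis: "is_basis R A n b"
  shows "is_basis R B n (\<lambda>i. \<theta> (b i))"
proof -
  interpret A: Module.module E A by fact
  interpret B: Module.module E B by fact
  have bij: "bij_betw \<theta> (carrier A) (carrier B)" using iso by (simp add: linear_iso_def)
  have b: "\<And>i. i < n \<Longrightarrow> b i \<in> carrier A" using basis by (simp add: is_basis_def)
  have lc: "\<theta> (lin_comb A (module.smult A) n c b) = lin_comb B (module.smult B) n c (\<lambda>i. \<theta> (b i))"
    "lin_comb A (module.smult A) n c b \<in> carrier A"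
    if "c \<in> {..<n} \<rightarrow>\<^sub>E R" for c
  proof -
    have c: "\<And>i. i < n \<Longrightarrow> c i \<in> carrier E" using that R by (auto simp: PiE_def Pi_def)
    show "\<theta> (lin_comb A (module.smult A) n c b) = lin_comb B (module.smult B) n c (\<lambda>i. \<theta> (b i))"
      by (rule lin_comb_hom)
        (use c b iso linear_iso_zero[OF mod iso] in
          \<open>auto simp: linear_iso_def bij_betw_def A.abelian_monoid_axioms B.abelian_monoid_axioms\<close>)
    show "lin_comb A (module.smult A) n c b \<in> carrier A"
      using c b by (intro A.M.lin_comb_closed) auto
  qed
  show ?thesis
    unfolding is_basis_def
  proof (intro conjI allI impI ballI)
    show "i < n \<Longrightarrow> \<theta> (b i) \<in> carrier B" for i using b bij by (auto simp: bij_betw_def)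
    fix y assume "y \<in> carrier B"
    then obtain x where x: "x \<in> carrier A" "y = \<theta> x" using bij by (auto simp: bij_betw_def)
    have "y = lin_comb B (module.smult B) n c (\<lambda>i. \<theta> (b i)) \<longleftrightarrow> x = lin_comb A (module.smult A) n c b"
      if "c \<in> {..<n} \<rightarrow>\<^sub>E R" for c
      using lc[OF that] x bij by (metis bij_betw_def inj_onD)
    then show "\<exists>!c. c \<in> {..<n} \<rightarrow>\<^sub>E R \<and> y = lin_comb B (module.smult B) n c (\<lambda>i. \<theta> (b i))"
      using basis x(1) unfolding is_basis_def by (metis (no_types, lifting))
  qed
qed

lemma is_basis_imp_fin_gen:
  assumes "is_basis R A n b"
  shows "fin_gen R A"
proof -
  have "\<exists>c\<in>{..<n} \<rightarrow>\<^sub>E R. x = lin_comb A (module.smult A) n c b" if "x \<in> carrier A" for x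
    using assms that unfolding is_basis_def by (metis (no_types, lifting))
  moreover have "\<forall>i<n. b i \<in> carrier A" using assms by (simp add: is_basis_def)
  ultimately show ?thesis unfolding fin_gen_def by (intro exI[of _ n] exI[of _ b]) simp
qed

lemma unital_algebra_vec:
  assumes "cring E"
  shows "unital_algebra E (vec E n)"
proof -
  interpret cring E by fact
  have "abelian_group (vec E n)"
  proof (rule abelian_groupI)
    fix x assume x: "x \<in> carrier (vec E n)"
    then show "\<exists>y\<in>carrier (vec E n). y \<oplus>\<^bsub>vec E n\<^esub> x = \<zero>\<^bsub>vec E n\<^esub>"
      by (intro bexI[of _ "\<lambda>i\<in>{..<n}. \<ominus>\<^bsub>E\<^esub> x i"]) (auto simp: vec_def PiE_def Pi_def l_neg fun_eq_iff)
    show "\<zero>\<^bsub>vec E n\<^esub> \<oplus>\<^bsub>vec E n\<^esub> x = x"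
      using x by (auto simp: vec_def PiE_def Pi_def extensional_def fun_eq_iff)
  qed (auto simp: vec_def a_ac fun_eq_iff PiE_def Pi_def)
  then have "Module.module E (vec E n)"
    using is_cring
    by (intro moduleI)
      (auto simp: vec_def l_distr r_distr m_assoc fun_eq_iff PiE_def Pi_def extensional_def)
  then show ?thesis
    unfolding unital_algebra_def
    by (auto simp: vec_def l_distr r_distr m_assoc m_lcomm fun_eq_iff PiE_def Pi_def extensional_def)
qed

lemma submodule_module:
  assumes "Module.module E A" "submodule L E A"
  shows "Module.module E (A\<lparr>carrier := L\<rparr>)"
  using submodule.submodule_is_module assms by blast

lemma module_restrict_scalars:
  assumes "Module.module E A" "subring R E"
  shows "Module.module (E\<lparr>carrier := R\<rparr>) A"
proof -
  interpret Module.module E A by fact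
  have "cring (E\<lparr>carrier := R\<rparr>)"
    using subcring_iff[of R] subringE(1)[OF assms(2)] is_cring assms(2) subcringI'[OF assms(2)] by blast
  then show ?thesis
    using subringE(1)[OF assms(2)] M.abelian_group_axioms
    by (intro moduleI) (auto simp: smult_l_distr smult_r_distr smult_assoc1 subset_iff)
qed

text \<open>The basis is needed for the existence of coordinates in E^N. That every choice of
  coordinates yields a lattice is a separate matter: each clause of \<open>is_lattice\<close> is
  invariant under linear isomorphisms.\<close>

lemma embeds_as_lattice_of_basis:
  fixes E (structure)
  assumes lat: "is_lattice R E A L"
    and basis: "is_basis (carrier E) A N b"
  shows "embeds_as_lattice R E A L N"
proof -
  have mod: "Module.module E A" using lat by (simp add: is_lattice_def unital_algebra_def)
  then interpret A: Module.module E A .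
  have Rsub: "subring R E" using lat by (simp add: is_lattice_def)
  note RE = subringE(1)[OF this]
  have uni: "unital_algebra E (vec E N)" by (rule unital_algebra_vec[OF A.is_cring])
  then have modv: "Module.module E (vec E N)" by (simp add: unital_algebra_def)
  interpret V: Module.module E "vec E N" by (rule modv)
  have b: "\<And>i. i < N \<Longrightarrow> b i \<in> carrier A" using basis by (simp add: is_basis_def)
  define lc where "lc = (\<lambda>c. lin_comb A (module.smult A) N c b)"
  have ex1: "\<exists>!c. c \<in> {..<N} \<rightarrow>\<^sub>E carrier E \<and> x = lc c" if "x \<in> carrier A" for x
    using basis that by (simp add: is_basis_def lc_def)
  have cV: "carrier (vec E N) = {..<N} \<rightarrow>\<^sub>E carrier E" by (simp add: vec_def)
  define \<theta> where "\<theta> = (\<lambda>x. THE c. c \<in> {..<N} \<rightarrow>\<^sub>E carrier E \<and> x = lc c)"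
  have th: "\<theta> x \<in> {..<N} \<rightarrow>\<^sub>E carrier E" "x = lc (\<theta> x)" if "x \<in> carrier A" for x
    using theI'[OF ex1[OF that]] by (auto simp: \<theta>_def)
  have lc_closed: "lc c \<in> carrier A" if "c \<in> {..<N} \<rightarrow>\<^sub>E carrier E" for c
    unfolding lc_def using that b by (intro A.M.lin_comb_closed) (auto simp: PiE_def Pi_def)
  have th_eq: "\<theta> (lc c) = c" if "c \<in> {..<N} \<rightarrow>\<^sub>E carrier E" for c
    using ex1[OF lc_closed[OF that]] th[OF lc_closed[OF that]] that by blast
  \<comment> \<open>Linearity is computed for the inverse map \<open>lc\<close>, where it concerns
    finite sums, and carried over to \<open>\<theta>\<close> by uniqueness of coefficients.\<close>
  have lc_add: "lc (c \<oplus>\<^bsub>vec E N\<^esub> d) = lc c \<oplus>\<^bsub>A\<^esub> lc d"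
    if "c \<in> {..<N} \<rightarrow>\<^sub>E carrier E" "d \<in> {..<N} \<rightarrow>\<^sub>E carrier E" for c d
  proof -
    have "lc (c \<oplus>\<^bsub>vec E N\<^esub> d) = (\<Oplus>\<^bsub>A\<^esub>i\<in>{..<N}. (c i \<odot>\<^bsub>A\<^esub> b i) \<oplus>\<^bsub>A\<^esub> (d i \<odot>\<^bsub>A\<^esub> b i))"
      unfolding lc_def lin_comb_def using that b
      by (intro A.M.finsum_cong') (auto simp: vec_def PiE_def Pi_def A.smult_l_distr)
    then show ?thesis
      unfolding lc_def lin_comb_def using that b
      by (subst (asm) A.M.finsum_addf) (auto simp: PiE_def Pi_def)
  qed
  have lc_smult: "lc (a \<odot>\<^bsub>vec E N\<^esub> c) = a \<odot>\<^bsub>A\<^esub> lc c"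
    if "c \<in> {..<N} \<rightarrow>\<^sub>E carrier E" "a \<in> carrier E" for c a
    unfolding lc_def
    by (rule lin_comb_hom[symmetric])
      (use that b in \<open>auto simp: A.abelian_monoid_axioms A.smult_r_distr A.smult_assoc1 vec_def PiE_def Pi_def\<close>)
  have iso: "linear_iso E A (vec E N) \<theta>"
    unfolding linear_iso_def
  proof (intro conjI ballI)
    show "bij_betw \<theta> (carrier A) (carrier (vec E N))"
      unfolding cV by (rule bij_betw_byWitness[of _ lc]) (use th th_eq lc_closed in auto)
    show "\<theta> (x \<oplus>\<^bsub>A\<^esub> y) = \<theta> x \<oplus>\<^bsub>vec E N\<^esub> \<theta> y" if "x \<in> carrier A" "y \<in> carrier A" for x y
      using th[OF that(1)] th[OF that(2)] lc_add[of "\<theta> x" "\<theta> y"] th_eq[of "\<theta> x \<oplus>\<^bsub>vec E N\<^esub> \<theta> y"]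
        V.M.add.m_closed[of "\<theta> x" "\<theta> y"] unfolding cV by metis
    show "\<theta> (a \<odot>\<^bsub>A\<^esub> x) = a \<odot>\<^bsub>vec E N\<^esub> \<theta> x" if "a \<in> carrier E" "x \<in> carrier A" for a x
      using th[OF that(2)] lc_smult[of "\<theta> x" a] th_eq[of "a \<odot>\<^bsub>vec E N\<^esub> \<theta> x"]
        V.smult_closed[of a "\<theta> x"] that unfolding cV by metis
  qed
  \<comment> \<open>From here on \<open>\<theta>\<close> is an arbitrary linear isomorphism and no
    longer the coordinate map of \<open>b\<close>.\<close>
  have "is_lattice R E (vec E N) (\<theta> ` L)" if iso: "linear_iso E A (vec E N) \<theta>" for \<theta>
  proof -
    have L: "submodule L (E\<lparr>carrier := R\<rparr>) A" and fg: "fin_gen R (A\<lparr>carrier := L\<rparr>)"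
      using lat by (auto simp: is_lattice_def)
    interpret AR: Module.module "E\<lparr>carrier := R\<rparr>" A by (rule module_restrict_scalars[OF mod Rsub])
    interpret VR: Module.module "E\<lparr>carrier := R\<rparr>" "vec E N" by (rule module_restrict_scalars[OF modv Rsub])
    have LA: "L \<subseteq> carrier A" using AR.submoduleE(1)[OF L] .
    have th: "\<And>x. x \<in> carrier A \<Longrightarrow> \<theta> x \<in> carrier (vec E N)"
      "\<And>x y. x \<in> carrier A \<Longrightarrow> y \<in> carrier A \<Longrightarrow> \<theta> (x \<oplus>\<^bsub>A\<^esub> y) = \<theta> x \<oplus>\<^bsub>vec E N\<^esub> \<theta> y"
      "\<And>a x. a \<in> carrier E \<Longrightarrow> x \<in> carrier A \<Longrightarrow> \<theta> (a \<odot>\<^bsub>A\<^esub> x) = a \<odot>\<^bsub>vec E N\<^esub> \<theta> x"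
      using iso by (auto simp: linear_iso_def bij_betw_def)
    note th0 = linear_iso_zero[OF mod modv iso]
    interpret hom: group_hom "add_monoid A" "add_monoid (vec E N)" \<theta>
      using th A.M.a_group V.M.a_group
      by (auto simp: group_hom_def group_hom_axioms_def hom_def)
    have "subgroup (\<theta> ` L) (add_monoid (vec E N))"
      using hom.subgroup_img_is_subgroup L by (simp add: submodule_def)
    then have sub: "submodule (\<theta> ` L) (E\<lparr>carrier := R\<rparr>) (vec E N)"
      unfolding submodule_def submodule_axioms_def
    proof (intro conjI allI impI)
      fix a x assume a: "a \<in> carrier (E\<lparr>carrier := R\<rparr>)" and "x \<in> \<theta> ` L"
      then obtain y where y: "y \<in> L" "x = \<theta> y" by blast
      have "a \<odot>\<^bsub>A\<^esub> y \<in> L" using AR.submoduleE(4)[OF L a y(1)] .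
      moreover have "\<theta> (a \<odot>\<^bsub>A\<^esub> y) = a \<odot>\<^bsub>vec E N\<^esub> x" using th(3)[of a y] a y LA RE by auto
      ultimately show "a \<odot>\<^bsub>vec E N\<^esub> x \<in> \<theta> ` L" by (metis imageI)
    qed
    have "fin_gen R ((vec E N)\<lparr>carrier := \<theta> ` L\<rparr>)"
    proof -
      obtain n b where b: "\<forall>i<n. b i \<in> L"
        "\<forall>x\<in>L. \<exists>c\<in>{..<n} \<rightarrow>\<^sub>E R. x = lin_comb (A\<lparr>carrier := L\<rparr>) (module.smult A) n c b"
        using fg by (auto simp: fin_gen_def)
      have ml: "Module.module (E\<lparr>carrier := R\<rparr>) (A\<lparr>carrier := L\<rparr>)"
        by (rule submodule_module[OF AR.module_axioms L])
      have mt: "Module.module (E\<lparr>carrier := R\<rparr>) ((vec E N)\<lparr>carrier := \<theta> ` L\<rparr>)"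
        by (rule submodule_module[OF VR.module_axioms sub])
      have lc: "\<theta> (lin_comb (A\<lparr>carrier := L\<rparr>) (module.smult A) n c b)
          = lin_comb ((vec E N)\<lparr>carrier := \<theta> ` L\<rparr>) (module.smult (vec E N)) n c (\<lambda>i. \<theta> (b i))"
        if "c \<in> {..<n} \<rightarrow>\<^sub>E R" for c
      proof (rule lin_comb_hom)
        show "abelian_monoid (A\<lparr>carrier := L\<rparr>)" "abelian_monoid ((vec E N)\<lparr>carrier := \<theta> ` L\<rparr>)"
          using ml mt by (auto simp: module_def abelian_group_def)
        fix i assume i: "i < n"
        then have ci: "c i \<in> R" using that by auto
        show "c i \<odot>\<^bsub>A\<^esub> b i \<in> carrier (A\<lparr>carrier := L\<rparr>)"
          using AR.submoduleE(4)[OF L, of "c i" "b i"] ci b i by simp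
        show "\<theta> (c i \<odot>\<^bsub>A\<^esub> b i) = c i \<odot>\<^bsub>vec E N\<^esub> \<theta> (b i)"
          using th(3) ci b(1) i LA RE by blast
      qed (use th(2) LA th0 in \<open>auto simp: subset_iff\<close>)
      have "\<exists>c\<in>{..<n} \<rightarrow>\<^sub>E R. \<theta> x =
          lin_comb ((vec E N)\<lparr>carrier := \<theta> ` L\<rparr>) (module.smult (vec E N)) n c (\<lambda>i. \<theta> (b i))"
        if "x \<in> L" for x
      proof -
        obtain c where c: "c \<in> {..<n} \<rightarrow>\<^sub>E R"
          "x = lin_comb (A\<lparr>carrier := L\<rparr>) (module.smult A) n c b"
          using b(2) \<open>x \<in> L\<close> by blast
        show ?thesis using lc[OF c(1)] c by (intro bexI[of _ c]) simp_all
      qed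
      then show ?thesis
        unfolding fin_gen_def using b(1)
        by (intro exI[of _ n] exI[of _ "\<lambda>i. \<theta> (b i)"]) auto
    qed
    moreover have "\<exists>n b. is_basis (carrier E) (vec E N) n b \<and> (\<forall>i<n. b i \<in> \<theta> ` L)"
    proof -
      obtain n b where b: "is_basis (carrier E) A n b" "\<forall>i<n. b i \<in> L"
        using lat by (auto simp: is_lattice_def)
      then show ?thesis
        using is_basis_image[OF mod modv iso order_refl b(1)] by auto
    qed
    ultimately show ?thesis using lat sub uni by (auto simp: is_lattice_def)
  qed
  then show ?thesis using iso by (auto simp: embeds_as_lattice_def)
qed



section \<open>Left ideals and codes\<close>

text \<open>Surjectivity lifts every multiplier in \<open>B\<close> to one in \<open>A\<close>. Only
  the additive structure is treated as a group, because the lemma serves nonassociative rings: it is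
  used for coefficientwise reduction and for the projection onto cosets.\<close>

lemma principal_left_ideal_image:
  assumes grp: "group (add_monoid A)" "group (add_monoid B)"
    and h: "\<And>x. x \<in> carrier A \<Longrightarrow> h x \<in> carrier B"
      "\<And>x y. x \<in> carrier A \<Longrightarrow> y \<in> carrier A \<Longrightarrow> h (x \<oplus>\<^bsub>A\<^esub> y) = h x \<oplus>\<^bsub>B\<^esub> h y"
      "\<And>x y. x \<in> carrier A \<Longrightarrow> y \<in> carrier A \<Longrightarrow> h (x \<otimes>\<^bsub>A\<^esub> y) = h x \<otimes>\<^bsub>B\<^esub> h y"
      "carrier B = h ` carrier A"
    and J: "principal_left_ideal A g J"
  shows "principal_left_ideal B (h g) (h ` J)"
proof -
  interpret hom: group_hom "add_monoid A" "add_monoid B" h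
    using grp h(1,2) by (auto simp: group_hom_def group_hom_axioms_def hom_def)
  have sub: "subgroup J (add_monoid A)" and mult: "\<And>a x. a \<in> carrier A \<Longrightarrow> x \<in> J \<Longrightarrow> a \<otimes>\<^bsub>A\<^esub> x \<in> J"
    and g: "g \<in> carrier A" and Jg: "J = {x \<otimes>\<^bsub>A\<^esub> g | x. x \<in> carrier A}"
    using J by (auto simp: principal_left_ideal_def left_ideal_def)
  have JA: "J \<subseteq> carrier A" using subgroup.subset[OF sub] by simp
  have "left_ideal (h ` J) B"
    unfolding left_ideal_def
  proof (intro conjI ballI)
    show "subgroup (h ` J) (add_monoid B)" by (rule hom.subgroup_img_is_subgroup[OF sub])
    fix b y assume "b \<in> carrier B" "y \<in> h ` J"
    then obtain a x where "a \<in> carrier A" "b = h a" "x \<in> J" "y = h x" using h(4) by auto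
    then show "b \<otimes>\<^bsub>B\<^esub> y \<in> h ` J"
      using mult[of a x] h(3)[of a x] JA by (metis imageI subsetD)
  qed
  moreover have "h ` J = {y \<otimes>\<^bsub>B\<^esub> h g | y. y \<in> carrier B}"
  proof (intro equalityI subsetI)
    fix y assume "y \<in> h ` J"
    then obtain x where x: "x \<in> carrier A" "y = h (x \<otimes>\<^bsub>A\<^esub> g)" using Jg by blast
    then have "y = h x \<otimes>\<^bsub>B\<^esub> h g" using h(3) g by simp
    then show "y \<in> {y \<otimes>\<^bsub>B\<^esub> h g | y. y \<in> carrier B}" 
      using h(1)[OF x(1)] by (intro CollectI exI[of _ "h x"] conjI)
  next
    fix y assume "y \<in> {y \<otimes>\<^bsub>B\<^esub> h g | y. y \<in> carrier B}"
    then obtain x where x: "x \<in> carrier A" "y = h x \<otimes>\<^bsub>B\<^esub> h g" using h(4) by auto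
    then have "y = h (x \<otimes>\<^bsub>A\<^esub> g)" using h(3) g by simp
    moreover have "x \<otimes>\<^bsub>A\<^esub> g \<in> J" using mult[OF x(1)] x(1) unfolding Jg by (intro CollectI exI[of _ x] conjI refl)
    ultimately show "y \<in> h ` J" by simp
  qed
  ultimately show ?thesis using h(1) g by (simp add: principal_left_ideal_def)
qed

section \<open>Left ideals of a Petit algebra as codes\<close>

context petit_algebra
begin

lemma left_ideal_submodule:
  assumes "0 < m" "left_ideal J A"
  shows "submodule J S A"
proof -
  have sub: "subgroup J (add_monoid A)" and mult: "\<And>a x. a \<in> Below \<Longrightarrow> x \<in> J \<Longrightarrow> a \<otimes>\<^bsub>A\<^esub> x \<in> J"
    using assms(2) by (auto simp: left_ideal_def petit_simps)
  have "a \<odot>\<^bsub>A\<^esub> x \<in> J" if "a \<in> carrier S" "x \<in> J" for a x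
    using mult[OF const_below[OF assms(1) that(1)] that(2)] petit_const_mult(1)[OF assms(1) that(1), of x]
      subgroup.subset[OF sub] that(2) by (auto simp: petit_simps)
  then show ?thesis using sub by (simp add: submodule_def submodule_axioms_def)
qed

lemma coords_linear_iso:
  assumes "submodule J S A"
  shows "linear_iso S (A\<lparr>carrier := J\<rparr>) ((vec S m)\<lparr>carrier := coords m ` J\<rparr>) (coords m)"
    "submodule (coords m ` J) S (vec S m)"
proof -
  interpret M: Module.module S A by (rule petit_module)
  have uni: "unital_algebra S (vec S m)" by (rule unital_algebra_vec[OF is_cring])
  interpret V: Module.module S "vec S m" using uni by (simp add: unital_algebra_def)
  have sub: "subgroup J (add_monoid A)" and sm: "\<And>a x. a \<in> carrier S \<Longrightarrow> x \<in> J \<Longrightarrow> a \<odot>\<^bsub>A\<^esub> x \<in> J"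
    using assms by (auto simp: submodule_def submodule_axioms_def)
  have JB: "J \<subseteq> Below" using subgroup.subset[OF sub] by (simp add: petit_simps)
  have inj: "inj_on (coords m) Below"
  proof (rule inj_onI)
    fix x y assume xy: "x \<in> Below" "y \<in> Below" "coords m x = coords m y"
    show "x = y"
    proof
      fix i
      show "x i = y i"
        using fun_cong[OF xy(3), of i] below_above[OF xy(1)] below_above[OF xy(2)]
        by (cases "i < m") (auto simp: coords_def)
    qed
  qed
  have add: "coords m (x \<oplus>\<^bsub>A\<^esub> y) = coords m x \<oplus>\<^bsub>vec S m\<^esub> coords m y" for x y
    by (auto simp: coords_def vec_def petit_simps)
  have smult: "coords m (a \<odot>\<^bsub>A\<^esub> x) = a \<odot>\<^bsub>vec S m\<^esub> coords m x" for a x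
    by (auto simp: coords_def vec_def petit_simps)
  show "linear_iso S (A\<lparr>carrier := J\<rparr>) ((vec S m)\<lparr>carrier := coords m ` J\<rparr>) (coords m)"
    using inj_on_subset[OF inj JB] by (simp add: linear_iso_def bij_betw_def add smult)
  have cl: "x \<in> Below \<Longrightarrow> coords m x \<in> carrier (vec S m)" for x
    by (auto simp: coords_def vec_def)
  interpret hom: group_hom "add_monoid A" "add_monoid (vec S m)" "coords m"
    using M.M.a_group V.M.a_group cl add
    by (auto simp: group_hom_def group_hom_axioms_def hom_def petit_simps(1))
  have "subgroup (coords m ` J) (add_monoid (vec S m))"
    by (rule hom.subgroup_img_is_subgroup[OF sub])
  moreover have "a \<odot>\<^bsub>vec S m\<^esub> y \<in> coords m ` J" if ay: "a \<in> carrier S" "y \<in> coords m ` J" for a y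
  proof -
    obtain x where "x \<in> J" "y = coords m x" using ay by blast
    then show ?thesis using sm[OF ay(1), of x] smult[of a x] by (metis imageI)
  qed
  ultimately show "submodule (coords m ` J) S (vec S m)"
    by (simp add: submodule_def submodule_axioms_def)
qed

text \<open>If \<open>g\<close> divides \<open>f\<close> then reducing modulo \<open>f\<close> does not leave \<open>S[t;\<sigma>]g\<close>, so that a
  nonzero element of the code has degree at least \<open>deg g\<close>.\<close>

lemma divisor_ideal_basis:
  assumes nontriv: "\<one> \<noteq> \<zero>" and g: "monic_poly S g" "right_divides S \<sigma> g f"
    and J: "principal_left_ideal A g J" and m: "0 < m"
  shows "is_basis (carrier S) (A\<lparr>carrier := J\<rparr>) (m - deg S g) (\<lambda>i. term_poly \<one> i \<star> g)"
proof -
  define d where "d = deg S g"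
  \<comment> \<open>Treating \<open>g\<close> as a modulus in its own right makes the leading
    coefficient argument available for multiples of \<open>g\<close>.\<close>
  interpret G: petit_algebra S \<sigma> g d
    using g(1) by unfold_locales (simp_all add: d_def)
  have gB: "g \<in> Below" and left: "left_ideal J A" and Jg: "J = {h \<otimes>\<^bsub>A\<^esub> g | h. h \<in> Below}"
    using J by (auto simp: principal_left_ideal_def petit_simps(1))
  have dm: "d < m"
    using below_above[OF gB, of d] G.f_top nontriv by (metis not_le)
  note sub = left_ideal_submodule[OF m left]
  interpret J: Module.module S "A\<lparr>carrier := J\<rparr>"
    by (rule submodule_module[OF petit_module sub])
  have JB: "J \<subseteq> Below" using petit_mult_closed gB Jg by blast
  \<comment> \<open>\<open>W\<close> is the left ideal of all multiples of \<open>g\<close> in the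
    skew polynomial ring, before reduction modulo \<open>f\<close>. The four closure properties are
    those required by \<open>skew_mult_mem\<close>, which then puts every multiple of
    \<open>f\<close> into \<open>W\<close>.\<close>
  define W where "W = {h \<star> g | h. h \<in> up S}"
  have W: "W \<subseteq> up S" "\<And>x y. x \<in> W \<Longrightarrow> y \<in> W \<Longrightarrow> (\<lambda>i. x i \<oplus> y i) \<in> W"
      "\<And>a x. a \<in> carrier S \<Longrightarrow> x \<in> W \<Longrightarrow> (\<lambda>i. a \<otimes> x i) \<in> W" "\<And>x. x \<in> W \<Longrightarrow> skew_shift x \<in> W"
  proof -
    show "W \<subseteq> up S" by (auto simp: W_def)
    have mem: "h \<star> g \<in> W" if "h \<in> up S" for h unfolding W_def using that by blast
    fix x assume "x \<in> W"
    then obtain h where h: "h \<in> up S" "x = h \<star> g" by (auto simp: W_def)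
    show "(\<lambda>i. x i \<oplus> y i) \<in> W" if "y \<in> W" for y
    proof -
      obtain k where "k \<in> up S" "y = k \<star> g" using \<open>y \<in> W\<close> by (auto simp: W_def)
      then show ?thesis
        using h mem[of "\<lambda>i. h i \<oplus> k i"] by (simp add: skew_distrib_right up_add_closed)
    qed
    show "(\<lambda>i. a \<otimes> x i) \<in> W" if "a \<in> carrier S" for a
      using that h mem[of "\<lambda>i. a \<otimes> h i"] by (simp add: skew_smult_left up_smult_closed)
    show "skew_shift x \<in> W" using h mem[of "skew_shift h"] by (simp add: skew_shift_mult)
  qed
  have fW: "f \<in> W" using g(2) by (auto simp: right_divides_def W_def skew_carrier)
  have JW: "x \<in> W" if xJ: "x \<in> J" for x
  proof -
    obtain h where h: "h \<in> Below" "x = rem (h \<star> g)" using xJ Jg by (auto simp: petit_simps(2))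
    have hg: "h \<star> g \<in> W"
      unfolding W_def using h(1) by (intro CollectI exI[of _ h] conjI refl) simp
    have hgu: "h \<star> g \<in> up S" using h(1) by simp
    obtain q where q: "q \<in> up S" "rem (h \<star> g) \<in> Below" "h \<star> g = (\<lambda>i. (q \<star> f) i \<oplus> rem (h \<star> g) i)"
      by (rule remE[OF hgu])
    have "q \<star> f \<in> W" by (rule skew_mult_mem[OF W q(1) fW])
    \<comment> \<open>Subtraction is written as addition of a multiple by -1, so that the closure
      rules for \<open>W\<close> apply.\<close>
    then have "(\<lambda>i. (\<ominus> \<one>) \<otimes> (q \<star> f) i) \<in> W" using W(3) by simp
    then have "(\<lambda>i. (h \<star> g) i \<oplus> (\<ominus> \<one>) \<otimes> (q \<star> f) i) \<in> W" using W(2)[OF hg] by simp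
    moreover have "(h \<star> g) i \<oplus> (\<ominus> \<one>) \<otimes> (q \<star> f) i = x i" for i
    proof -
      have c: "(q \<star> f) i \<in> carrier S" "x i \<in> carrier S" using q(1,2) h(2) by (auto simp: up_coeff_closed)
      have "(h \<star> g) i = (q \<star> f) i \<oplus> x i" using fun_cong[OF q(3), of i] h(2) by simp
      then show ?thesis using c by (simp add: l_minus a_ac r_neg r_neg1 r_neg2)
    qed
    ultimately show ?thesis by simp
  qed
  have bc: "(term_poly \<one> k \<star> g) n = (if k \<le> n then (\<sigma> ^^ k) (g (n - k)) else \<zero>)" for k n
    by (simp add: term_mult_coeff)
  show ?thesis
    unfolding d_def[symmetric]
  \<comment> \<open>The coordinates are the coefficients at d, ..., m - 1. In them the vectors
    \<open>t^i g\<close> are triangular with diagonal 1, since \<open>g\<close> is monic of degree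
    d.\<close>
  proof (rule triangular_basis[where \<pi> = "\<lambda>i x. x (i + d)"])
    show "Module.module S (A\<lparr>carrier := J\<rparr>)" by unfold_locales
    fix i assume i: "i < m - d"
    have tB: "term_poly \<one> i \<in> Below" using i by (intro belowI) (auto simp: term_poly_def)
    have bB: "term_poly \<one> i \<star> g \<in> Below"
      using i by (intro belowI) (auto simp: bc G.f_above sigma_pow_zero)
    have "term_poly \<one> i \<star> g = term_poly \<one> i \<otimes>\<^bsub>A\<^esub> g" using bB by (simp add: petit_simps(2) rem_below)
    then show "term_poly \<one> i \<star> g \<in> carrier (A\<lparr>carrier := J\<rparr>)" using tB Jg by auto
    show "(term_poly \<one> j \<star> g) (i + d) = \<zero>" if "j < i" for j
      using \<open>j < i\<close> by (simp add: bc G.f_above sigma_pow_zero)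
    have top: "(term_poly \<one> i \<star> g) (i + d) = \<one>" by (simp add: bc G.f_top sigma_pow_one)
    show "c = \<zero>" if "c \<in> carrier S" "c \<otimes> (term_poly \<one> i \<star> g) (i + d) = \<zero>" for c
      using that top by simp
    show "\<exists>c\<in>carrier S. x (i + d) = c \<otimes> (term_poly \<one> i \<star> g) (i + d)"
      if "x \<in> carrier (A\<lparr>carrier := J\<rparr>)" for x
      using that top JB by (intro bexI[of _ "x (i + d)"]) auto
  next
    fix x assume x: "x \<in> carrier (A\<lparr>carrier := J\<rparr>)" "\<And>i. i < m - d \<Longrightarrow> x (i + d) = \<zero>"
    obtain h where h: "h \<in> up S" "x = h \<star> g" using JW[of x] x(1) by (auto simp: W_def)
    \<comment> \<open>Coefficients from d to m - 1 vanish by hypothesis and those from m on because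
      \<open>x\<close> is a remainder. A multiple of \<open>g\<close> without terms of degree at
      least d is zero.\<close>
    have "x i = \<zero>" if "i \<ge> d" for i
      using x(2)[of "i - d"] \<open>i \<ge> d\<close> below_above[of x i] x(1) JB by (cases "i < m") auto
    then have "h = (\<lambda>i. \<zero>)" using G.mult_monic_eq_zero[OF h(1)] h(2) by simp
    then show "x = \<zero>\<^bsub>A\<lparr>carrier := J\<rparr>\<^esub>" using h by (simp add: skew_mult_zero_left petit_simps)
  qed (use JB in \<open>auto simp: petit_simps\<close>)
qed

theorem divisor_code:
  assumes nontriv: "\<one> \<noteq> \<zero>" and g: "monic_poly S g" "right_divides S \<sigma> g f"
    and J: "principal_left_ideal A g J" and m: "0 < m"
  shows "cyclic_code_gen_by S \<sigma> f g (coords m ` J)"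
    "code_dimension S m (coords m ` J) (m - deg S g)"
proof -
  show "cyclic_code_gen_by S \<sigma> f g (coords m ` J)"
    unfolding cyclic_code_gen_by_def using g J degree by auto
  have sub: "submodule J S A" using J m by (intro left_ideal_submodule) (auto simp: principal_left_ideal_def)
  have uni: "Module.module S (vec S m)" using unital_algebra_vec[OF is_cring] by (simp add: unital_algebra_def)
  show "code_dimension S m (coords m ` J) (m - deg S g)"
    unfolding code_dimension_def free_of_rank_def
    using is_basis_image[OF submodule_module[OF petit_module sub]
        submodule_module[OF uni coords_linear_iso(2)[OF sub]] coords_linear_iso(1)[OF sub] order_refl
        divisor_ideal_basis[OF assms]] by blast
qed

end


section \<open>Reduction of Petit algebras\<close>

text \<open>In \<open>FactRing\<close> the product of two cosets is a union of cosets over all pairs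
  of representatives; this collapses the union once its members agree.\<close>

lemma UN_UN_const:
  assumes "x \<in> B" "y \<in> C" "\<And>u v. u \<in> B \<Longrightarrow> v \<in> C \<Longrightarrow> h u v = Z"
  shows "(\<Union>u\<in>B. \<Union>v\<in>C. h u v) = Z"
  using assms by auto

text \<open>Reduction is abstracted to a surjective homomorphism \<open>r\<close> that intertwines
  the two twists, which keeps the coset arithmetic of the coefficients out of the polynomial
  arguments.\<close>

locale petit_reduction = P: petit_algebra S \<sigma> f m + Q: skew_polynomials S' \<sigma>'
  for S (structure) and \<sigma> f m and S' (structure) and \<sigma>' +
  fixes r
  assumes r_hom: "r \<in> ring_hom S S'"
    and r_sigma: "\<And>x. x \<in> carrier S \<Longrightarrow> r (\<sigma> x) = \<sigma>' (r x)"
    and r_surj: "r ` carrier S = carrier S'"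
    and nontrivial: "\<one>\<^bsub>S'\<^esub> \<noteq> \<zero>\<^bsub>S'\<^esub>"
begin

interpretation h: ring_hom_cring S S' r
  using r_hom by (simp add: ring_hom_cring_def ring_hom_cring_axioms_def P.is_cring Q.is_cring)

abbreviation red where "red p \<equiv> (\<lambda>i. r (p i))"

lemma r_pow: "x \<in> carrier S \<Longrightarrow> r ((\<sigma> ^^ i) x) = (\<sigma>' ^^ i) (r x)"
  by (induction i) (simp_all add: r_sigma)

lemma red_up [simp]:
  assumes "p \<in> up S"
  shows "red p \<in> up S'"
proof -
  obtain n where "\<forall>i\<ge>n. p i = \<zero>\<^bsub>S\<^esub>" using P.up_bound assms by blast
  then show ?thesis using assms by (intro Q.up_intro[of _ n]) auto
qed

lemma red_mult:
  assumes "p \<in> up S" "q \<in> up S"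
  shows "red (P.skew_mult p q) = Q.skew_mult (red p) (red q)"
proof
  fix n
  show "r (P.skew_mult p q n) = Q.skew_mult (red p) (red q) n"
    unfolding P.skew_mult_coeff Q.skew_mult_coeff using assms
    by (subst h.hom_finsum) (auto simp: comp_def r_pow intro!: Q.finsum_cong')
qed

text \<open>The leading coefficient 1 is mapped to 1, which is nonzero in the target, so the degree
  does not drop.\<close>

lemma red_monic:
  assumes "monic_poly S g"
  shows "monic_poly S' (red g)" "deg S' (red g) = deg S g"
proof -
  have g: "g \<in> up S" "g (deg S g) = \<one>\<^bsub>S\<^esub>" using assms by (auto simp: monic_poly_def)
  show d: "deg S' (red g) = deg S g"
    using g P.degree_props(1)[OF g(1)] nontrivial by (intro Q.degree_eqI) auto
  show "monic_poly S' (red g)" using g d by (simp add: monic_poly_def)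
qed

sublocale T: petit_algebra S' \<sigma>' "red f" m
  using red_monic[OF P.monic] P.degree by unfold_locales simp_all

lemma red_below [simp]: "x \<in> P.Below \<Longrightarrow> red x \<in> T.Below"
  by (intro T.belowI) (auto simp: P.below_above)

lemma red_below_surj: "red ` P.Below = T.Below"
proof (intro equalityI subsetI)
  fix y assume y: "y \<in> T.Below"
  \<comment> \<open>Preimages are chosen coefficient by coefficient; taking zero from m on keeps the
    lift inside the Petit algebra.\<close>
  have "\<exists>a\<in>carrier S. r a = y i \<and> (i \<ge> m \<longrightarrow> a = \<zero>\<^bsub>S\<^esub>)" for i
  proof (cases "i \<ge> m")
    case True
    then show ?thesis using T.below_above[OF y] by (intro bexI[of _ "\<zero>\<^bsub>S\<^esub>"]) auto
  next
    case False
    have "y i \<in> r ` carrier S" using r_surj T.below_coeff[OF y, of i] by simp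
    then show ?thesis using False by auto
  qed
  then obtain x where x: "\<And>i. x i \<in> carrier S" "\<And>i. r (x i) = y i" "\<And>i. i \<ge> m \<Longrightarrow> x i = \<zero>\<^bsub>S\<^esub>"
    by metis
  then have "x \<in> P.Below" "red x = y" by (auto intro!: P.belowI)
  then show "y \<in> red ` P.Below" by blast
qed auto

text \<open>Applying \<open>r\<close> to \<open>h = q f + r'\<close> yields a division of the
  reduced \<open>h\<close> by the reduced \<open>f\<close>, which is again monic of degree m, and
  such a division has only one remainder.\<close>

lemma red_rem:
  assumes "h \<in> up S"
  shows "red (P.rem h) = T.rem (red h)"
proof -
  obtain q where q: "q \<in> up S" "P.rem h \<in> P.Below" "h = (\<lambda>i. P.skew_mult q f i \<oplus>\<^bsub>S\<^esub> P.rem h i)"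
    using P.remE[OF assms] by metis
  have "red h = (\<lambda>i. Q.skew_mult (red q) (red f) i \<oplus>\<^bsub>S'\<^esub> red (P.rem h) i)"
  proof
    fix i
    have "r (h i) = r (P.skew_mult q f i \<oplus>\<^bsub>S\<^esub> P.rem h i)" using q(3) by metis
    also have "\<dots> = r (P.skew_mult q f i) \<oplus>\<^bsub>S'\<^esub> r (P.rem h i)"
      using q(1,2) P.skew_mult_closed[OF q(1) P.f_closed] by (intro h.hom_add) (auto simp del: P.skew_mult_closed)
    finally show "r (h i) = Q.skew_mult (red q) (red f) i \<oplus>\<^bsub>S'\<^esub> r (P.rem h i)"
      using fun_cong[OF red_mult[OF q(1) P.f_closed], of i] by simp
  qed
  then show ?thesis
    using T.rem_eqI[of "red q" "red (P.rem h)" "red h"] q(1,2) by simp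
qed

lemma red_petit_mult:
  "x \<in> P.Below \<Longrightarrow> y \<in> P.Below \<Longrightarrow> red (x \<otimes>\<^bsub>P.A\<^esub> y) = red x \<otimes>\<^bsub>T.A\<^esub> red y"
  by (simp add: P.petit_simps T.petit_simps red_rem red_mult)

lemma red_petit_add:
  "x \<in> P.Below \<Longrightarrow> y \<in> P.Below \<Longrightarrow> red (x \<oplus>\<^bsub>P.A\<^esub> y) = red x \<oplus>\<^bsub>T.A\<^esub> red y"
  by (simp add: P.petit_simps T.petit_simps)

lemma red_principal_left_ideal:
  assumes "principal_left_ideal P.A g J"
  shows "principal_left_ideal T.A (red g) (red ` J)"
proof (rule principal_left_ideal_image[OF _ _ _ _ _ _ assms])
  interpret PM: Module.module S P.A by (rule P.petit_module)
  interpret TM: Module.module S' T.A by (rule T.petit_module)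
  show "group (add_monoid P.A)" "group (add_monoid T.A)" by (rule PM.M.a_group TM.M.a_group)+
qed (simp_all add: P.petit_simps(1) T.petit_simps(1) red_petit_add red_petit_mult red_below_surj)

definition red_kernel where "red_kernel = {x \<in> P.Below. \<forall>i. r (x i) = \<zero>\<^bsub>S'\<^esub>}"

text \<open>The notion \<open>ideal\<close> presupposes an associative ring, so the kernel is
  handled as an additive subgroup, and the product of cosets gets its own argument.\<close>

lemma red_kernel_subgroup: "abelian_subgroup red_kernel P.A"
proof -
  interpret PM: Module.module S P.A by (rule P.petit_module)
  have "subgroup red_kernel (add_monoid P.A)"
  proof (rule PM.M.add.subgroupI)
    show "red_kernel \<noteq> {}" using P.below_zero by (auto simp: red_kernel_def)
    show "\<ominus>\<^bsub>P.A\<^esub> x \<in> red_kernel" if "x \<in> red_kernel" for x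
      using that by (auto simp: red_kernel_def P.petit_neg P.below_neg)
    show "x \<oplus>\<^bsub>P.A\<^esub> y \<in> red_kernel" if "x \<in> red_kernel" "y \<in> red_kernel" for x y
      using that by (auto simp: red_kernel_def P.petit_simps P.below_add)
  qed (auto simp: red_kernel_def P.petit_simps)
  then show ?thesis
    by (intro abelian_subgroupI3) (auto simp: additive_subgroup_def PM.M.abelian_group_axioms)
qed

text \<open>With cosets described as fibres of reduction, questions of well-definedness turn into
  statements about \<open>red\<close>.\<close>

lemma red_coset_eq:
  assumes "x \<in> P.Below"
  shows "red_kernel +>\<^bsub>P.A\<^esub> x = {y \<in> P.Below. red y = red x}"
proof (intro equalityI subsetI)
  fix y assume "y \<in> red_kernel +>\<^bsub>P.A\<^esub> x"
  then obtain n where n: "n \<in> red_kernel" "y = n \<oplus>\<^bsub>P.A\<^esub> x"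
    by (auto simp: a_r_coset_def r_coset_def)
  then show "y \<in> {y \<in> P.Below. red y = red x}"
    using assms by (auto simp: red_kernel_def P.petit_simps P.below_add)
next
  interpret PM: Module.module S P.A by (rule P.petit_module)
  fix y assume "y \<in> {y \<in> P.Below. red y = red x}"
  then have y: "y \<in> P.Below" "\<And>i. r (y i) = r (x i)" by (auto dest: fun_cong)
  define n where "n = y \<oplus>\<^bsub>P.A\<^esub> (\<ominus>\<^bsub>P.A\<^esub> x)"
  have nc: "n = (\<lambda>i. y i \<oplus>\<^bsub>S\<^esub> \<ominus>\<^bsub>S\<^esub> x i)"
    using assms by (simp add: n_def P.petit_neg P.petit_simps)
  have "n \<in> red_kernel"
    using y assms unfolding red_kernel_def nc
    by (auto simp: P.below_add[OF _ P.below_neg] Q.r_neg)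
  moreover have "y = n \<oplus>\<^bsub>P.A\<^esub> x"
    using y(1) assms unfolding nc by (simp add: P.petit_simps P.a_assoc P.l_neg)
  ultimately show "y \<in> red_kernel +>\<^bsub>P.A\<^esub> x"
    by (auto simp: a_r_coset_def r_coset_def)
qed

lemma on_cosets_red: "x \<in> P.Below \<Longrightarrow> on_cosets red (red_kernel +>\<^bsub>P.A\<^esub> x) = red x"
proof -
  assume x: "x \<in> P.Below"
  then have "red ` (red_kernel +>\<^bsub>P.A\<^esub> x) = {red x}" by (auto simp: red_coset_eq)
  then show ?thesis by (simp add: on_cosets_def)
qed

lemma quotient_principal_left_ideal:
  assumes "principal_left_ideal P.A g J"
  shows "principal_left_ideal (P.A Quot red_kernel) (red_kernel +>\<^bsub>P.A\<^esub> g) ((\<lambda>x. red_kernel +>\<^bsub>P.A\<^esub> x) ` J)"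
proof (rule principal_left_ideal_image[OF _ _ _ _ _ _ assms])
  interpret PM: Module.module S P.A by (rule P.petit_module)
  interpret N: abelian_subgroup red_kernel P.A by (rule red_kernel_subgroup)
  show "group (add_monoid P.A)" by (rule PM.M.a_group)
  have "add_monoid (P.A Quot red_kernel) = P.A A_Mod red_kernel"
    by (simp add: FactRing_def A_FactGroup_def FactGroup_def A_RCOSETS_def set_add_def)
  then show "group (add_monoid (P.A Quot red_kernel))" using N.a_factorgroup_is_group by simp
  show "red_kernel +>\<^bsub>P.A\<^esub> x \<in> carrier (P.A Quot red_kernel)" if "x \<in> carrier P.A" for x
    using that by (auto simp: FactRing_def A_RCOSETS_defs a_r_coset_def r_coset_def)
  show "carrier (P.A Quot red_kernel) = (+>\<^bsub>P.A\<^esub>) red_kernel ` carrier P.A"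
    by (auto simp: FactRing_def A_RCOSETS_def RCOSETS_def a_r_coset_def)
  show "red_kernel +>\<^bsub>P.A\<^esub> (x \<oplus>\<^bsub>P.A\<^esub> y) =
      (red_kernel +>\<^bsub>P.A\<^esub> x) \<oplus>\<^bsub>P.A Quot red_kernel\<^esub> (red_kernel +>\<^bsub>P.A\<^esub> y)"
    if "x \<in> carrier P.A" "y \<in> carrier P.A" for x y
    using N.a_rcos_sum[OF that] by (simp add: FactRing_def)
  show "red_kernel +>\<^bsub>P.A\<^esub> (x \<otimes>\<^bsub>P.A\<^esub> y) =
      (red_kernel +>\<^bsub>P.A\<^esub> x) \<otimes>\<^bsub>P.A Quot red_kernel\<^esub> (red_kernel +>\<^bsub>P.A\<^esub> y)"
    if xy: "x \<in> carrier P.A" "y \<in> carrier P.A" for x y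
  proof -
    have B: "x \<in> P.Below" "y \<in> P.Below" using xy by (simp_all add: P.petit_simps(1))
    \<comment> \<open>Cosets are fibres of \<open>red\<close>, and \<open>red\<close> is
      multiplicative; hence the coset of a product depends only on the cosets of its
      factors.\<close>
    have *: "red_kernel +>\<^bsub>P.A\<^esub> (a \<otimes>\<^bsub>P.A\<^esub> b) = red_kernel +>\<^bsub>P.A\<^esub> (x \<otimes>\<^bsub>P.A\<^esub> y)"
      if "a \<in> red_kernel +>\<^bsub>P.A\<^esub> x" "b \<in> red_kernel +>\<^bsub>P.A\<^esub> y" for a b
    proof -
      have "a \<in> P.Below" "b \<in> P.Below" "red a = red x" "red b = red y"
        using that B by (auto simp: red_coset_eq)
      then have "red (a \<otimes>\<^bsub>P.A\<^esub> b) = red (x \<otimes>\<^bsub>P.A\<^esub> y)" using B by (simp only: red_petit_mult)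
      then show ?thesis
        using B \<open>a \<in> P.Below\<close> \<open>b \<in> P.Below\<close> by (simp only: red_coset_eq P.petit_mult_closed)
    qed
    have "x \<in> red_kernel +>\<^bsub>P.A\<^esub> x" "y \<in> red_kernel +>\<^bsub>P.A\<^esub> y" using B by (auto simp: red_coset_eq)
    from UN_UN_const[OF this *] show ?thesis unfolding FactRing_def rcoset_mult_def by simp
  qed
qed

end

text \<open>Since \<sigma> maps \<open>P\<close> into itself, all cosets united in
  \<open>induced_map\<close> for one argument coincide. The induced map then inherits the
  homomorphism laws from \<sigma> through representatives.\<close>

lemma petit_reduction_quotient:
  assumes "petit_algebra S \<sigma> f m" "ideal P S" "\<one>\<^bsub>S\<^esub> \<notin> P"
    and stable: "\<And>x. x \<in> P \<Longrightarrow> \<sigma> x \<in> P"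
  shows "petit_reduction S \<sigma> f m (S Quot P) (induced_map S P \<sigma>) (\<lambda>x. P +>\<^bsub>S\<^esub> x)"
proof -
  interpret petit_algebra S \<sigma> f m by fact
  interpret P: ideal P S by fact
  let ?r = "\<lambda>x. P +>\<^bsub>S\<^esub> x"
  have sm: "induced_map S P \<sigma> (?r x) = ?r (\<sigma> x)" if x: "x \<in> carrier S" for x
  proof -
    have "?r (\<sigma> b) = ?r (\<sigma> x)" if b: "b \<in> ?r x" for b
    proof -
      obtain n where n: "n \<in> P" "b = n \<oplus>\<^bsub>S\<^esub> x" using b by (auto simp: a_r_coset_def r_coset_def)
      then have "\<sigma> b \<in> ?r (\<sigma> x)"
        using stable[of n] P.a_subset x ring_hom_add[OF sigma_hom, of n x]
        by (auto simp: a_r_coset_def r_coset_def)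
      then show ?thesis using P.a_repr_independence'[of "\<sigma> b" "\<sigma> x"] x by simp
    qed
    moreover have "x \<in> ?r x" using x by (rule P.a_rcos_self)
    ultimately show ?thesis unfolding induced_map_def by blast
  qed
  have surj: "?r ` carrier S = carrier (S Quot P)"
    by (auto simp: FactRing_def A_RCOSETS_def RCOSETS_def a_r_coset_def)
  note rh = P.rcos_ring_hom
  have sh: "induced_map S P \<sigma> \<in> ring_hom (S Quot P) (S Quot P)"
  proof (rule ring_hom_memI)
    fix x assume "x \<in> carrier (S Quot P)"
    then obtain a where a: "a \<in> carrier S" "x = ?r a" using surj by blast
    show "induced_map S P \<sigma> x \<in> carrier (S Quot P)" using a sm surj by auto
    fix y assume "y \<in> carrier (S Quot P)"
    then obtain b where b: "b \<in> carrier S" "y = ?r b" using surj by blast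
    show "induced_map S P \<sigma> (x \<otimes>\<^bsub>S Quot P\<^esub> y) = induced_map S P \<sigma> x \<otimes>\<^bsub>S Quot P\<^esub> induced_map S P \<sigma> y"
      using a b sm ring_hom_mult[OF rh, of a b] ring_hom_mult[OF rh, of "\<sigma> a" "\<sigma> b"]
        ring_hom_mult[OF sigma_hom, of a b] by (metis m_closed sigma_closed)
    show "induced_map S P \<sigma> (x \<oplus>\<^bsub>S Quot P\<^esub> y) = induced_map S P \<sigma> x \<oplus>\<^bsub>S Quot P\<^esub> induced_map S P \<sigma> y"
      using a b sm ring_hom_add[OF rh, of a b] ring_hom_add[OF rh, of "\<sigma> a" "\<sigma> b"]
        ring_hom_add[OF sigma_hom, of a b] by (metis a_closed sigma_closed)
  next
    show "induced_map S P \<sigma> \<one>\<^bsub>S Quot P\<^esub> = \<one>\<^bsub>S Quot P\<^esub>"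
      using sm[of "\<one>\<^bsub>S\<^esub>"] ring_hom_one[OF rh] ring_hom_one[OF sigma_hom] by simp
  qed
  have "\<one>\<^bsub>S Quot P\<^esub> \<noteq> \<zero>\<^bsub>S Quot P\<^esub>"
    using P.rcos_const_imp_mem[of "\<one>\<^bsub>S\<^esub>"] assms(3) by (auto simp: FactRing_def)
  then show ?thesis
    using rh sh sm surj P.quotient_is_cring[OF is_cring] petit_algebra_axioms
    by (simp add: petit_reduction_def petit_reduction_axioms_def skew_polynomials_def skew_polynomials_axioms_def)
qed



section \<open>Valued fields\<close>

lemma (in abelian_group) minus_add_cancel:
  "x \<in> carrier G \<Longrightarrow> y \<in> carrier G \<Longrightarrow> x \<ominus> (y \<oplus> x) = \<ominus> y"
  by (simp add: a_minus_def a_comm[of y x] minus_add r_neg2)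

lemma (in abelian_group) add_minus_cancel:
  "x \<in> carrier G \<Longrightarrow> y \<in> carrier G \<Longrightarrow> y \<oplus> (x \<ominus> y) = x"
  by (simp add: a_minus_def a_comm[of x "\<ominus> y"] r_neg2)

lemma (in abelian_group) minus_diff_cancel:
  "x \<in> carrier G \<Longrightarrow> y \<in> carrier G \<Longrightarrow> z \<in> carrier G \<Longrightarrow> (x \<ominus> z) \<ominus> (y \<ominus> z) = x \<ominus> y"
  by (simp add: a_minus_def minus_add a_assoc a_comm[of "\<ominus> y" z] r_neg1)

lemma (in abelian_group) minus_minus_cancel:
  "x \<in> carrier G \<Longrightarrow> y \<in> carrier G \<Longrightarrow> y \<ominus> (y \<ominus> x) = x"
  by (simp add: a_minus_def minus_add r_neg2)

lemma powi_le_one_iff: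
  fixes c :: real
  assumes "0 < c" "c < 1"
  shows "c powi k \<le> 1 \<longleftrightarrow> 0 \<le> k"
proof (cases "0 \<le> k")
  case True
  then show ?thesis using assms by (simp add: power_int_le_one)
next
  case False
  then have "nat (- k) > 0" by simp
  then have "c ^ nat (- k) < 1" "0 < c ^ nat (- k)" using assms by (simp_all add: power_less_one_iff)
  then show ?thesis using False by (simp add: power_int_def field_simps)
qed

locale valued_field = K?: Ring.field K for K (structure) +
  fixes \<nu>
  assumes nonarch: "is_nonarch_abs K \<nu>"
begin

lemma val_nonneg: "x \<in> carrier K \<Longrightarrow> 0 \<le> \<nu> x"
  and val_eq_0_iff: "x \<in> carrier K \<Longrightarrow> \<nu> x = 0 \<longleftrightarrow> x = \<zero>"
  and val_mult: "x \<in> carrier K \<Longrightarrow> y \<in> carrier K \<Longrightarrow> \<nu> (x \<otimes> y) = \<nu> x * \<nu> y"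
  and val_add_max: "x \<in> carrier K \<Longrightarrow> y \<in> carrier K \<Longrightarrow> \<nu> (x \<oplus> y) \<le> max (\<nu> x) (\<nu> y)"
  using nonarch by (auto simp: is_nonarch_abs_def)

lemma val_zero [simp]: "\<nu> \<zero> = 0"
  using val_eq_0_iff by simp

lemma val_pos: "x \<in> carrier K \<Longrightarrow> x \<noteq> \<zero> \<Longrightarrow> 0 < \<nu> x"
  using val_nonneg[of x] val_eq_0_iff[of x] by linarith

lemma val_one [simp]: "\<nu> \<one> = 1"
proof -
  have "\<nu> \<one> * \<nu> \<one> = \<nu> \<one>" using val_mult[of \<one> \<one>] by simp
  then show ?thesis using val_eq_0_iff[of \<one>] by simp
qed

lemma val_neg [simp]: "x \<in> carrier K \<Longrightarrow> \<nu> (\<ominus> x) = \<nu> x"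
proof -
  assume x: "x \<in> carrier K"
  have "\<nu> (\<ominus> \<one>) * \<nu> (\<ominus> \<one>) = 1" using val_mult[of "\<ominus> \<one>" "\<ominus> \<one>"] by (simp add: l_minus)
  then have "\<nu> (\<ominus> \<one>) = 1"
    using val_nonneg[of "\<ominus> \<one>"] by (simp add: square_eq_1_iff)
  then show ?thesis using val_mult[of "\<ominus> \<one>" x] x by (simp add: l_minus)
qed

lemma val_add_le: "x \<in> carrier K \<Longrightarrow> y \<in> carrier K \<Longrightarrow> \<nu> x \<le> B \<Longrightarrow> \<nu> y \<le> B \<Longrightarrow> \<nu> (x \<oplus> y) \<le> B"
  using val_add_max[of x y] by simp

lemma val_minus_le: "x \<in> carrier K \<Longrightarrow> y \<in> carrier K \<Longrightarrow> \<nu> x \<le> B \<Longrightarrow> \<nu> y \<le> B \<Longrightarrow> \<nu> (x \<ominus> y) \<le> B"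
  unfolding a_minus_def by (rule val_add_le) auto

lemma val_pow: "x \<in> carrier K \<Longrightarrow> \<nu> (x [^] (n :: nat)) = \<nu> x ^ n"
  by (induction n) (simp_all add: val_mult)

lemma nonzero_inv:
  assumes "x \<in> carrier K" "x \<noteq> \<zero>"
  shows "inv x \<in> carrier K" "x \<otimes> inv x = \<one>" "\<nu> (inv x) = 1 / \<nu> x"
proof -
  have u: "x \<in> Units K" using assms field_Units by blast
  then show i: "inv x \<in> carrier K" "x \<otimes> inv x = \<one>" by auto
  have "\<nu> x * \<nu> (inv x) = 1" using val_mult[OF assms(1) i(1)] i(2) by simp
  then show "\<nu> (inv x) = 1 / \<nu> x" using val_pos[OF assms] by (simp add: field_simps)
qed

lemma val_divide:
  assumes "x \<in> carrier K" "a \<in> carrier K" "a \<noteq> \<zero>"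
  obtains y where "y \<in> carrier K" "x = a \<otimes> y" "\<nu> y = \<nu> x / \<nu> a"
proof
  have i: "inv a \<in> carrier K" "a \<otimes> inv a = \<one>" "\<nu> (inv a) = 1 / \<nu> a"
    using nonzero_inv[OF assms(2,3)] by auto
  show "inv a \<otimes> x \<in> carrier K" using i assms by simp
  show "x = a \<otimes> (inv a \<otimes> x)" using i assms by (simp add: m_assoc[symmetric])
  show "\<nu> (inv a \<otimes> x) = \<nu> x / \<nu> a" using i assms by (simp add: val_mult)
qed

lemma val_finsum_le:
  assumes "finite B" "h \<in> B \<rightarrow> carrier K" "\<And>b. b \<in> B \<Longrightarrow> \<nu> (h b) \<le> C" "0 \<le> C"
  shows "\<nu> (\<Oplus>b\<in>B. h b) \<le> C"
  using assms
proof (induction B)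
  case (insert a B)
  have "(\<Oplus>b\<in>insert a B. h b) = h a \<oplus> (\<Oplus>b\<in>B. h b)"
    using insert by (intro finsum_insert) auto
  moreover have "(\<Oplus>b\<in>B. h b) \<in> carrier K" using insert by (intro finsum_closed) auto
  moreover have "\<nu> (\<Oplus>b\<in>B. h b) \<le> C" using insert by auto
  ultimately show ?case using insert.prems by (simp add: val_add_le)
qed simp

abbreviation "VR \<equiv> val_ring K \<nu>"

lemma VR_iff: "x \<in> VR \<longleftrightarrow> x \<in> carrier K \<and> \<nu> x \<le> 1"
  by (simp add: val_ring_def)

lemma val_ring_subring: "subring VR K"
proof (rule subringI)
  show "h1 \<otimes> h2 \<in> VR" if "h1 \<in> VR" "h2 \<in> VR" for h1 h2
    using that mult_le_one[of "\<nu> h1" "\<nu> h2"] val_nonneg[of h2] by (auto simp: VR_iff val_mult)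
  show "h1 \<oplus> h2 \<in> VR" if "h1 \<in> VR" "h2 \<in> VR" for h1 h2
    using that val_add_le[of h1 h2 1] by (auto simp: VR_iff)
qed (auto simp: VR_iff)

lemma val_ring_cring: "cring (K\<lparr>carrier := VR\<rparr>)"
  using subcring_iff[OF subringE(1)[OF val_ring_subring]] subcringI'[OF val_ring_subring] by simp

end

locale discrete_valued_field = valued_field K \<nu> for K (structure) and \<nu> +
  fixes \<pi>
  assumes pi: "\<pi> \<in> carrier K" "0 < \<nu> \<pi>" "\<nu> \<pi> < 1"
    and discrete: "\<And>x. x \<in> carrier K \<Longrightarrow> x \<noteq> \<zero> \<Longrightarrow> \<exists>k::int. \<nu> x = \<nu> \<pi> powi k"
begin

lemma val_eq_pi_power:
  assumes "x \<in> carrier K" "x \<noteq> \<zero>" "\<nu> x \<le> 1"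
  shows "\<exists>k::nat. \<nu> x = \<nu> \<pi> ^ k"
proof -
  obtain k :: int where k: "\<nu> x = \<nu> \<pi> powi k" using discrete assms by blast
  then have "k \<ge> 0" using powi_le_one_iff[OF pi(2,3)] assms(3) by simp
  then show ?thesis using k by (auto simp: power_int_def)
qed

lemma val_less_one_le_pi:
  assumes "x \<in> carrier K" "\<nu> x < 1"
  shows "\<nu> x \<le> \<nu> \<pi>"
proof (cases "x = \<zero>")
  case False
  then obtain k :: nat where k: "\<nu> x = \<nu> \<pi> ^ k" using val_eq_pi_power assms by force
  have "k \<noteq> 0" using assms(2) k by (intro notI) simp
  then show ?thesis using k pi power_decreasing[of 1 k "\<nu> \<pi>"] by simp
qed (use pi in simp)

text \<open>Values of nonzero integral elements are powers of \<open>\<nu> \<pi>\<close> with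
  natural exponents, so a least exponent yields a largest value. Used with images of subsets of E,
  it gives E a uniformizer and its ideals a generator, both from the discreteness of K.\<close>

lemma val_max_exists:
  assumes "N \<subseteq> carrier K" "x0 \<in> N" "x0 \<noteq> \<zero>" "\<And>x. x \<in> N \<Longrightarrow> \<nu> x \<le> 1"
  shows "\<exists>a\<in>N. a \<noteq> \<zero> \<and> (\<forall>x\<in>N. \<nu> x \<le> \<nu> a)"
proof -
  define P where "P k \<longleftrightarrow> (\<exists>x\<in>N. x \<noteq> \<zero> \<and> \<nu> x = \<nu> \<pi> ^ k)" for k :: nat
  have ex: "\<exists>k. \<nu> x = \<nu> \<pi> ^ k" if "x \<in> N" "x \<noteq> \<zero>" for x
    using val_eq_pi_power[of x] assms that by blast
  then have "\<exists>k. P k" using assms(2,3) unfolding P_def by blast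
  then have "P (LEAST k. P k)" by (rule LeastI_ex)
  then obtain a where a: "a \<in> N" "a \<noteq> \<zero>" "\<nu> a = \<nu> \<pi> ^ (LEAST k. P k)"
    unfolding P_def[abs_def] by blast
  have "\<nu> x \<le> \<nu> a" if xN: "x \<in> N" for x
  proof (cases "x = \<zero>")
    case False
    then obtain k where k: "\<nu> x = \<nu> \<pi> ^ k" using ex xN by blast
    then have "P k" using xN False unfolding P_def by blast
    then have "(LEAST k. P k) \<le> k" by (rule Least_le)
    then show ?thesis using k a(3) pi by (simp add: power_decreasing)
  qed (use val_nonneg[of a] a(1) assms(1) in auto)
  then show ?thesis using a by blast
qed

end

text \<open>Only \<open>E\<close> has to be complete; discreteness and finiteness of residues are inherited from \<open>K\<close>.\<close>

locale local_extension = K: discrete_valued_field K \<nu> \<pi> + E: Ring.field E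
  for K :: "('a, 'k) ring_scheme" (structure) and \<nu> \<pi> and E :: "('t, 'e) ring_scheme" +
  fixes \<phi> :: "'t \<Rightarrow> 'a"
  assumes phi_hom: "\<phi> \<in> ring_hom E K"
    and complete: "is_complete_abs E (\<lambda>x. \<nu> (\<phi> x))"
    and nontrivial: "\<exists>x\<in>carrier E. 0 < \<nu> (\<phi> x) \<and> \<nu> (\<phi> x) < 1"
    and residue_finite: "finite (carrier ((K\<lparr>carrier := val_ring K \<nu>\<rparr>) Quot (max_ideal K \<nu>)))"
begin

abbreviation "\<mu> \<equiv> (\<lambda>x. \<nu> (\<phi> x))"
abbreviation "OK \<equiv> val_ring K \<nu>"
abbreviation "R \<equiv> val_ring E \<mu>"
abbreviation "ER \<equiv> E\<lparr>carrier := R\<rparr>"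

abbreviation zero_E (\<open>\<zero>\<^sub>E\<close>) where "\<zero>\<^sub>E \<equiv> \<zero>\<^bsub>E\<^esub>"
abbreviation one_E (\<open>\<one>\<^sub>E\<close>) where "\<one>\<^sub>E \<equiv> \<one>\<^bsub>E\<^esub>"
abbreviation add_E (infixl \<open>\<oplus>\<^sub>E\<close> 65) where "x \<oplus>\<^sub>E y \<equiv> x \<oplus>\<^bsub>E\<^esub> y"
abbreviation minus_E (infixl \<open>\<ominus>\<^sub>E\<close> 65) where "x \<ominus>\<^sub>E y \<equiv> x \<ominus>\<^bsub>E\<^esub> y"
abbreviation mult_E (infixl \<open>\<otimes>\<^sub>E\<close> 70) where "x \<otimes>\<^sub>E y \<equiv> x \<otimes>\<^bsub>E\<^esub> y"

lemma phi_closed [simp]: "x \<in> carrier E \<Longrightarrow> \<phi> x \<in> carrier K"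
  and phi_mult: "x \<in> carrier E \<Longrightarrow> y \<in> carrier E \<Longrightarrow> \<phi> (x \<otimes>\<^sub>E y) = \<phi> x \<otimes> \<phi> y"
  and phi_add: "x \<in> carrier E \<Longrightarrow> y \<in> carrier E \<Longrightarrow> \<phi> (x \<oplus>\<^sub>E y) = \<phi> x \<oplus> \<phi> y"
  and phi_one: "\<phi> \<one>\<^sub>E = \<one>"
  using phi_hom by (auto simp: ring_hom_def)

lemma phi_zero: "\<phi> \<zero>\<^sub>E = \<zero>"
  using ring_hom_zero[OF phi_hom] E.ring_axioms K.ring_axioms by blast

lemma phi_inj: "x \<in> carrier E \<Longrightarrow> \<phi> x = \<zero> \<Longrightarrow> x = \<zero>\<^sub>E"
proof (rule ccontr)
  assume x: "x \<in> carrier E" "\<phi> x = \<zero>" "x \<noteq> \<zero>\<^sub>E"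
  then have "x \<in> Units E" using E.field_Units by blast
  then have "x \<otimes>\<^sub>E inv\<^bsub>E\<^esub> x = \<one>\<^sub>E" "inv\<^bsub>E\<^esub> x \<in> carrier E" by auto
  then show False using phi_mult[OF x(1), of "inv\<^bsub>E\<^esub> x"] x phi_one K.one_not_zero by simp
qed

lemma phi_neg: "x \<in> carrier E \<Longrightarrow> \<phi> (\<ominus>\<^bsub>E\<^esub> x) = \<ominus> \<phi> x"
  using phi_add[of "\<ominus>\<^bsub>E\<^esub> x" x] phi_zero K.minus_equality[of "\<phi> (\<ominus>\<^bsub>E\<^esub> x)" "\<phi> x"]
  by (simp add: E.l_neg)

lemma valued_E: "valued_field E \<mu>"
proof (unfold_locales)
  show "is_nonarch_abs E \<mu>"
    unfolding is_nonarch_abs_def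
    using K.val_nonneg K.val_eq_0_iff phi_inj phi_zero
    by (auto simp: phi_mult phi_add K.val_mult K.val_add_max)
qed

sublocale VE: valued_field E \<mu>
  by (rule valued_E)

lemma R_iff: "x \<in> R \<longleftrightarrow> x \<in> carrier E \<and> \<mu> x \<le> 1"
  by (rule VE.VR_iff)

text \<open>A uniformizer of E. As an element of K it has the value of a power of \<pi>, the
  exponent being the ramification index of K over E.\<close>

definition unif where
  "unif = (SOME x. x \<in> carrier E \<and> 0 < \<mu> x \<and> \<mu> x < 1 \<and> (\<forall>y\<in>carrier E. \<mu> y < 1 \<longrightarrow> \<mu> y \<le> \<mu> x))"

lemma uniformizer: "unif \<in> carrier E" "0 < \<mu> unif" "\<mu> unif < 1" "\<And>y. y \<in> carrier E \<Longrightarrow> \<mu> y < 1 \<Longrightarrow> \<mu> y \<le> \<mu> unif"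
proof -
  obtain x0 where x0: "x0 \<in> carrier E" "0 < \<mu> x0" "\<mu> x0 < 1" using nontrivial by blast
  let ?N = "\<phi> ` {x \<in> carrier E. \<mu> x < 1}"
  have "\<exists>a\<in>?N. a \<noteq> \<zero> \<and> (\<forall>x\<in>?N. \<nu> x \<le> \<nu> a)"
    by (rule K.val_max_exists[of _ "\<phi> x0"]) (use x0 in auto)
  then obtain x where "x \<in> carrier E" "\<mu> x < 1" "\<phi> x \<noteq> \<zero>" "\<forall>y\<in>carrier E. \<mu> y < 1 \<longrightarrow> \<mu> y \<le> \<mu> x"
    by auto
  then have "x \<in> carrier E \<and> 0 < \<mu> x \<and> \<mu> x < 1 \<and> (\<forall>y\<in>carrier E. \<mu> y < 1 \<longrightarrow> \<mu> y \<le> \<mu> x)"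
    using K.val_pos by auto
  then have "unif \<in> carrier E \<and> 0 < \<mu> unif \<and> \<mu> unif < 1 \<and> (\<forall>y\<in>carrier E. \<mu> y < 1 \<longrightarrow> \<mu> y \<le> \<mu> unif)"
    unfolding unif_def by (rule someI)
  then show "unif \<in> carrier E" "0 < \<mu> unif" "\<mu> unif < 1" "\<And>y. y \<in> carrier E \<Longrightarrow> \<mu> y < 1 \<Longrightarrow> \<mu> y \<le> \<mu> unif"
    by auto
qed

lemma uniformizer_nonzero: "unif \<noteq> \<zero>\<^sub>E"
  using uniformizer(2) phi_zero by auto

subsection \<open>The valuation ring\<close>

lemma R_subring: "subring R E"
  by (rule VE.val_ring_subring)

lemma R_quotient_field:
  assumes "x \<in> carrier E"
  shows "\<exists>a\<in>R. \<exists>b\<in>R - {\<zero>\<^sub>E}. x \<otimes>\<^sub>E b = a"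
proof (cases "\<mu> x \<le> 1")
  case True
  then show ?thesis using assms E.one_not_zero
    by (intro bexI[of _ x] bexI[of _ "\<one>\<^sub>E"]) (auto simp: R_iff phi_one)
next
  case False
  then have x: "x \<noteq> \<zero>\<^sub>E" using phi_zero by auto
  note i = VE.nonzero_inv[OF assms x]
  have "inv\<^bsub>E\<^esub> x \<noteq> \<zero>\<^sub>E" using i(2) assms E.one_not_zero by auto
  moreover have "\<mu> (inv\<^bsub>E\<^esub> x) \<le> 1" using i(3) False by simp
  ultimately show ?thesis using i assms
    by (intro bexI[of _ "\<one>\<^sub>E"] bexI[of _ "inv\<^bsub>E\<^esub> x"]) (auto simp: R_iff phi_one)
qed

text \<open>Dividing by an element of largest absolute value in an ideal stays inside
  \<open>R\<close>, so every ideal is principal, and a principal ideal domain is Noetherian.\<close>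

lemma R_noetherian: "noetherian_domain (ER)"
proof -
  have gen: "\<exists>a\<in>carrier (ER). I = cgenideal (ER) a"
    if I: "ideal I (ER)" for I
  proof -
    note add = ideal.axioms(1)[OF I]
    have IR: "I \<subseteq> R" using additive_subgroup.a_subset[OF add] by simp
    have z: "\<zero>\<^sub>E \<in> I" using additive_subgroup.zero_closed[OF add] by simp
    have lc: "x \<otimes>\<^sub>E a \<in> I" if "x \<in> R" "a \<in> I" for x a
      using ideal.I_l_closed[OF I that(2), of x] that(1) by simp
    show ?thesis
    proof (cases "I \<subseteq> {\<zero>\<^sub>E}")
      case True
      then have "I = cgenideal (ER) \<zero>\<^sub>E"
        using z by (auto simp: cgenideal_def R_iff phi_zero intro!: exI[of _ "\<zero>\<^sub>E"])
      then show ?thesis by (intro bexI[of _ "\<zero>\<^sub>E"]) (auto simp: R_iff phi_zero)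
    next
      case False
      then obtain x0 where x0: "x0 \<in> I" "x0 \<noteq> \<zero>\<^sub>E" by blast
      have "\<exists>a\<in>\<phi> ` I. a \<noteq> \<zero> \<and> (\<forall>x\<in>\<phi> ` I. \<nu> x \<le> \<nu> a)"
      proof (rule K.val_max_exists[of _ "\<phi> x0"])
        show "\<phi> ` I \<subseteq> carrier K" using IR by (auto simp: R_iff)
        show "\<phi> x0 \<noteq> \<zero>" using phi_inj[of x0] x0 IR by (auto simp: R_iff)
        show "\<nu> x \<le> 1" if "x \<in> \<phi> ` I" for x using that IR by (auto simp: R_iff)
      qed (use x0 in simp)
      then obtain a where a: "a \<in> I" "\<phi> a \<noteq> \<zero>" "\<And>x. x \<in> I \<Longrightarrow> \<mu> x \<le> \<mu> a" by auto
      have aE: "a \<in> carrier E" "a \<noteq> \<zero>\<^sub>E" using a(1,2) IR phi_zero by (auto simp: R_iff)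
      have pos: "0 < \<mu> a" using VE.val_pos[OF aE] .
      have "I = cgenideal (ER) a"
      proof (intro equalityI subsetI)
        fix x assume x: "x \<in> I"
        then have xE: "x \<in> carrier E" using IR by (auto simp: R_iff)
        obtain y where y: "y \<in> carrier E" "x = a \<otimes>\<^sub>E y" "\<mu> y = \<mu> x / \<mu> a"
          using VE.val_divide[OF xE aE] by metis
        have "y \<in> R" using y a(3)[OF x] pos by (simp add: R_iff)
        then show "x \<in> cgenideal (ER) a"
          using y(2) E.m_comm[OF aE(1) y(1)] by (auto simp: cgenideal_def)
      next
        fix x assume "x \<in> cgenideal (ER) a"
        then show "x \<in> I" using lc a(1) by (auto simp: cgenideal_def)
      qed
      then show ?thesis using a(1) IR by auto
    qed
  qed
  have "domain (ER)"
    using E.subdomainI'[OF R_subring] E.subdomain_iff[of R] subringE(1)[OF R_subring] by simp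
  then interpret principal_domain "ER"
    unfolding principal_domain_def principal_domain_axioms_def using gen by blast
  show ?thesis by unfold_locales
qed

subsection \<open>Lifting a residue basis\<close>

lemma residue_cover: "\<exists>T. finite T \<and> T \<subseteq> OK \<and> (\<forall>x\<in>OK. \<exists>t\<in>T. \<nu> (x \<ominus> t) < 1)"
proof -
  let ?Q = "(K\<lparr>carrier := OK\<rparr>) Quot (max_ideal K \<nu>)"
  let ?c = "\<lambda>x. max_ideal K \<nu> +>\<^bsub>K\<lparr>carrier := OK\<rparr>\<^esub> x"
  define T where "T = (\<lambda>B. SOME t. t \<in> B) ` carrier ?Q"
  have carr: "carrier ?Q = ?c ` OK"
    by (auto simp: FactRing_def A_RCOSETS_def RCOSETS_def a_r_coset_def)
  have c: "?c x = {n \<oplus> x | n. n \<in> max_ideal K \<nu>}" for x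
    by (auto simp: a_r_coset_def r_coset_def)
  have some: "(SOME t. t \<in> ?c x) \<in> ?c x" if "x \<in> OK" for x
  proof (rule someI[of _ x])
    show "x \<in> ?c x" unfolding c using that
      by (auto intro!: exI[of _ \<zero>] simp: K.VR_iff max_ideal_def)
  qed
  have cx: "t \<in> OK \<and> \<nu> (x \<ominus> t) < 1" if x: "x \<in> OK" and t: "t \<in> ?c x" for x t
  proof -
    obtain n where n: "n \<in> carrier K" "\<nu> n < 1" "t = n \<oplus> x"
      using t unfolding c by (auto simp: max_ideal_def)
    have xK: "x \<in> carrier K" "\<nu> x \<le> 1" using x by (auto simp: K.VR_iff)
    have "x \<ominus> t = \<ominus> n" using n xK by (simp add: K.minus_add_cancel)
    moreover have "\<nu> t \<le> 1" using n xK by (simp add: K.val_add_le)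
    ultimately show ?thesis using n xK by (simp add: K.VR_iff)
  qed
  have "finite T" unfolding T_def using residue_finite by simp
  moreover have "T \<subseteq> OK" unfolding T_def carr using cx some by blast
  moreover have "\<forall>x\<in>OK. \<exists>t\<in>T. \<nu> (x \<ominus> t) < 1"
    unfolding T_def carr using cx some by blast
  ultimately show ?thesis by blast
qed

text \<open>One more \<pi>-adic digit per step: the error left by \<open>T\<close> is \<pi>^k times
  an integral element, which is approximated in turn by a residue representative from
  \<open>U\<close>.\<close>

lemma residue_cover_power:
  "\<exists>T. finite T \<and> T \<subseteq> OK \<and> (\<forall>x\<in>OK. \<exists>t\<in>T. \<nu> (x \<ominus> t) \<le> \<nu> \<pi> ^ k)"
proof (induction k)
  case 0
  show ?case
    by (rule exI[of _ "{\<zero>}"]) (auto simp: K.VR_iff a_minus_def)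
next
  case (Suc k)
  obtain T where T: "finite T" "T \<subseteq> OK" "\<And>x. x \<in> OK \<Longrightarrow> \<exists>t\<in>T. \<nu> (x \<ominus> t) \<le> \<nu> \<pi> ^ k"
    using Suc by blast
  obtain U where U: "finite U" "U \<subseteq> OK" "\<And>x. x \<in> OK \<Longrightarrow> \<exists>t\<in>U. \<nu> (x \<ominus> t) < 1"
    using residue_cover by blast
  let ?p = "\<pi> [^] k"
  have p: "?p \<in> carrier K" "\<nu> ?p = \<nu> \<pi> ^ k" "?p \<noteq> \<zero>"
    using K.pi K.val_pow[of \<pi> k] by auto
  have le1: "\<nu> \<pi> ^ k \<le> 1" using K.pi by (simp add: power_le_one)
  let ?V = "(\<lambda>(t, u). t \<oplus> ?p \<otimes> u) ` (T \<times> U)"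
  have "finite ?V" using T U by simp
  moreover have "?V \<subseteq> OK"
  proof
    fix v assume "v \<in> ?V"
    then obtain t u where tu: "t \<in> T" "u \<in> U" "v = t \<oplus> ?p \<otimes> u" by auto
    have tO: "t \<in> carrier K" "\<nu> t \<le> 1" "u \<in> carrier K" "\<nu> u \<le> 1"
      using tu(1,2) T(2) U(2) by (auto simp: K.VR_iff)
    have "\<nu> (?p \<otimes> u) \<le> 1"
      using tO p le1 K.val_nonneg[of u] K.pi(2) by (simp add: K.val_mult mult_le_one)
    then show "v \<in> OK" using tu(3) tO p by (simp add: K.VR_iff K.val_add_le)
  qed
  moreover have "\<exists>v\<in>?V. \<nu> (x \<ominus> v) \<le> \<nu> \<pi> ^ Suc k" if x: "x \<in> OK" for x
  proof -
    have xK: "x \<in> carrier K" using x by (simp add: K.VR_iff)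
    obtain t where t: "t \<in> T" "\<nu> (x \<ominus> t) \<le> \<nu> \<pi> ^ k" using T(3)[OF x] by blast
    have tK: "t \<in> carrier K" using t(1) T(2) by (auto simp: K.VR_iff)
    have xt: "x \<ominus> t \<in> carrier K" using xK tK by simp
    obtain y where y: "y \<in> carrier K" "x \<ominus> t = ?p \<otimes> y" "\<nu> y = \<nu> (x \<ominus> t) / \<nu> ?p"
      using K.val_divide[OF xt p(1,3)] by metis
    have "\<nu> y \<le> 1" using y(3) t(2) p(2) K.pi(2) by (simp add: divide_le_eq)
    then have "y \<in> OK" using y(1) by (simp add: K.VR_iff)
    then obtain u where u: "u \<in> U" "\<nu> (y \<ominus> u) < 1" using U(3) by blast
    have uK: "u \<in> carrier K" using u(1) U(2) by (auto simp: K.VR_iff)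
    have "x = t \<oplus> (x \<ominus> t)" using xK tK by (simp add: K.add_minus_cancel)
    then have "x \<ominus> (t \<oplus> ?p \<otimes> u) = (t \<oplus> ?p \<otimes> y) \<ominus> (t \<oplus> ?p \<otimes> u)" using y(2) by simp
    also have "\<dots> = ?p \<otimes> (y \<ominus> u)"
      using tK p(1) y(1) uK
      by (simp add: a_minus_def K.minus_add K.r_distr K.r_minus K.a_ac K.r_neg1 K.r_neg2)
    finally have "\<nu> (x \<ominus> (t \<oplus> ?p \<otimes> u)) = \<nu> \<pi> ^ k * \<nu> (y \<ominus> u)"
      using p y(1) uK by (simp add: K.val_mult)
    \<comment> \<open>Discreteness sharpens an error below 1 to one of at most
      \<open>\<nu> \<pi>\<close>, which supplies the next power.\<close>
    also have "\<dots> \<le> \<nu> \<pi> ^ k * \<nu> \<pi>"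
      using K.val_less_one_le_pi[of "y \<ominus> u"] u(2) y(1) uK K.pi(2) by (intro mult_left_mono) auto
    finally show ?thesis using t(1) u(1) by (intro bexI[of _ "t \<oplus> ?p \<otimes> u"]) (auto simp: mult.commute)
  qed
  ultimately show ?case by (intro exI[of _ ?V] conjI ballI)
qed

text \<open>The vectors are indexed by themselves, so that discarding a vector is removing an
  element from a set.\<close>

definition comb where "comb B c = (\<Oplus>b\<in>B. \<phi> (c b) \<otimes> b)"

text \<open>Generation of O_K modulo the uniformizer of E only. Exact generation is deduced later
  from completeness.\<close>

definition spans where
  "spans B \<longleftrightarrow> finite B \<and> B \<subseteq> OK \<and>
     (\<forall>x\<in>OK. \<exists>c. c \<in> B \<rightarrow> R \<and> \<nu> (x \<ominus> comb B c) \<le> \<mu> unif)"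

lemma comb_closed: "B \<subseteq> OK \<Longrightarrow> c \<in> B \<rightarrow> carrier E \<Longrightarrow> comb B c \<in> carrier K"
  unfolding comb_def by (intro K.finsum_closed) (auto simp: K.VR_iff Pi_def subset_iff)

lemma comb_add:
  assumes "B \<subseteq> OK" "c \<in> B \<rightarrow> carrier E" "d \<in> B \<rightarrow> carrier E"
  shows "comb B (\<lambda>b. c b \<oplus>\<^sub>E d b) = comb B c \<oplus> comb B d"
proof -
  have "comb B (\<lambda>b. c b \<oplus>\<^sub>E d b) = (\<Oplus>b\<in>B. (\<phi> (c b) \<otimes> b) \<oplus> (\<phi> (d b) \<otimes> b))"
    unfolding comb_def using assms
    by (intro K.finsum_cong') (auto simp: K.VR_iff phi_add K.l_distr Pi_def subset_iff)
  then show ?thesis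
    unfolding comb_def using assms
    by (subst (asm) K.finsum_addf) (auto simp: K.VR_iff Pi_def subset_iff)
qed

lemma comb_smult:
  assumes "finite B" "B \<subseteq> OK" "c \<in> B \<rightarrow> carrier E" "a \<in> carrier E"
  shows "comb B (\<lambda>b. a \<otimes>\<^sub>E c b) = \<phi> a \<otimes> comb B c"
proof -
  have "comb B (\<lambda>b. a \<otimes>\<^sub>E c b) = (\<Oplus>b\<in>B. \<phi> a \<otimes> (\<phi> (c b) \<otimes> b))"
    unfolding comb_def using assms
    by (intro K.finsum_cong') (auto simp: K.VR_iff phi_mult K.m_assoc Pi_def subset_iff)
  then show ?thesis
    unfolding comb_def using assms
    by (subst K.finsum_rdistr) (auto simp: K.VR_iff Pi_def subset_iff)
qed

lemma comb_minus:
  assumes "finite B" "B \<subseteq> OK" "c \<in> B \<rightarrow> carrier E" "d \<in> B \<rightarrow> carrier E"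
  shows "comb B (\<lambda>b. c b \<ominus>\<^sub>E d b) = comb B c \<ominus> comb B d"
proof -
  have "comb B (\<lambda>b. c b \<ominus>\<^sub>E d b) = comb B (\<lambda>b. c b \<oplus>\<^sub>E (\<ominus>\<^bsub>E\<^esub> \<one>\<^sub>E) \<otimes>\<^sub>E d b)"
    unfolding comb_def using assms
    by (intro K.finsum_cong') (auto simp: K.VR_iff a_minus_def E.l_minus Pi_def subset_iff)
  also have "\<dots> = comb B c \<oplus> comb B (\<lambda>b. (\<ominus>\<^bsub>E\<^esub> \<one>\<^sub>E) \<otimes>\<^sub>E d b)"
    using assms by (intro comb_add) auto
  also have "\<dots> = comb B c \<ominus> comb B d"
    using assms comb_closed[OF assms(2,4)]
    by (subst comb_smult) (auto simp: phi_neg phi_one a_minus_def K.l_minus)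
  finally show ?thesis .
qed

lemma comb_val_le:
  assumes "finite B" "B \<subseteq> OK" "c \<in> B \<rightarrow> carrier E" "\<And>b. b \<in> B \<Longrightarrow> \<mu> (c b) \<le> C" "0 \<le> C"
  shows "\<nu> (comb B c) \<le> C"
  unfolding comb_def
proof (rule K.val_finsum_le[OF assms(1)])
  fix b assume b: "b \<in> B"
  have bK: "b \<in> carrier K" "\<nu> b \<le> 1" "c b \<in> carrier E" using b assms by (auto simp: K.VR_iff)
  have "\<mu> (c b) * \<nu> b \<le> C * 1"
    using assms(4)[OF b] bK assms(5) K.val_nonneg[OF bK(1)] by (intro mult_mono) auto
  then show "\<nu> (\<phi> (c b) \<otimes> b) \<le> C" using bK by (simp add: K.val_mult)
qed (use assms in \<open>auto simp: K.VR_iff Pi_def subset_iff\<close>)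

text \<open>The uniformizer of E has the same value as some \<pi>^k, so representatives modulo
  \<pi>^k generate, each element being approximated by a single representative with coefficient
  1.\<close>

lemma spans_exists: "\<exists>B. spans B"
proof -
  have "\<phi> unif \<noteq> \<zero>" using uniformizer_nonzero phi_inj uniformizer(1) by blast
  then obtain k where k: "\<mu> unif = \<nu> \<pi> ^ k"
    using K.val_eq_pi_power[of "\<phi> unif"] uniformizer by auto
  obtain T where T: "finite T" "T \<subseteq> OK" "\<And>x. x \<in> OK \<Longrightarrow> \<exists>t\<in>T. \<nu> (x \<ominus> t) \<le> \<nu> \<pi> ^ k"
    using residue_cover_power[of k] by blast
  have "\<exists>c. c \<in> T \<rightarrow> R \<and> \<nu> (x \<ominus> comb T c) \<le> \<mu> unif" if "x \<in> OK" for x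
  proof -
    obtain t where t: "t \<in> T" "\<nu> (x \<ominus> t) \<le> \<nu> \<pi> ^ k" using T(3)[OF \<open>x \<in> OK\<close>] by blast
    let ?c = "\<lambda>b. if b = t then \<one>\<^sub>E else \<zero>\<^sub>E"
    have TK: "T \<subseteq> carrier K" using T(2) by (auto simp: K.VR_iff)
    have "comb T ?c = (\<Oplus>b\<in>T. if t = b then b else \<zero>)"
      unfolding comb_def using TK
      by (intro K.finsum_cong') (auto simp: phi_one phi_zero subset_iff)
    also have "\<dots> = t"
      using K.finsum_singleton[OF t(1) T(1), of "\<lambda>b. b"] TK by auto
    finally show ?thesis
      using t(2) k by (intro exI[of _ ?c]) (auto simp: R_iff phi_one phi_zero)
  qed
  then show ?thesis using T(1,2) unfolding spans_def by blast
qed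

text \<open>Minimal cardinality stands in for linear independence over the residue field of E, so
  that no vector space over that field has to be formed.\<close>

definition basis_set where "basis_set = (ARG_MIN card B. spans B)"

lemma basis_set_spans: "spans basis_set"
  and basis_set_min: "spans B \<Longrightarrow> card basis_set \<le> card B"
proof -
  obtain B0 where "spans B0" using spans_exists by blast
  then have "spans basis_set \<and> (\<forall>B. spans B \<longrightarrow> card basis_set \<le> card B)"
    unfolding basis_set_def by (rule arg_min_nat_lemma)
  then show "spans basis_set" "spans B \<Longrightarrow> card basis_set \<le> card B" by blast+
qed

lemma basis_set_finite [simp]: "finite basis_set" and basis_set_OK: "basis_set \<subseteq> OK"
  using basis_set_spans unfolding spans_def by blast+

text \<open>If a coefficient of such a relation were a unit, its vector could be expressed through
  the others modulo the uniformizer and dropped, against minimality.\<close>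

lemma residue_independent:
  assumes c: "c \<in> basis_set \<rightarrow> R" "\<nu> (comb basis_set c) \<le> \<mu> unif" and b0: "b0 \<in> basis_set"
  shows "\<mu> (c b0) < 1"
proof (rule ccontr)
  assume "\<not> \<mu> (c b0) < 1"
  moreover have cb0: "c b0 \<in> carrier E" "\<mu> (c b0) \<le> 1" using c(1) b0 by (auto simp: R_iff)
  ultimately have one: "\<mu> (c b0) = 1" by simp
  let ?B = "basis_set" let ?C = "basis_set - {b0}"
  have cE: "c \<in> ?B \<rightarrow> carrier E" using c(1) by (auto simp: R_iff Pi_def)
  have nz: "c b0 \<noteq> \<zero>\<^sub>E" using one phi_zero by auto
  have "spans ?C"
    unfolding spans_def
  proof (intro conjI ballI)
    fix x assume x: "x \<in> OK"
    then have xK: "x \<in> carrier K" by (simp add: K.VR_iff)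
    obtain d where d: "d \<in> ?B \<rightarrow> R" "\<nu> (x \<ominus> comb ?B d) \<le> \<mu> unif"
      using basis_set_spans x unfolding spans_def by blast
    have dE: "d \<in> ?B \<rightarrow> carrier E" using d(1) by (auto simp: R_iff Pi_def)
    then have db0: "d b0 \<in> carrier E" "\<mu> (d b0) \<le> 1" using d(1) b0 by (auto simp: R_iff)
    obtain e where e: "e \<in> carrier E" "d b0 = c b0 \<otimes>\<^sub>E e" "\<mu> e = \<mu> (d b0) / \<mu> (c b0)"
      using VE.val_divide[OF db0(1) cb0(1) nz] by metis
    have e1: "\<mu> e \<le> 1" using e(3) one db0 by simp
    \<comment> \<open>The factor \<open>e\<close> is \<open>d b0 / c b0\<close>, integral because
      \<open>c b0\<close> is a unit. Subtracting \<open>e\<close> times the small combination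
      cancels the coefficient of \<open>b0\<close> and changes the value represented by at most
      \<open>\<mu> unif\<close>.\<close>
    let ?d = "\<lambda>b. d b \<ominus>\<^sub>E e \<otimes>\<^sub>E c b"
    have d'E: "?d \<in> ?B \<rightarrow> carrier E" using dE cE e(1) by auto
    have d'R: "?d b \<in> R" if "b \<in> ?B" for b
    proof -
      have "d b \<in> R" "e \<in> R" "c b \<in> R"
        using that d(1) c(1) e(1) e1 by (auto simp: R_iff)
      moreover from this have "e \<otimes>\<^sub>E c b \<in> R" by (intro subringE(6)[OF R_subring])
      ultimately show ?thesis using VE.val_minus_le[of "d b" "e \<otimes>\<^sub>E c b" 1] by (simp add: R_iff)
    qed
    have "?d b0 = \<zero>\<^sub>E" using e cb0(1) by (simp add: E.m_comm E.r_neg a_minus_def)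
    then have "comb ?B ?d = comb ?C ?d"
      unfolding comb_def
      using K.finsum_insert[of ?C b0 "\<lambda>b. \<phi> (?d b) \<otimes> b"] b0 d'E basis_set_OK
      by (simp add: insert_absorb insert_Diff phi_zero Pi_def subset_iff K.VR_iff)
    moreover have "comb ?B ?d = comb ?B d \<ominus> \<phi> e \<otimes> comb ?B c"
      using dE cE e(1) basis_set_OK by (subst comb_minus) (auto simp: comb_smult)
    ultimately have eq: "comb ?C ?d = comb ?B d \<ominus> \<phi> e \<otimes> comb ?B c" by simp
    have cl: "comb ?B d \<in> carrier K" "comb ?B c \<in> carrier K"
      using comb_closed basis_set_OK dE cE by auto
    have "x \<ominus> comb ?C ?d = (x \<ominus> comb ?B d) \<oplus> \<phi> e \<otimes> comb ?B c"
      unfolding eq using xK cl e(1) by (simp add: a_minus_def K.minus_add K.a_ac)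
    moreover have "\<nu> (\<phi> e \<otimes> comb ?B c) \<le> \<mu> unif"
    proof -
      have "\<nu> (\<phi> e \<otimes> comb ?B c) = \<mu> e * \<nu> (comb ?B c)" using cl e(1) by (simp add: K.val_mult)
      also have "\<dots> \<le> 1 * \<mu> unif"
        using e1 c(2) K.val_nonneg[OF cl(2)] by (intro mult_mono) auto
      finally show ?thesis by simp
    qed
    ultimately have "\<nu> (x \<ominus> comb ?C ?d) \<le> \<mu> unif"
      using d(2) xK cl e(1) by (simp add: K.val_add_le)
    then show "\<exists>c. c \<in> ?C \<rightarrow> R \<and> \<nu> (x \<ominus> comb ?C c) \<le> \<mu> unif"
      using d'R by (intro exI[of _ ?d]) auto
  qed (use basis_set_OK in auto)
  then have "card ?B \<le> card ?C" by (rule basis_set_min)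
  moreover have "card ?C < card ?B" using b0 by (intro card_Diff1_less) auto
  ultimately show False by simp
qed

text \<open>Dividing a nontrivial relation by a coefficient of largest absolute value makes all
  coefficients integral and one of them 1, which \<open>residue_independent\<close>
  excludes.\<close>

lemma independent:
  assumes c: "c \<in> basis_set \<rightarrow> carrier E" "comb basis_set c = \<zero>" and b: "b \<in> basis_set"
  shows "c b = \<zero>\<^sub>E"
proof (rule ccontr)
  assume nz: "c b \<noteq> \<zero>\<^sub>E"
  let ?B = basis_set let ?M = "Max ((\<lambda>b. \<mu> (c b)) ` ?B)"
  have "?M \<in> (\<lambda>b. \<mu> (c b)) ` ?B" using b by (intro Max_in) auto
  then obtain b0 where b0: "b0 \<in> ?B" "\<mu> (c b0) = ?M" by auto
  have max: "\<mu> (c b') \<le> \<mu> (c b0)" if "b' \<in> ?B" for b'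
    unfolding b0(2) using that by (intro Max_ge) auto
  have bE: "c b \<in> carrier E" "c b0 \<in> carrier E" using b b0 c(1) by auto
  have pos: "0 < \<mu> (c b0)" using VE.val_pos[OF bE(1) nz] max[OF b] by simp
  then have nz0: "c b0 \<noteq> \<zero>\<^sub>E" using phi_zero by auto
  note i = VE.nonzero_inv[OF bE(2) nz0]
  let ?d = "\<lambda>b. inv\<^bsub>E\<^esub> (c b0) \<otimes>\<^sub>E c b"
  have "comb ?B ?d = \<phi> (inv\<^bsub>E\<^esub> (c b0)) \<otimes> comb ?B c"
    using c i basis_set_OK by (intro comb_smult) auto
  then have "\<nu> (comb ?B ?d) \<le> \<mu> unif" using c(2) i(1) uniformizer(2) by simp
  moreover have "?d \<in> ?B \<rightarrow> R"
  proof
    fix b' assume b': "b' \<in> ?B"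
    then have "c b' \<in> carrier E" using c(1) by auto
    then show "?d b' \<in> R"
      using i max[OF b'] pos by (simp add: R_iff phi_mult K.val_mult divide_le_eq)
  qed
  ultimately have "\<mu> (?d b0) < 1" using residue_independent[of ?d b0] b0(1) by simp
  moreover have "?d b0 = \<one>\<^sub>E" using i bE by (simp add: E.m_comm)
  ultimately show False by (simp add: phi_one)
qed

text \<open>By the ultrametric inequality a sum of later increments is no larger than the bound on
  the first, so the sequence is Cauchy without summing a series. The limit is integral because it
  differs from some member by less than 1.\<close>

lemma complete_geometric:
  assumes s: "\<And>k. s k \<in> R" "\<And>k. \<mu> (s (Suc k) \<ominus>\<^sub>E s k) \<le> \<mu> unif ^ k"
  shows "\<exists>l\<in>R. (\<lambda>n. \<mu> (s n \<ominus>\<^sub>E l)) \<longlonglongrightarrow> 0"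
proof -
  let ?r = "\<mu> unif"
  have r: "0 < ?r" "?r < 1" using uniformizer by auto
  have sE: "s k \<in> carrier E" "\<mu> (s k) \<le> 1" for k using s(1)[of k] by (auto simp: R_iff)
  have tail: "\<mu> (s (k + j) \<ominus>\<^sub>E s k) \<le> ?r ^ k" for k j
  proof (induction j)
    case 0
    then show ?case using sE r by (simp add: a_minus_def E.r_neg phi_zero)
  next
    case (Suc j)
    have "s (k + Suc j) \<ominus>\<^sub>E s k = (s (Suc (k + j)) \<ominus>\<^sub>E s (k + j)) \<oplus>\<^sub>E (s (k + j) \<ominus>\<^sub>E s k)"
      using sE(1) by (simp add: a_minus_def E.a_assoc E.r_neg1)
    moreover have "\<mu> (s (Suc (k + j)) \<ominus>\<^sub>E s (k + j)) \<le> ?r ^ k"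
    proof -
      have "?r ^ (k + j) \<le> ?r ^ k" using r by (intro power_decreasing) auto
      then show ?thesis using s(2)[of "k + j"] by linarith
    qed
    ultimately show ?case using Suc sE(1) by (simp add: VE.val_add_le)
  qed
  have "\<exists>n0. \<forall>i\<ge>n0. \<forall>j\<ge>n0. \<mu> (s i \<ominus>\<^sub>E s j) < \<epsilon>" if "\<epsilon> > 0" for \<epsilon>
  proof -
    obtain n0 where n0: "?r ^ n0 < \<epsilon>" using real_arch_pow_inv[OF \<open>\<epsilon> > 0\<close> r(2)] by blast
    have "\<mu> (s i \<ominus>\<^sub>E s j) < \<epsilon>" if "i \<ge> n0" "j \<ge> n0" for i j
    proof -
      have "s i \<ominus>\<^sub>E s j = (s i \<ominus>\<^sub>E s n0) \<ominus>\<^sub>E (s j \<ominus>\<^sub>E s n0)"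
        using sE(1) by (simp add: E.minus_diff_cancel)
      then have "\<mu> (s i \<ominus>\<^sub>E s j) \<le> ?r ^ n0"
        using tail[of n0 "i - n0"] tail[of n0 "j - n0"] that sE(1) by (simp add: VE.val_minus_le)
      then show ?thesis using n0 by simp
    qed
    then show ?thesis by blast
  qed
  then obtain l where l: "l \<in> carrier E" "(\<lambda>n. \<mu> (s n \<ominus>\<^sub>E l)) \<longlonglongrightarrow> 0"
    using complete sE(1) unfolding is_complete_abs_def by metis
  obtain n where n: "\<mu> (s n \<ominus>\<^sub>E l) < 1"
    using order_tendstoD(2)[OF l(2), of 1] by (auto simp: eventually_sequentially)
  have "l = s n \<ominus>\<^sub>E (s n \<ominus>\<^sub>E l)"
    using sE(1) l(1) by (simp add: E.minus_minus_cancel)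
  then have "\<mu> l \<le> 1" using VE.val_minus_le[of "s n" "s n \<ominus>\<^sub>E l" 1] sE n l(1) by simp
  then show ?thesis using l by (auto simp: R_iff)
qed

lemma spans_exact:
  assumes x: "x \<in> OK"
  shows "\<exists>c\<in>basis_set \<rightarrow> R. x = comb basis_set c"
proof -
  let ?B = basis_set let ?w = "\<phi> unif" let ?r = "\<mu> unif"
  note BO = basis_set_OK
  have r: "0 < ?r" "?r < 1" using uniformizer by auto
  have w: "?w \<in> carrier K" "?w \<noteq> \<zero>" using uniformizer uniformizer_nonzero phi_inj by auto
  have xK: "x \<in> carrier K" using x by (simp add: K.VR_iff)
  \<comment> \<open>\<open>P\<close> bounds the error after n steps, \<open>Q\<close> the n-th
    correction of each coefficient. Thus convergence takes place among the coefficients, and it is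
    the completeness of E that provides the limit.\<close>
  define P where "P n s \<longleftrightarrow> s \<in> ?B \<rightarrow> R \<and> \<nu> (x \<ominus> comb ?B s) \<le> ?r ^ n" for n s
  define Q where "Q n s s' \<longleftrightarrow> (\<forall>b\<in>?B. \<mu> (s' b \<ominus>\<^sub>E s b) \<le> ?r ^ n)" for n s s'
  have R_E: "s \<in> ?B \<rightarrow> carrier E" if "s \<in> ?B \<rightarrow> R" for s using that by (auto simp: R_iff Pi_def)
  have "\<exists>s. \<forall>n. P n (s n) \<and> Q n (s n) (s (Suc n))"
  proof (rule dependent_nat_choice)
    have "comb ?B (\<lambda>b. \<zero>\<^sub>E) = (\<Oplus>b\<in>?B. \<zero>)"
      unfolding comb_def using BO by (intro K.finsum_cong') (auto simp: phi_zero K.VR_iff subset_iff)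
    then show "\<exists>s. P 0 s"
      using x unfolding P_def
      by (intro exI[of _ "\<lambda>b. \<zero>\<^sub>E"]) (auto simp: R_iff phi_zero K.VR_iff a_minus_def)
  next
    fix s n assume "P n s"
    then have s: "s \<in> ?B \<rightarrow> R" "\<nu> (x \<ominus> comb ?B s) \<le> ?r ^ n" by (auto simp: P_def)
    note sE = R_E[OF s(1)]
    have cs: "comb ?B s \<in> carrier K" using comb_closed BO sE by auto
    let ?p = "unif [^]\<^bsub>E\<^esub> n"
    have p: "?p \<in> carrier E" "\<mu> ?p = ?r ^ n" using uniformizer(1) VE.val_pow by auto
    have pnz: "\<phi> ?p \<in> carrier K" "\<phi> ?p \<noteq> \<zero>" using p r by auto
    have xs: "x \<ominus> comb ?B s \<in> carrier K" using xK cs by simp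
    obtain y where y: "y \<in> carrier K" "x \<ominus> comb ?B s = \<phi> ?p \<otimes> y" "\<nu> y = \<nu> (x \<ominus> comb ?B s) / \<mu> ?p"
      using K.val_divide[OF xs pnz] by metis
    have "y \<in> OK" using y(1,3) s(2) p r by (simp add: K.VR_iff divide_le_eq)
    then obtain c where c: "c \<in> ?B \<rightarrow> R" "\<nu> (y \<ominus> comb ?B c) \<le> ?r"
      using basis_set_spans unfolding spans_def by blast
    note cE = R_E[OF c(1)]
    have cc: "comb ?B c \<in> carrier K" using comb_closed BO cE by auto
    let ?t = "\<lambda>b. ?p \<otimes>\<^sub>E c b" let ?s = "\<lambda>b. s b \<oplus>\<^sub>E ?t b"
    have tE: "?t \<in> ?B \<rightarrow> carrier E" using cE p by auto
    have tle: "\<mu> (?t b) \<le> ?r ^ n" if "b \<in> ?B" for b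
    proof -
      have cb: "c b \<in> carrier E" "\<mu> (c b) \<le> 1" using that c(1) by (auto simp: R_iff)
      have "\<mu> ?p * \<mu> (c b) \<le> ?r ^ n * 1"
        using cb p r K.val_nonneg[of "\<phi> (c b)"] by (intro mult_mono) auto
      then show ?thesis using cb p by (simp add: VE.val_mult)
    qed
    have "comb ?B ?s = comb ?B s \<oplus> \<phi> ?p \<otimes> comb ?B c"
      using BO sE cE p tE by (subst comb_add) (auto simp: comb_smult)
    then have "x \<ominus> comb ?B ?s = (x \<ominus> comb ?B s) \<ominus> \<phi> ?p \<otimes> comb ?B c"
      using xK cs cc pnz by (simp add: a_minus_def K.minus_add K.a_ac)
    also have "\<dots> = \<phi> ?p \<otimes> (y \<ominus> comb ?B c)"
      unfolding y(2) using y(1) cc pnz by (simp add: a_minus_def K.r_distr K.r_minus)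
    finally have "\<nu> (x \<ominus> comb ?B ?s) = ?r ^ n * \<nu> (y \<ominus> comb ?B c)"
      using y(1) cc pnz p by (simp add: K.val_mult)
    also have "\<dots> \<le> ?r ^ n * ?r" using c(2) r by (intro mult_left_mono) auto
    finally have 1: "\<nu> (x \<ominus> comb ?B ?s) \<le> ?r ^ Suc n" by (simp add: mult.commute)
    have 2: "?s b \<in> R" if "b \<in> ?B" for b
    proof -
      have "s b \<in> carrier E" "\<mu> (s b) \<le> 1" "?t b \<in> carrier E" using that s(1) tE by (auto simp: R_iff)
      moreover have "\<mu> (?t b) \<le> 1" using tle[OF that] power_le_one[of ?r n] r by simp
      ultimately show ?thesis by (simp add: R_iff VE.val_add_le)
    qed
    have 3: "\<mu> (?s b \<ominus>\<^sub>E s b) \<le> ?r ^ n" if "b \<in> ?B" for b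
    proof -
      have E: "s b \<in> carrier E" "?t b \<in> carrier E" using that sE tE by auto
      have "?s b \<ominus>\<^sub>E s b = ?t b" using E by (simp add: a_minus_def E.a_ac E.r_neg E.r_neg2 E.r_neg1 del: E.m_closed)
      then show ?thesis using tle[OF that] by simp
    qed
    show "\<exists>s'. P (Suc n) s' \<and> Q n s s'"
      unfolding P_def Q_def using 1 2 3 by (intro exI[of _ ?s]) auto
  qed
  then obtain s where sP: "\<And>n. P n (s n)" and sQ: "\<And>n. Q n (s n) (s (Suc n))" by blast
  have "\<exists>l\<in>R. (\<lambda>n. \<mu> (s n b \<ominus>\<^sub>E l)) \<longlonglongrightarrow> 0" if "b \<in> ?B" for b
    using complete_geometric[of "\<lambda>n. s n b"] sP sQ that unfolding P_def Q_def by auto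
  then obtain l where l: "\<And>b. b \<in> ?B \<Longrightarrow> l b \<in> R" "\<And>b. b \<in> ?B \<Longrightarrow> (\<lambda>n. \<mu> (s n b \<ominus>\<^sub>E l b)) \<longlonglongrightarrow> 0"
    by metis
  have lR: "l \<in> ?B \<rightarrow> R" using l(1) by auto
  note lE = R_E[OF lR]
  have cl: "comb ?B l \<in> carrier K" using comb_closed BO lE by auto
  \<comment> \<open>One index n must make both the approximation error and all coefficient errors
    small; as \<open>?B\<close> is finite, the latter hold together eventually.\<close>
  have "\<nu> (x \<ominus> comb ?B l) \<le> \<epsilon>" if eps: "\<epsilon> > 0" for \<epsilon>
  proof -
    have "\<forall>\<^sub>F n in sequentially. \<forall>b\<in>?B. \<mu> (s n b \<ominus>\<^sub>E l b) < \<epsilon>"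
      using order_tendstoD(2)[OF l(2) eps] by (intro eventually_ball_finite) auto
    moreover have "\<forall>\<^sub>F n in sequentially. ?r ^ n < \<epsilon>"
      using order_tendstoD(2)[OF LIMSEQ_realpow_zero[of ?r] eps] r by simp
    ultimately have "\<forall>\<^sub>F n in sequentially. (\<forall>b\<in>?B. \<mu> (s n b \<ominus>\<^sub>E l b) < \<epsilon>) \<and> ?r ^ n < \<epsilon>"
      by (rule eventually_conj)
    then obtain n where n: "\<forall>b\<in>?B. \<mu> (s n b \<ominus>\<^sub>E l b) < \<epsilon>" "?r ^ n < \<epsilon>"
      by (auto simp: eventually_sequentially)
    have sn: "s n \<in> ?B \<rightarrow> R" "\<nu> (x \<ominus> comb ?B (s n)) \<le> ?r ^ n" using sP[of n] by (auto simp: P_def)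
    note snE = R_E[OF sn(1)]
    have cs: "comb ?B (s n) \<in> carrier K" using comb_closed BO snE by auto
    have d: "comb ?B (\<lambda>b. s n b \<ominus>\<^sub>E l b) = comb ?B (s n) \<ominus> comb ?B l"
      using BO snE lE by (intro comb_minus) auto
    have "\<nu> (comb ?B (\<lambda>b. s n b \<ominus>\<^sub>E l b)) \<le> \<epsilon>"
    proof (rule comb_val_le)
      show "(\<lambda>b. s n b \<ominus>\<^sub>E l b) \<in> ?B \<rightarrow> carrier E" using snE lE by auto
      show "b \<in> ?B \<Longrightarrow> \<mu> (s n b \<ominus>\<^sub>E l b) \<le> \<epsilon>" for b using n(1) by force
    qed (use BO eps in auto)
    moreover have "x \<ominus> comb ?B l = (x \<ominus> comb ?B (s n)) \<oplus> (comb ?B (s n) \<ominus> comb ?B l)"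
      using xK cs cl by (simp add: a_minus_def K.a_assoc K.r_neg1)
    ultimately show ?thesis
      using d sn(2) n(2) xK cs cl by (simp add: K.val_add_le)
  qed
  then have "\<nu> (x \<ominus> comb ?B l) \<le> 0" by (rule dense_ge)
  then have "x \<ominus> comb ?B l = \<zero>" using K.val_pos[of "x \<ominus> comb ?B l"] xK cl by force
  then have "x = comb ?B l" using xK cl K.r_right_minus_eq by blast
  then show ?thesis using lR by blast
qed

lemma spans_field:
  assumes x: "x \<in> carrier K"
  shows "\<exists>c\<in>basis_set \<rightarrow> carrier E. x = comb basis_set c"
proof -
  let ?B = basis_set let ?r = "\<mu> unif"
  have r: "0 < ?r" "?r < 1" using uniformizer by auto
  have "\<exists>k. ?r ^ k * \<nu> x \<le> 1"
  proof (cases "x = \<zero>")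
    case False
    then have pos: "0 < 1 / \<nu> x" using K.val_pos x by simp
    obtain k where "?r ^ k < 1 / \<nu> x" using real_arch_pow_inv[OF pos r(2)] by blast
    then show ?thesis using K.val_pos[OF x False] by (intro exI[of _ k]) (simp add: field_simps)
  qed auto
  then obtain k where k: "?r ^ k * \<nu> x \<le> 1" by blast
  let ?p = "unif [^]\<^bsub>E\<^esub> k"
  have p: "?p \<in> carrier E" "\<mu> ?p = ?r ^ k" using uniformizer(1) VE.val_pow by auto
  have pnz: "?p \<noteq> \<zero>\<^sub>E" using p r phi_zero by auto
  note i = VE.nonzero_inv[OF p(1) pnz]
  have "\<phi> ?p \<otimes> x \<in> OK" using p k x by (simp add: K.VR_iff K.val_mult)
  then obtain c where c: "c \<in> ?B \<rightarrow> R" "\<phi> ?p \<otimes> x = comb ?B c" using spans_exact by blast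
  have cE: "c \<in> ?B \<rightarrow> carrier E" using c(1) by (auto simp: R_iff Pi_def)
  let ?d = "\<lambda>b. inv\<^bsub>E\<^esub> ?p \<otimes>\<^sub>E c b"
  have "comb ?B ?d = \<phi> (inv\<^bsub>E\<^esub> ?p) \<otimes> (\<phi> ?p \<otimes> x)"
    unfolding c(2) using basis_set_OK cE i by (intro comb_smult) auto
  also have "\<dots> = \<phi> (?p \<otimes>\<^sub>E inv\<^bsub>E\<^esub> ?p) \<otimes> x"
    using i(1) p(1) x by (simp add: phi_mult K.m_ac)
  also have "\<dots> = x" using i(2) x by (simp add: phi_one)
  finally show ?thesis using cE i(1) by (intro bexI[of _ ?d]) auto
qed

subsection \<open>Coordinates\<close>

text \<open>Extensional coefficient functions make the representation unique as a function, as the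
  definite description requires.\<close>

definition coord where
  "coord b x = (THE c. c \<in> basis_set \<rightarrow>\<^sub>E carrier E \<and> x = comb basis_set c) b"

lemma comb_restrict: "c \<in> basis_set \<rightarrow> carrier E \<Longrightarrow> comb basis_set (restrict c basis_set) = comb basis_set c"
  unfolding comb_def using basis_set_OK
  by (intro K.finsum_cong') (auto simp: K.VR_iff subset_iff Pi_def)

lemma comb_unique:
  assumes "c \<in> basis_set \<rightarrow> carrier E" "d \<in> basis_set \<rightarrow> carrier E"
    "comb basis_set c = comb basis_set d" "b \<in> basis_set"
  shows "c b = d b"
proof -
  have "comb basis_set (\<lambda>b. c b \<ominus>\<^sub>E d b) = \<zero>"
    using comb_minus[OF basis_set_finite basis_set_OK assms(1,2)] comb_closed[OF basis_set_OK assms(2)] assms(3)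
    by (simp add: a_minus_def K.r_neg)
  then have "c b \<ominus>\<^sub>E d b = \<zero>\<^sub>E"
    using assms(1,2,4) by (intro independent[of "\<lambda>b. c b \<ominus>\<^sub>E d b"]) auto
  moreover have "c b \<in> carrier E" "d b \<in> carrier E" using assms by auto
  ultimately show ?thesis using E.r_right_minus_eq by blast
qed

lemma coord_eq:
  assumes c: "c \<in> basis_set \<rightarrow> carrier E" "x = comb basis_set c" and b: "b \<in> basis_set"
  shows "coord b x = c b"
proof -
  have "(THE c. c \<in> basis_set \<rightarrow>\<^sub>E carrier E \<and> x = comb basis_set c) = restrict c basis_set"
  proof (rule the_equality)
    show "restrict c basis_set \<in> basis_set \<rightarrow>\<^sub>E carrier E \<and> x = comb basis_set (restrict c basis_set)"
      using c comb_restrict by auto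
    fix d assume d: "d \<in> basis_set \<rightarrow>\<^sub>E carrier E \<and> x = comb basis_set d"
    then have "d b = c b" if "b \<in> basis_set" for b
      using comb_unique[of d c b] c that by auto
    then show "d = restrict c basis_set" using d by (auto simp: PiE_def extensional_def fun_eq_iff)
  qed
  then show ?thesis using b by (simp add: coord_def)
qed

lemma coord_expand:
  assumes "x \<in> carrier K"
  shows "(\<lambda>b. coord b x) \<in> basis_set \<rightarrow> carrier E" "x = comb basis_set (\<lambda>b. coord b x)"
proof -
  obtain c where c: "c \<in> basis_set \<rightarrow> carrier E" "x = comb basis_set c" using spans_field[OF assms] by blast
  have e: "coord b x = c b" if "b \<in> basis_set" for b using coord_eq[OF c that] .
  then show "(\<lambda>b. coord b x) \<in> basis_set \<rightarrow> carrier E" using c(1) by auto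
  have "comb basis_set (\<lambda>b. coord b x) = comb basis_set c"
    unfolding comb_def using e c(1) basis_set_OK
    by (intro K.finsum_cong') (auto simp: K.VR_iff subset_iff Pi_def)
  then show "x = comb basis_set (\<lambda>b. coord b x)" using c(2) by simp
qed

lemma coord_closed: "b \<in> basis_set \<Longrightarrow> x \<in> carrier K \<Longrightarrow> coord b x \<in> carrier E"
  using coord_expand(1) by blast

lemma coord_add:
  assumes "b \<in> basis_set" "x \<in> carrier K" "y \<in> carrier K"
  shows "coord b (x \<oplus> y) = coord b x \<oplus>\<^sub>E coord b y"
proof (rule coord_eq[OF _ _ assms(1)])
  show "(\<lambda>b. coord b x \<oplus>\<^sub>E coord b y) \<in> basis_set \<rightarrow> carrier E"
    using coord_closed assms by auto
  show "x \<oplus> y = comb basis_set (\<lambda>b. coord b x \<oplus>\<^sub>E coord b y)"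
    using comb_add[OF basis_set_OK coord_expand(1)[OF assms(2)] coord_expand(1)[OF assms(3)]]
      coord_expand(2)[OF assms(2)] coord_expand(2)[OF assms(3)] by simp
qed

lemma coord_smult:
  assumes "b \<in> basis_set" "x \<in> carrier K" "a \<in> carrier E"
  shows "coord b (\<phi> a \<otimes> x) = a \<otimes>\<^sub>E coord b x"
proof (rule coord_eq[OF _ _ assms(1)])
  show "(\<lambda>b. a \<otimes>\<^sub>E coord b x) \<in> basis_set \<rightarrow> carrier E"
    using coord_closed assms by auto
  show "\<phi> a \<otimes> x = comb basis_set (\<lambda>b. a \<otimes>\<^sub>E coord b x)"
    using comb_smult[OF basis_set_finite basis_set_OK coord_expand(1)[OF assms(2)] assms(3)]
      coord_expand(2)[OF assms(2)] by simp
qed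

lemma coord_integral:
  assumes "b \<in> basis_set" "x \<in> OK"
  shows "coord b x \<in> R"
proof -
  obtain c where c: "c \<in> basis_set \<rightarrow> R" "x = comb basis_set c" using spans_exact[OF assms(2)] by blast
  then have "c \<in> basis_set \<rightarrow> carrier E" by (auto simp: R_iff Pi_def)
  then show ?thesis using coord_eq[of c x b] c assms(1) by auto
qed

lemma coord_separates:
  assumes "x \<in> carrier K" "\<And>b. b \<in> basis_set \<Longrightarrow> coord b x = \<zero>\<^sub>E"
  shows "x = \<zero>"
proof -
  have "comb basis_set (\<lambda>b. coord b x) = (\<Oplus>b\<in>basis_set. \<zero>)"
    unfolding comb_def using assms(2) basis_set_OK
    by (intro K.finsum_cong') (auto simp: phi_zero K.VR_iff subset_iff)
  then show ?thesis using coord_expand(2)[OF assms(1)] by simp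
qed

lemma coord_basis:
  assumes "b \<in> basis_set" "b' \<in> basis_set"
  shows "coord b b' = (if b = b' then \<one>\<^sub>E else \<zero>\<^sub>E)"
proof (rule coord_eq[OF _ _ assms(1)])
  have BK: "basis_set \<subseteq> carrier K" using basis_set_OK by (auto simp: K.VR_iff)
  show "(\<lambda>b. if b = b' then \<one>\<^sub>E else \<zero>\<^sub>E) \<in> basis_set \<rightarrow> carrier E" by auto
  have "comb basis_set (\<lambda>b. if b = b' then \<one>\<^sub>E else \<zero>\<^sub>E) = (\<Oplus>b\<in>basis_set. if b' = b then b else \<zero>)"
    unfolding comb_def using BK by (intro K.finsum_cong') (auto simp: phi_one phi_zero subset_iff)
  also have "\<dots> = b'"
    using K.finsum_singleton[OF assms(2) basis_set_finite, of "\<lambda>b. b"] BK by auto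
  finally show "b' = comb basis_set (\<lambda>b. if b = b' then \<one>\<^sub>E else \<zero>\<^sub>E)" by simp
qed

subsection \<open>Automorphisms preserve the absolute value bound\<close>

text \<open>Images of powers of an integral element stay in a bounded set because
  \<open>\<sigma>(\<O>\<^sub>K)\<close> is generated by finitely many elements over the fixed ring.\<close>

lemma automorphism_integral:
  assumes sigma: "\<sigma> \<in> ring_hom K K" "\<And>a. a \<in> carrier E \<Longrightarrow> \<sigma> (\<phi> a) = \<phi> a"
    and x: "x \<in> OK"
  shows "\<sigma> x \<in> OK"
proof -
  let ?B = basis_set
  interpret s: ring_hom_cring K K \<sigma>
    using sigma(1) by (simp add: ring_hom_cring_def ring_hom_cring_axioms_def K.is_cring)
  \<comment> \<open>The inserted 1 keeps the maximum meaningful for an empty family and gives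
    \<open>1 \<le> C\<close>, from which nonnegativity of the bound follows.\<close>
  define C where "C = Max (insert 1 ((\<lambda>b. \<nu> (\<sigma> b)) ` ?B))"
  have BK: "?B \<subseteq> carrier K" using basis_set_OK by (auto simp: K.VR_iff)
  have C: "1 \<le> C" "\<And>b. b \<in> ?B \<Longrightarrow> \<nu> (\<sigma> b) \<le> C" unfolding C_def by (auto intro!: Max_ge)
  have bound: "\<nu> (\<sigma> y) \<le> C" if y: "y \<in> OK" for y
  proof -
    obtain c where c: "c \<in> ?B \<rightarrow> R" "y = comb ?B c" using spans_exact[OF y] by blast
    have cE: "\<And>b. b \<in> ?B \<Longrightarrow> c b \<in> carrier E \<and> \<mu> (c b) \<le> 1" using c(1) by (auto simp: R_iff)
    have "\<sigma> y = (\<Oplus>b\<in>?B. \<sigma> (\<phi> (c b) \<otimes> b))"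
      unfolding c(2) comb_def using cE BK by (subst s.hom_finsum) (auto simp: comp_def)
    also have "\<nu> \<dots> \<le> C"
    proof (rule K.val_finsum_le)
      fix b assume b: "b \<in> ?B"
      have bK: "b \<in> carrier K" using b BK by auto
      have "\<nu> (\<sigma> (\<phi> (c b) \<otimes> b)) = \<mu> (c b) * \<nu> (\<sigma> b)"
        using cE[OF b] bK by (simp add: sigma(2) K.val_mult)
      also have "\<dots> \<le> 1 * C"
        using cE[OF b] C(2)[OF b] K.val_nonneg[of "\<sigma> b"] bK by (intro mult_mono) auto
      finally show "\<nu> (\<sigma> (\<phi> (c b) \<otimes> b)) \<le> C" by simp
    qed (use cE BK C(1) in auto)
    finally show ?thesis .
  qed
  have xK: "x \<in> carrier K" "\<nu> x \<le> 1" using x by (auto simp: K.VR_iff)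
  \<comment> \<open>All powers of \<open>x\<close> are integral, so the same \<open>C\<close> bounds
    the values of all their images; if \<open>\<nu> (\<sigma> x)\<close> exceeded 1, its powers
    would outgrow \<open>C\<close>.\<close>
  have pow: "\<nu> (\<sigma> x) ^ k \<le> C" for k
  proof -
    have "x [^] k \<in> OK" using xK K.val_nonneg[OF xK(1)] by (simp add: K.VR_iff K.val_pow power_le_one)
    then have "\<nu> (\<sigma> (x [^] k)) \<le> C" by (rule bound)
    moreover have "\<sigma> (x [^] k) = \<sigma> x [^] k" using xK(1) by (induction k) simp_all
    ultimately show ?thesis using xK(1) by (simp add: K.val_pow)
  qed
  have "\<nu> (\<sigma> x) \<le> 1"
  proof (rule ccontr)
    assume "\<not> \<nu> (\<sigma> x) \<le> 1"
    then obtain k where "C < \<nu> (\<sigma> x) ^ k" using real_arch_pow[of "\<nu> (\<sigma> x)" C] by auto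
    then show False using pow[of k] by simp
  qed
  then show ?thesis using xK(1) by (simp add: K.VR_iff)
qed

end



section \<open>Lattices in Petit algebras\<close>

text \<open>The type of \<^term>\<open>add_monoid A\<close> depends on the record extension of \<open>A\<close>, so that the additive
  groups of \<open>A\<close> and \<^term>\<open>pull_scalars \<phi> A\<close> cannot be equated.\<close>

lemma abelian_group_cong:
  fixes A :: "('x, 'k) ring_scheme" and B :: "('x, 'l) ring_scheme"
  assumes A: "abelian_group A"
    and B: "carrier B = carrier A" "add B = add A" "\<zero>\<^bsub>B\<^esub> = \<zero>\<^bsub>A\<^esub>"
  shows "abelian_group B"
proof -
  interpret abelian_group A by fact
  show ?thesis
  proof (rule abelian_groupI)
    show "\<exists>y\<in>carrier B. y \<oplus>\<^bsub>B\<^esub> x = \<zero>\<^bsub>B\<^esub>" if "x \<in> carrier B" for x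
      using that by (intro bexI[of _ "\<ominus>\<^bsub>A\<^esub> x"]) (simp_all add: B l_neg)
  qed (simp_all add: B a_ac)
qed

lemma subgroup_add_monoid_cong:
  fixes A :: "('x, 'k) ring_scheme" and B :: "('x, 'l) ring_scheme"
  assumes "subgroup H (add_monoid A)" "carrier B = carrier A" "add B = add A" "\<zero>\<^bsub>B\<^esub> = \<zero>\<^bsub>A\<^esub>"
  shows "subgroup H (add_monoid B)"
  using assms by (simp add: subgroup_def m_inv_def)

text \<open>No code occurs here: \<open>L\<close> is known only as an \<open>R\<close>-submodule
  squeezed between \<open>unif\<close> times the integral polynomials and the integral polynomials
  themselves. One and the same \<open>L\<close> can therefore be studied over several fields
  E.\<close>

locale petit_lattice = local_extension K \<nu> \<pi> E \<phi> + P: petit_algebra K \<sigma> f m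
  for K :: "('a, 'k) ring_scheme" (structure) and \<nu> \<pi> and E :: "('t, 'e) ring_scheme" and \<phi> \<sigma> f m +
  fixes L :: "(nat \<Rightarrow> 'a) set"
  assumes sigma_fixes: "\<And>a. a \<in> carrier E \<Longrightarrow> \<sigma> (\<phi> a) = \<phi> a"
    and m_pos: "0 < m"
    and L_subgroup: "subgroup L (add_monoid P.A)"
    and L_smult: "\<And>a x. a \<in> R \<Longrightarrow> x \<in> L \<Longrightarrow> \<phi> a \<odot>\<^bsub>P.A\<^esub> x \<in> L"
    and L_integral: "\<And>x i. x \<in> L \<Longrightarrow> x i \<in> OK"
    and L_contains: "\<And>x. x \<in> P.Below \<Longrightarrow> (\<And>i. x i \<in> OK) \<Longrightarrow> \<phi> unif \<odot>\<^bsub>P.A\<^esub> x \<in> L"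
begin

abbreviation M where "M \<equiv> pull_scalars \<phi> P.A"

lemma L_below: "L \<subseteq> P.Below"
  using subgroup.subset[OF L_subgroup] by (simp add: P.petit_simps(1))

text \<open>Scalars coming from E can be moved past powers of t because \<sigma> fixes their images,
  and this is what makes the Petit multiplication bilinear over E.\<close>

lemma M_unital_algebra: "unital_algebra E M"
proof -
  interpret PM: Module.module K P.A by (rule P.petit_module)
  have "Module.module E M"
  proof (rule moduleI)
    show "cring E" by (rule E.is_cring)
    show "abelian_group M"
      by (rule abelian_group_cong[OF PM.M.abelian_group_axioms]) (simp_all add: pull_scalars_def)
  qed (simp_all add: phi_add phi_mult phi_one PM.smult_l_distr PM.smult_r_distr PM.smult_assoc1)
  then show ?thesis
    unfolding unital_algebra_def
    using P.const_below[OF m_pos, of \<one>] P.petit_const_mult[OF m_pos, of \<one>]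
      P.sigma_pow_one[of 1] P.petit_smult_mult P.petit_distrib P.petit_mult_closed sigma_fixes
    by (simp add: P.petit_simps(1) P.petit_simps(3) P.petit_simps(6)[of \<one>])
qed

lemma M_module: "Module.module E M"
  using M_unital_algebra by (simp add: unital_algebra_def)

lemma M_module_R: "Module.module (ER) M"
  by (rule module_restrict_scalars[OF M_module R_subring])

lemma L_submodule: "submodule L (ER) M"
  using subgroup_add_monoid_cong[OF L_subgroup, of M] L_smult
  by (simp add: submodule_def submodule_axioms_def pull_scalars_def)

section \<open>Coordinates on O_K and on S_f over E\<close>

definition n where "n = card basis_set"

definition enum where "enum = (SOME h. bij_betw h {0..<n} basis_set)"

lemma enum_bij: "bij_betw enum {0..<n} basis_set"
  unfolding enum_def n_def by (rule someI_ex[OF ex_bij_betw_nat_finite[OF basis_set_finite]])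

lemma enum_mem [simp]: "k < n \<Longrightarrow> enum k \<in> basis_set"
  using enum_bij by (auto simp: bij_betw_def)

lemma enum_eq_iff: "i < n \<Longrightarrow> j < n \<Longrightarrow> enum i = enum j \<longleftrightarrow> i = j"
  using enum_bij by (auto simp: bij_betw_def inj_on_def)

lemma enum_surj:
  assumes "b \<in> basis_set"
  shows "\<exists>k<n. b = enum k"
proof -
  have "b \<in> enum ` {0..<n}" using assms enum_bij by (simp add: bij_betw_def)
  then show ?thesis by auto
qed

lemma enum_OK: "k < n \<Longrightarrow> enum k \<in> OK"
  using basis_set_OK enum_mem by blast

text \<open>This shows that the \<open>n\<close> defined as a cardinality is the rank [O_K : R]. The
  coordinates are dual to the enumerated set, so the triangular criterion applies with the identity
  matrix.\<close>

lemma integers_free: "free_of_rank R (pull_scalars \<phi> (self_module (K\<lparr>carrier := OK\<rparr>))) n"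
proof -
  let ?S = "pull_scalars \<phi> (self_module (K\<lparr>carrier := OK\<rparr>))"
  interpret O: cring "K\<lparr>carrier := OK\<rparr>" by (rule K.val_ring_cring)
  have S: "carrier ?S = OK" "\<And>x y. x \<oplus>\<^bsub>?S\<^esub> y = x \<oplus> y" "\<And>a x. a \<odot>\<^bsub>?S\<^esub> x = \<phi> a \<otimes> x" "\<zero>\<^bsub>?S\<^esub> = \<zero>"
    by (simp_all add: self_module_def)
  have OKc: "x \<in> carrier K" if "x \<in> OK" for x using that by (simp add: K.VR_iff)
  have RE: "a \<in> carrier E" "\<phi> a \<in> OK" if "a \<in> R" for a using that by (auto simp: R_iff K.VR_iff)
  have cl: "\<phi> a \<otimes> x \<in> OK" if "a \<in> R" "x \<in> OK" for a x
    using subringE(6)[OF K.val_ring_subring, of "\<phi> a" x] RE that by simp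
  have mod: "Module.module (ER) ?S"
  proof (rule moduleI)
    show "cring (ER)" by (rule VE.val_ring_cring)
    show "abelian_group ?S"
      by (rule abelian_group_cong[OF O.abelian_group_axioms])
        (simp_all add: self_module_def pull_scalars_def)
  qed (auto simp: self_module_def cl OKc RE phi_add phi_mult phi_one K.l_distr K.r_distr K.m_assoc)
  have "is_basis (carrier (ER)) ?S n enum"
  proof (rule triangular_basis[OF mod, where \<pi> = "\<lambda>i. coord (enum i)"])
    fix i assume i: "i < n"
    have self: "coord (enum i) (enum i) = \<one>\<^sub>E" using i by (simp add: coord_basis)
    show "coord (enum i) (enum j) = \<zero>\<^bsub>ER\<^esub>" if "j < i" for j
      using i that by (simp add: coord_basis enum_eq_iff)
    show "c = \<zero>\<^bsub>ER\<^esub>"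
      if "c \<in> carrier (ER)"
        "c \<otimes>\<^bsub>ER\<^esub> coord (enum i) (enum i) = \<zero>\<^bsub>ER\<^esub>" for c
      using that RE by (simp add: self)
    show "\<exists>c\<in>carrier (ER). coord (enum i) x = c \<otimes>\<^bsub>ER\<^esub> coord (enum i) (enum i)"
      if x: "x \<in> carrier ?S" for x
    proof -
      have "coord (enum i) x \<in> R" using x coord_integral[of "enum i" x] i unfolding S(1) by simp
      then show ?thesis using RE by (intro bexI[of _ "coord (enum i) x"]) (simp_all add: self)
    qed
  next
    fix x assume x: "x \<in> carrier ?S" "\<And>i. i < n \<Longrightarrow> coord (enum i) x = \<zero>\<^bsub>ER\<^esub>"
    have "x = \<zero>"
    proof (rule coord_separates)
      show "x \<in> carrier K" using x(1) OKc unfolding S(1) by blast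
      show "coord b x = \<zero>\<^sub>E" if "b \<in> basis_set" for b using enum_surj[OF that] x(2) by auto
    qed
    then show "x = \<zero>\<^bsub>?S\<^esub>" by (simp add: self_module_def)
  qed (auto simp: self_module_def coord_integral coord_add coord_smult OKc RE enum_OK)
  then show ?thesis unfolding free_of_rank_def by auto
qed

text \<open>An index below \<open>m * n\<close> encodes a pair: \<open>j div n\<close> is the power
  of t and \<open>j mod n\<close> selects the element of the basis of O_K.\<close>

definition proj where "proj j x = coord (enum (j mod n)) (x (j div n))"

definition vect where "vect j = P.term_poly (enum (j mod n)) (j div n)"

lemma index:
  assumes "j < m * n"
  shows "j mod n < n" "j div n < m"
proof -
  have "0 < n" using assms by (cases n) auto
  then show "j mod n < n" "j div n < m" using assms by (auto simp: less_mult_imp_div_less)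
qed

lemma proj_closed: "j < m * n \<Longrightarrow> x \<in> P.Below \<Longrightarrow> proj j x \<in> carrier E"
  using index by (simp add: proj_def coord_closed)

lemma proj_integral: "j < m * n \<Longrightarrow> (\<And>i. x i \<in> OK) \<Longrightarrow> proj j x \<in> R"
  using index by (simp add: proj_def coord_integral)

lemma proj_add: "j < m * n \<Longrightarrow> x \<in> P.Below \<Longrightarrow> y \<in> P.Below \<Longrightarrow> proj j (x \<oplus>\<^bsub>P.A\<^esub> y) = proj j x \<oplus>\<^sub>E proj j y"
  using index by (simp add: proj_def coord_add P.petit_simps)

lemma proj_smult: "j < m * n \<Longrightarrow> a \<in> carrier E \<Longrightarrow> x \<in> P.Below \<Longrightarrow> proj j (\<phi> a \<odot>\<^bsub>P.A\<^esub> x) = a \<otimes>\<^sub>E proj j x"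
  using index by (simp add: proj_def coord_smult P.petit_simps)

lemma proj_separates:
  assumes x: "x \<in> P.Below" "\<And>j. j < m * n \<Longrightarrow> proj j x = \<zero>\<^sub>E"
  shows "x = (\<lambda>i. \<zero>)"
proof
  fix i
  show "x i = \<zero>"
  proof (cases "i < m")
    case True
    show ?thesis
    proof (rule coord_separates)
      show "x i \<in> carrier K" using x(1) by simp
      fix b assume "b \<in> basis_set"
      then obtain k where k: "k < n" "b = enum k" using enum_surj by blast
      have "i * n + k < Suc i * n" using k by simp
      also have "\<dots> \<le> m * n" using True by (intro mult_right_mono) auto
      finally show "coord b (x i) = \<zero>\<^sub>E"
        using x(2)[of "i * n + k"] k by (simp add: proj_def)
    qed
  qed (use P.below_above[OF x(1)] in simp)
qed

lemma vect_props:
  assumes "j < m * n"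
  shows "vect j \<in> P.Below" "vect j i \<in> OK"
  using index[OF assms] enum_OK[of "j mod n"] unfolding vect_def
  by (auto intro!: P.belowI simp: P.term_poly_def K.VR_iff)

lemma coord_zero: "b \<in> basis_set \<Longrightarrow> coord b \<zero> = \<zero>\<^sub>E"
  using coord_smult[of b \<zero> "\<zero>\<^sub>E"] coord_closed[of b \<zero>] phi_zero by simp

lemma proj_vect:
  assumes "i < m * n" "j < m * n"
  shows "proj i (vect j) = (if i = j then \<one>\<^sub>E else \<zero>\<^sub>E)"
proof (cases "i div n = j div n")
  case True
  then have "i mod n = j mod n \<longleftrightarrow> i = j" by (metis div_mult_mod_eq)
  then show ?thesis
    using True index[OF assms(1)] index[OF assms(2)]
    by (simp add: proj_def vect_def P.term_poly_def coord_basis enum_eq_iff)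
next
  case False
  then show ?thesis
    using index[OF assms(1)] by (auto simp: proj_def vect_def P.term_poly_def coord_zero)
qed

text \<open>Since \<open>\<varpi>\<Lambda> \<subseteq> L \<subseteq> \<Lambda>\<close>, the leading coordinates of the elements of \<open>L\<close> supported on the
  first \<open>j\<close> coordinates form either \<open>R\<close> or \<open>\<varpi>R\<close>.\<close>

definition adapted where
  "adapted j y \<longleftrightarrow> y \<in> L \<and> (\<forall>i. j < i \<and> i < m * n \<longrightarrow> proj i y = \<zero>\<^sub>E) \<and> proj j y \<noteq> \<zero>\<^sub>E \<and>
    (\<forall>x\<in>L. (\<forall>i. j < i \<and> i < m * n \<longrightarrow> proj i x = \<zero>\<^sub>E) \<longrightarrow> (\<exists>c\<in>R. proj j x = c \<otimes>\<^sub>E proj j y))"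

text \<open>If an element of \<open>L\<close> supported on the first coordinates up to j has a unit
  there, it divides all others. Otherwise every such coordinate has value at most
  \<open>\<mu> unif\<close>, and \<open>unif\<close> times the j-th standard vector, which lies in
  \<open>L\<close>, attains this value.\<close>

lemma adapted_exists:
  assumes j: "j < m * n"
  shows "\<exists>y. adapted j y"
proof -
  define T where "T x \<longleftrightarrow> x \<in> L \<and> (\<forall>i. j < i \<and> i < m * n \<longrightarrow> proj i x = \<zero>\<^sub>E)" for x
  have TR: "proj j x \<in> R" if "T x" for x using proj_integral[OF j] L_integral that unfolding T_def by blast
  have quot: "\<exists>c\<in>R. proj j x = c \<otimes>\<^sub>E d"
    if x: "T x" and d: "d \<in> carrier E" "d \<noteq> \<zero>\<^sub>E" "\<mu> (proj j x) \<le> \<mu> d" for x d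
  proof -
    have pE: "proj j x \<in> carrier E" using TR[OF x] by (simp add: R_iff)
    obtain c where c: "c \<in> carrier E" "proj j x = d \<otimes>\<^sub>E c" "\<mu> c = \<mu> (proj j x) / \<mu> d"
      using VE.val_divide[OF pE d(1,2)] by metis
    have "c \<in> R" using c(1,3) d(3) VE.val_pos[OF d(1,2)] by (simp add: R_iff divide_le_eq)
    then show ?thesis using c(2) E.m_comm[OF d(1) c(1)] by (intro bexI[of _ c]) simp_all
  qed
  have "\<exists>y. T y \<and> proj j y \<noteq> \<zero>\<^sub>E \<and> (\<forall>x. T x \<longrightarrow> (\<exists>c\<in>R. proj j x = c \<otimes>\<^sub>E proj j y))"
  proof (cases "\<exists>y. T y \<and> \<mu> (proj j y) = 1")
    case True
    then obtain y where y: "T y" "\<mu> (proj j y) = 1" by blast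
    have "proj j y \<in> carrier E" using TR[OF y(1)] by (simp add: R_iff)
    moreover have "proj j y \<noteq> \<zero>\<^sub>E" using y(2) phi_zero by auto
    moreover have "\<mu> (proj j x) \<le> \<mu> (proj j y)" if "T x" for x
      using TR[OF that] y(2) by (simp add: R_iff)
    ultimately show ?thesis using y(1) quot by (intro exI[of _ y]) auto
  next
    case False
    let ?y = "\<phi> unif \<odot>\<^bsub>P.A\<^esub> vect j"
    note v = vect_props[OF j]
    have py: "proj i ?y = (if i = j then unif else \<zero>\<^sub>E)" if "i < m * n" for i
      using proj_smult[OF that uniformizer(1) v(1)] proj_vect[OF that j] uniformizer(1) by simp
    have "T ?y" unfolding T_def using L_contains[OF v] py by simp
    moreover have "\<mu> (proj j x) \<le> \<mu> unif" if "T x" for x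
    proof (rule uniformizer(4))
      show "proj j x \<in> carrier E" using TR[OF that] by (simp add: R_iff)
      have "\<mu> (proj j x) \<noteq> 1" using False that by blast
      then show "\<mu> (proj j x) < 1" using TR[OF that] by (simp add: R_iff)
    qed
    ultimately show ?thesis
      using py[OF j] quot uniformizer(1) uniformizer_nonzero by (intro exI[of _ ?y]) auto
  qed
  then obtain y where y: "T y" "proj j y \<noteq> \<zero>\<^sub>E"
    "\<And>x. T x \<Longrightarrow> \<exists>c\<in>R. proj j x = c \<otimes>\<^sub>E proj j y" by (elim exE conjE) simp
  show ?thesis
    unfolding adapted_def
  proof (intro exI[of _ y] conjI ballI impI)
    show "\<exists>c\<in>R. proj j x = c \<otimes>\<^sub>E proj j y"
      if "x \<in> L" "\<forall>i. j < i \<and> i < m * n \<longrightarrow> proj i x = \<zero>\<^sub>E" for x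
      by (rule y(3)) (simp add: T_def that)
  qed (use y(1,2) in \<open>simp_all add: T_def\<close>)
qed

text \<open>The triangular criterion is applied twice to the same family. Over E the divisibility
  condition holds because the diagonal entries are nonzero; over \<open>R\<close> it is the last
  clause of \<open>adapted\<close>.\<close>

theorem full_lattice: "full_lattice_of_rank R E M L (m * n)"
proof -
  let ?N = "m * n"
  obtain b where ad: "\<And>j. j < ?N \<Longrightarrow> adapted j (b j)"
    using adapted_exists by metis
  have b: "\<And>j. j < ?N \<Longrightarrow> b j \<in> L"
      "\<And>j i. j < ?N \<Longrightarrow> j < i \<Longrightarrow> i < ?N \<Longrightarrow> proj i (b j) = \<zero>\<^sub>E"
      "\<And>j. j < ?N \<Longrightarrow> proj j (b j) \<noteq> \<zero>\<^sub>E"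
      "\<And>j x. j < ?N \<Longrightarrow> x \<in> L \<Longrightarrow> (\<And>i. j < i \<Longrightarrow> i < ?N \<Longrightarrow> proj i x = \<zero>\<^sub>E) \<Longrightarrow>
        \<exists>c\<in>R. proj j x = c \<otimes>\<^sub>E proj j (b j)"
    using ad unfolding adapted_def by simp_all
  have bB: "b j \<in> P.Below" if "j < ?N" for j using b(1)[OF that] L_below by blast
  have bE: "proj j (b j) \<in> carrier E" if "j < ?N" for j using proj_closed[OF that bB[OF that]] .
  have RE: "a \<in> carrier E" if "a \<in> R" for a using that by (simp add: R_iff)
  have cancel: "c = \<zero>\<^sub>E" if "j < ?N" "c \<in> carrier E" "c \<otimes>\<^sub>E proj j (b j) = \<zero>\<^sub>E" for j c
    using E.integral[OF that(3,2) bE[OF that(1)]] b(3)[OF that(1)] by blast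
  have basisE: "is_basis (carrier E) M ?N b"
  proof (rule triangular_basis[OF M_module, where \<pi> = proj])
    fix i x assume i: "i < ?N" and x: "x \<in> carrier M"
    have pE: "proj i x \<in> carrier E" using proj_closed[OF i] x by (simp add: P.petit_simps(1))
    show "proj i x \<in> carrier E" by (rule pE)
    obtain c where c: "c \<in> carrier E" "proj i x = proj i (b i) \<otimes>\<^sub>E c"
      using VE.val_divide[OF pE bE[OF i] b(3)[OF i]] by metis
    then show "\<exists>c\<in>carrier E. proj i x = c \<otimes>\<^sub>E proj i (b i)"
      using E.m_comm[OF bE[OF i] c(1)] by (intro bexI[of _ c]) simp_all
  next
    show "x = \<zero>\<^bsub>M\<^esub>" if "x \<in> carrier M" "\<And>i. i < ?N \<Longrightarrow> proj i x = \<zero>\<^sub>E" for x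
      using proj_separates[of x] that by (simp add: P.petit_simps(1,4))
    show "c = \<zero>\<^sub>E" if "i < ?N" "c \<in> carrier E" "c \<otimes>\<^sub>E proj i (b i) = \<zero>\<^sub>E" for i c
      using that by (rule cancel)
    show "proj i (b j) = \<zero>\<^sub>E" if "j < i" "i < ?N" for i j
      using b(2)[of j i] that by simp
  qed (simp_all add: P.petit_simps(1) proj_add proj_smult bB)
  interpret LM: Module.module "ER" "M\<lparr>carrier := L\<rparr>"
    by (rule submodule_module[OF M_module_R L_submodule])
  have "is_basis (carrier (ER)) (M\<lparr>carrier := L\<rparr>) ?N b"
  proof (rule triangular_basis[OF LM.module_axioms, where \<pi> = proj])
    show "\<exists>c\<in>carrier (ER). proj i x = c \<otimes>\<^bsub>ER\<^esub> proj i (b i)"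
      if "i < ?N" "x \<in> carrier (M\<lparr>carrier := L\<rparr>)"
        "\<And>j. i < j \<Longrightarrow> j < ?N \<Longrightarrow> proj j x = \<zero>\<^bsub>ER\<^esub>" for i x
      using b(4)[OF that(1), of x] that(2,3) by simp
    show "x = \<zero>\<^bsub>M\<lparr>carrier := L\<rparr>\<^esub>"
      if "x \<in> carrier (M\<lparr>carrier := L\<rparr>)" "\<And>i. i < ?N \<Longrightarrow> proj i x = \<zero>\<^bsub>ER\<^esub>" for x
      using proj_separates[of x] L_below that by (auto simp: P.petit_simps(4))
    show "proj i (a \<odot>\<^bsub>M\<lparr>carrier := L\<rparr>\<^esub> x) = a \<otimes>\<^bsub>ER\<^esub> proj i x"
      if "i < ?N" "a \<in> carrier (ER)" "x \<in> carrier (M\<lparr>carrier := L\<rparr>)" for i a x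
      using proj_smult[of i a x] that L_below RE by auto
    show "proj i (x \<oplus>\<^bsub>M\<lparr>carrier := L\<rparr>\<^esub> y) = proj i x \<oplus>\<^bsub>ER\<^esub> proj i y"
      if "i < ?N" "x \<in> carrier (M\<lparr>carrier := L\<rparr>)" "y \<in> carrier (M\<lparr>carrier := L\<rparr>)" for i x y
      using proj_add[of i x y] that L_below by auto
    show "c = \<zero>\<^bsub>ER\<^esub>"
      if "i < ?N" "c \<in> carrier (ER)"
        "c \<otimes>\<^bsub>ER\<^esub> proj i (b i) = \<zero>\<^bsub>ER\<^esub>" for i c
      using cancel[of i c] that RE by simp
    show "proj i x \<in> carrier (ER)" if "i < ?N" "x \<in> carrier (M\<lparr>carrier := L\<rparr>)" for i x
      using proj_integral[of i x] L_integral that by simp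
  qed (use b(1,2) in simp_all)
  then have basisL: "is_basis R (M\<lparr>carrier := L\<rparr>) ?N b" by simp
  have lat: "is_lattice R E M L"
    unfolding is_lattice_def
  proof (intro conjI ballI)
    show "Ring.field E" by (rule E.field_axioms)
    show "fin_gen R (M\<lparr>carrier := L\<rparr>)" by (rule is_basis_imp_fin_gen[OF basisL])
    show "\<exists>n b. is_basis (carrier E) M n b \<and> (\<forall>i<n. b i \<in> L)" using basisE b(1) by blast
  qed (use R_subring R_noetherian R_quotient_field M_unital_algebra L_submodule in auto)
  show ?thesis
    unfolding full_lattice_of_rank_def free_of_rank_def
    using lat basisL embeds_as_lattice_of_basis[OF lat basisE] by blast
qed

end



section \<open>The natural order\<close>

lemma nonarch_local_field_discrete:
  assumes "nonarch_local_field K \<nu>"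
  shows "\<exists>\<pi>. discrete_valued_field K \<nu> \<pi>"
proof -
  have "Ring.field K" "is_nonarch_abs K \<nu>" using assms by (auto simp: nonarch_local_field_def)
  moreover obtain \<pi> where "\<pi> \<in> carrier K" "0 < \<nu> \<pi>" "\<nu> \<pi> < 1"
      "\<And>x. x \<in> carrier K \<Longrightarrow> x \<noteq> \<zero>\<^bsub>K\<^esub> \<Longrightarrow> \<exists>k::int. \<nu> x = \<nu> \<pi> powi k"
    using assms unfolding nonarch_local_field_def by blast
  ultimately have "discrete_valued_field K \<nu> \<pi>"
    by (simp add: discrete_valued_field_def discrete_valued_field_axioms_def
        valued_field_def valued_field_axioms_def)
  then show ?thesis ..
qed

lemma subring_inclusion_hom:
  assumes "subring H K"
  shows "(\<lambda>x. x) \<in> ring_hom (K\<lparr>carrier := H\<rparr>) K"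
  using subringE(1)[OF assms] by (auto intro!: ring_hom_memI)

text \<open>The instance E = F with the inclusion as embedding: it makes \<open>unif\<close> a
  uniformizer of F and provides the stability of O_K under \<sigma> on which
  \<open>\<Lambda>\<close> depends.\<close>

locale natural_order =
  local_extension K \<nu> \<pi> "K\<lparr>carrier := F\<rparr>" "\<lambda>x. x"
  for K :: "('a, 'k) ring_scheme" (structure) and \<nu> \<pi> and F :: "'a set" +
  fixes \<sigma> f m
  assumes sigma: "\<sigma> \<in> ring_hom K K" "\<And>a. a \<in> F \<Longrightarrow> \<sigma> a = a"
    and f_monic: "monic_poly (K\<lparr>carrier := OK\<rparr>) f" "deg (K\<lparr>carrier := OK\<rparr>) f = m"
    and m_pos: "0 < m"
begin

abbreviation OKR where "OKR \<equiv> K\<lparr>carrier := OK\<rparr>"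
abbreviation pF where "pF \<equiv> max_ideal (K\<lparr>carrier := F\<rparr>) \<nu>"
abbreviation pO where "pO \<equiv> genideal OKR pF"

interpretation O: cring OKR by (rule K.val_ring_cring)

lemma F_carrier: "F \<subseteq> carrier K"
  using phi_closed by auto

lemma OK_carrier: "x \<in> OK \<Longrightarrow> x \<in> carrier K"
  by (simp add: K.VR_iff)

lemma sigma_OKR: "\<sigma> \<in> ring_hom OKR OKR"
proof -
  have "\<sigma> x \<in> OK" if "x \<in> OK" for x
    using automorphism_integral[OF sigma(1) _ that] sigma(2) by simp
  then show ?thesis
    using sigma(1) OK_carrier by (auto simp: ring_hom_def)
qed

sublocale N: petit_algebra OKR \<sigma> f m
  using sigma_OKR f_monic
  by (simp add: petit_algebra_def petit_algebra_axioms_def skew_polynomials_def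
      skew_polynomials_axioms_def O.is_cring)

lemma up_OKR: "x \<in> up OKR \<Longrightarrow> x \<in> up K"
  by (auto simp: up_def K.VR_iff Pi_def)

lemma petit_algebra_K: "petit_algebra K \<sigma> f m"
proof -
  have f: "f \<in> up OKR" "f m = \<one>" "\<And>i. i > m \<Longrightarrow> f i = \<zero>"
    using N.f_closed N.f_top N.f_above by auto
  have fK: "f \<in> up K" by (rule up_OKR[OF f(1)])
  have "deg K f = m" by (rule K.degree_eqI[OF fK f(3)]) (use f(2) in simp_all)
  then show ?thesis
    using fK f(2) sigma(1) K.is_cring
    by (simp add: petit_algebra_def petit_algebra_axioms_def skew_polynomials_def
      skew_polynomials_axioms_def monic_poly_def)
qed

section \<open>The ideal pO_K and the kernel of reduction\<close>

lemma unif_pF: "unif \<in> pF" and pF_le: "a \<in> pF \<Longrightarrow> a \<in> F \<and> \<nu> a \<le> \<nu> unif"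
  using uniformizer by (auto simp: max_ideal_def)

lemma pF_OK: "pF \<subseteq> OK"
  using F_carrier by (auto simp: max_ideal_def K.VR_iff)

lemma unif_K: "unif \<in> carrier K" "unif \<noteq> \<zero>" "unif \<in> OK"
  using unif_pF pF_OK OK_carrier uniformizer(2) by auto

lemma pO_ideal: "ideal pO OKR"
  by (rule O.genideal_ideal) (simp add: pF_OK)

lemma OKR_minus: "x \<in> OK \<Longrightarrow> \<ominus>\<^bsub>OKR\<^esub> x = \<ominus> x"
  using O.minus_equality[of "\<ominus> x" x] subringE(5)[OF K.val_ring_subring, of x]
  by (simp add: OK_carrier K.l_neg)

text \<open>The last property lets an element of \<Lambda> be divided coefficient by coefficient
  with its zero coefficients kept, so that the quotient stays below degree m.\<close>

lemma unif_divide: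
  assumes "x \<in> OK" "\<nu> x \<le> \<nu> unif"
  obtains y where "y \<in> OK" "x = unif \<otimes> y" "x = \<zero> \<longrightarrow> y = \<zero>"
proof -
  obtain y where y: "y \<in> carrier K" "x = unif \<otimes> y" "\<nu> y = \<nu> x / \<nu> unif"
    using K.val_divide[OF OK_carrier[OF assms(1)] unif_K(1,2)] by metis
  have "y \<in> OK" using y assms(2) uniformizer(2) by (simp add: K.VR_iff divide_le_eq)
  moreover have "y = \<zero>" if "x = \<zero>" using y(1,3) that K.val_eq_0_iff[of y] by simp
  ultimately show thesis using y(2) that by simp
qed

text \<open>Since \<open>unif\<close> has the largest value in the maximal ideal of F, it generates
  the extended ideal, which is therefore a ball. In the ramified case it is strictly smaller than
  the maximal ideal of O_K.\<close>

lemma pO_eq: "pO = {x \<in> OK. \<nu> x \<le> \<nu> unif}"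
proof (intro equalityI subsetI)
  let ?I = "{x \<in> OK. \<nu> x \<le> \<nu> unif}"
  have cl: "x \<otimes> a \<in> ?I" if "a \<in> ?I" "x \<in> OK" for a x
  proof -
    have "\<nu> x * \<nu> a \<le> 1 * \<nu> unif"
      using that K.val_nonneg[of a] by (intro mult_mono) (auto simp: K.VR_iff)
    then show ?thesis
      using that subringE(6)[OF K.val_ring_subring, of x a] by (simp add: OK_carrier K.val_mult)
  qed
  have "ideal ?I OKR"
  proof (rule idealI)
    show "ring OKR" by (rule O.ring_axioms)
    show "subgroup ?I (add_monoid OKR)"
    proof (rule O.add.subgroupI)
      show "?I \<noteq> {}" using uniformizer(2) by (auto simp: K.VR_iff intro!: exI[of _ \<zero>])
      show "\<ominus>\<^bsub>OKR\<^esub> x \<in> ?I" if "x \<in> ?I" for x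
        using that subringE(5)[OF K.val_ring_subring, of x] by (simp add: OKR_minus OK_carrier)
      show "x \<oplus>\<^bsub>OKR\<^esub> y \<in> ?I" if "x \<in> ?I" "y \<in> ?I" for x y
        using that subringE(7)[OF K.val_ring_subring, of x y] by (simp add: OK_carrier K.val_add_le)
    qed auto
    show "x \<otimes>\<^bsub>OKR\<^esub> a \<in> ?I" if "a \<in> ?I" "x \<in> carrier OKR" for a x
      using cl[of a x] that by simp
    show "a \<otimes>\<^bsub>OKR\<^esub> x \<in> ?I" if "a \<in> ?I" "x \<in> carrier OKR" for a x
      using cl[of a x] that by (simp add: OK_carrier K.m_comm)
  qed
  then have "pO \<subseteq> ?I"
    by (rule O.genideal_minimal) (use pF_OK pF_le in blast)
  then show "x \<in> ?I" if "x \<in> pO" for x using that by blast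
  fix x assume x: "x \<in> ?I"
  then have "x \<in> OK" "\<nu> x \<le> \<nu> unif" by simp_all
  then obtain y where y: "y \<in> OK" "x = unif \<otimes> y" by (rule unif_divide)
  have "unif \<in> pO" using O.genideal_self[of pF] pF_OK unif_pF by auto
  then show "x \<in> pO" using ideal.I_r_closed[OF pO_ideal, of unif y] y by simp
qed

text \<open>The generator \<open>unif\<close> lies in F and is fixed by \<sigma>, so \<sigma>
  preserves divisibility by it.\<close>

lemma sigma_pO: "x \<in> pO \<Longrightarrow> \<sigma> x \<in> pO"
proof -
  assume "x \<in> pO"
  then have "x \<in> OK" "\<nu> x \<le> \<nu> unif" by (simp_all add: pO_eq)
  then obtain y where y: "y \<in> OK" "x = unif \<otimes> y" by (rule unif_divide)
  then have sy: "\<sigma> y \<in> OK" using N.sigma_closed by simp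
  have "unif \<in> F" using unif_pF pF_le by blast
  then have "\<sigma> x = unif \<otimes> \<sigma> y"
    using y ring_hom_mult[OF sigma(1) unif_K(1) OK_carrier[OF y(1)]] sigma(2) by simp
  moreover have "unif \<in> pO" by (simp add: pO_eq unif_K)
  ultimately show ?thesis using ideal.I_r_closed[OF pO_ideal, of unif "\<sigma> y"] sy by simp
qed

sublocale Rd: petit_reduction OKR \<sigma> f m "OKR Quot pO" "induced_map OKR pO \<sigma>" "\<lambda>x. pO +>\<^bsub>OKR\<^esub> x"
proof (rule petit_reduction_quotient)
  show "petit_algebra OKR \<sigma> f m" by (rule N.petit_algebra_axioms)
  show "ideal pO OKR" by (rule pO_ideal)
  show "\<one>\<^bsub>OKR\<^esub> \<notin> pO" using uniformizer(3) by (simp add: pO_eq)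
qed (rule sigma_pO)

lemma reduce_poly_eq: "reduce_poly OKR pO = (\<lambda>g i. pO +>\<^bsub>OKR\<^esub> g i)"
  by (intro ext) (simp add: reduce_poly_def)

lemma coset_zero_iff: "x \<in> OK \<Longrightarrow> pO +>\<^bsub>OKR\<^esub> x = \<zero>\<^bsub>OKR Quot pO\<^esub> \<longleftrightarrow> x \<in> pO"
  using O.a_rcos_zero[OF pO_ideal, of x] ideal.rcos_const_imp_mem[OF pO_ideal, of x]
  by (auto simp: FactRing_def)

lemma red_kernel_iff: "x \<in> Rd.red_kernel \<longleftrightarrow> x \<in> N.Below \<and> (\<forall>i. x i \<in> pO)"
proof (cases "x \<in> N.Below")
  case True
  then have "x i \<in> OK" for i using N.below_coeff[of x i] by simp
  then show ?thesis using True by (simp add: Rd.red_kernel_def coset_zero_iff)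
qed (simp add: Rd.red_kernel_def)

text \<open>A polynomial with coefficients in pO_K is already a single product \<open>unif y\<close>
  with \<open>y\<close> in \<Lambda>, so sums of products contribute nothing new. This identifies
  pO_K-valued coefficients with the additively generated p\<Lambda>.\<close>

lemma ideal_times_eq: "ideal_times pF N.A = Rd.red_kernel"
proof (intro equalityI)
  interpret NM: Module.module OKR N.A by (rule N.petit_module)
  have "{a \<odot>\<^bsub>N.A\<^esub> x | a x. a \<in> pF \<and> x \<in> carrier N.A} \<subseteq> Rd.red_kernel"
  proof clarify
    fix a x assume a: "a \<in> pF" and x: "x \<in> carrier N.A"
    have aO: "a \<in> OK" using a pF_OK by blast
    have xB: "x \<in> N.Below" using x by (simp add: N.petit_simps(1))
    have "a \<in> pO" using O.genideal_self[of pF] pF_OK a by auto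
    then have "a \<otimes>\<^bsub>OKR\<^esub> x i \<in> pO" for i
      using ideal.I_r_closed[OF pO_ideal, of a "x i"] N.below_coeff[OF xB, of i] by simp
    moreover have "(\<lambda>i. a \<otimes>\<^bsub>OKR\<^esub> x i) \<in> N.Below" using N.below_smult[OF _ xB, of a] aO by simp
    ultimately show "a \<odot>\<^bsub>N.A\<^esub> x \<in> Rd.red_kernel" unfolding red_kernel_iff N.petit_simps(6) by blast
  qed
  then show "ideal_times pF N.A \<subseteq> Rd.red_kernel"
    unfolding ideal_times_def
    using NM.M.add.generate_subgroup_incl[of _ Rd.red_kernel] additive_subgroup.a_subgroup[OF abelian_subgroup.axioms(1)[OF Rd.red_kernel_subgroup]]
    by simp
  show "Rd.red_kernel \<subseteq> ideal_times pF N.A"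
  proof
    fix x assume "x \<in> Rd.red_kernel"
    then have x: "x \<in> N.Below" "\<And>i. x i \<in> pO" by (auto simp: red_kernel_iff)
    have "\<exists>y\<in>OK. x i = unif \<otimes> y \<and> (x i = \<zero> \<longrightarrow> y = \<zero>)" for i
    proof -
      have "x i \<in> OK" "\<nu> (x i) \<le> \<nu> unif" using x(2)[of i] by (simp_all add: pO_eq)
      then obtain y where "y \<in> OK" "x i = unif \<otimes> y" "x i = \<zero> \<longrightarrow> y = \<zero>" by (rule unif_divide)
      then show ?thesis by blast
    qed
    then obtain y where y: "\<And>i. y i \<in> OK" "\<And>i. x i = unif \<otimes> y i" "\<And>i. x i = \<zero> \<Longrightarrow> y i = \<zero>"
      by metis
    have "y \<in> N.Below"
    proof (rule N.belowI)
      show "y i = \<zero>\<^bsub>OKR\<^esub>" if "i \<ge> m" for i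
        using y(3)[of i] N.below_above[OF x(1) that] by simp
    qed (simp add: y(1))
    moreover have "x = unif \<odot>\<^bsub>N.A\<^esub> y" using y(2) by (simp add: N.petit_simps(6) fun_eq_iff)
    ultimately have "x \<in> {a \<odot>\<^bsub>N.A\<^esub> x | a x. a \<in> pF \<and> x \<in> carrier N.A}"
      using unif_pF by (intro CollectI exI[of _ unif] exI[of _ y]) (simp add: N.petit_simps(1))
    then show "x \<in> ideal_times pF N.A" unfolding ideal_times_def by (rule generate.incl)
  qed
qed

section \<open>The preimage of the code as a lattice\<close>

definition preimage where
  "preimage I = {x \<in> N.Below. Rd.red x \<in> (\<lambda>x. Rd.red x) ` I}"

text \<open>The reduced ideal is a submodule over the residue ring, so its preimage is stable under
  all of O_K, hence under the integers of E. It contains the whole kernel of reduction because the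
  ideal contains zero.\<close>

lemma preimage_petit_lattice:
  assumes I: "principal_left_ideal N.A g I"
    and ext: "local_extension K \<nu> \<pi> E \<phi>" and F: "\<And>a. a \<in> carrier E \<Longrightarrow> \<phi> a \<in> F"
  shows "petit_lattice K \<nu> \<pi> E \<phi> \<sigma> f m (preimage I)"
proof -
  let ?L = "preimage I" and ?J = "(\<lambda>x. Rd.red x) ` I"
  interpret E': local_extension K \<nu> \<pi> E \<phi> by (rule ext)
  interpret PK: petit_algebra K \<sigma> f m by (rule petit_algebra_K)
  interpret PKM: Module.module K PK.A by (rule PK.petit_module)
  interpret TM: Module.module "OKR Quot pO" Rd.T.A by (rule Rd.T.petit_module)
  have "left_ideal ?J Rd.T.A"
    using Rd.red_principal_left_ideal[OF I] unfolding principal_left_ideal_def by (elim conjE)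
  then have J: "submodule ?J (OKR Quot pO) Rd.T.A" by (rule Rd.T.left_ideal_submodule[OF m_pos])
  note J_add = TM.submoduleE(5)[OF J] and J_smult = TM.submoduleE(4)[OF J]
  have J_zero: "(\<lambda>i. \<zero>\<^bsub>OKR Quot pO\<^esub>) \<in> ?J"
    using subgroup.one_closed[OF submodule.axioms(1)[OF J]] by (simp add: Rd.T.petit_simps(4))
  have hom: "(\<lambda>x. pO +>\<^bsub>OKR\<^esub> x) \<in> ring_hom OKR (OKR Quot pO)" by (rule Rd.r_hom)
  have LB: "x \<in> N.Below" "Rd.red x \<in> ?J" if "x \<in> ?L" for x using that by (auto simp: preimage_def)
  have L_OK: "x i \<in> OK" if "x \<in> ?L" for x i using N.below_coeff[OF LB(1)[OF that], of i] by simp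
  have sub: "N.Below \<subseteq> PK.Below"
  proof
    fix x assume x: "x \<in> N.Below"
    show "x \<in> PK.Below"
    proof (rule PK.belowI)
      show "x i \<in> carrier K" for i using N.below_coeff[OF x, of i] OK_carrier by simp
      show "x i = \<zero>" if "i \<ge> m" for i using N.below_above[OF x that] by simp
    qed
  qed
  have L_add: "(\<lambda>i. x i \<oplus> y i) \<in> ?L" if "x \<in> ?L" "y \<in> ?L" for x y
  proof -
    have "Rd.red (\<lambda>i. x i \<oplus> y i) = Rd.red x \<oplus>\<^bsub>Rd.T.A\<^esub> Rd.red y"
      using Rd.red_petit_add[OF LB(1)[OF that(1)] LB(1)[OF that(2)]] by (simp add: N.petit_simps(5))
    then have "Rd.red (\<lambda>i. x i \<oplus> y i) \<in> ?J"
      using J_add[OF LB(2)[OF that(1)] LB(2)[OF that(2)]] by (simp only:)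
    then show ?thesis
      using N.below_add[OF LB(1)[OF that(1)] LB(1)[OF that(2)]] by (simp add: preimage_def)
  qed
  have L_smult: "(\<lambda>i. a \<otimes> x i) \<in> ?L" if "a \<in> OK" "x \<in> ?L" for a x
  proof -
    have "Rd.red (\<lambda>i. a \<otimes> x i) = (pO +>\<^bsub>OKR\<^esub> a) \<odot>\<^bsub>Rd.T.A\<^esub> Rd.red x"
      using ring_hom_mult[OF hom, of a] that(1) L_OK[OF that(2)]
      by (simp add: Rd.T.petit_simps(6))
    moreover have "pO +>\<^bsub>OKR\<^esub> a \<in> carrier (OKR Quot pO)"
      using ring_hom_closed[OF hom, of a] that(1) by simp
    ultimately have "Rd.red (\<lambda>i. a \<otimes> x i) \<in> ?J"
      using J_smult[OF _ LB(2)[OF that(2)], of "pO +>\<^bsub>OKR\<^esub> a"] by (simp only:)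
    then show ?thesis
      using N.below_smult[OF _ LB(1)[OF that(2)], of a] that(1) by (simp add: preimage_def)
  qed
  have kernel_L: "x \<in> ?L" if x: "x \<in> N.Below" "\<And>i. x i \<in> pO" for x
  proof -
    have "Rd.red x = (\<lambda>i. \<zero>\<^bsub>OKR Quot pO\<^esub>)"
    proof
      fix i
      show "Rd.red x i = \<zero>\<^bsub>OKR Quot pO\<^esub>"
        using coset_zero_iff[of "x i"] N.below_coeff[OF x(1), of i] x(2)[of i] by simp
    qed
    then have "Rd.red x \<in> ?J" using J_zero by (simp only:)
    then show ?thesis using x(1) unfolding preimage_def by blast
  qed
  have subgrp: "subgroup ?L (add_monoid PK.A)"
  proof (rule PKM.M.add.subgroupI)
    show "?L \<subseteq> carrier PK.A" using sub LB(1) by (auto simp: PK.petit_simps(1))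
    have "(\<lambda>i. \<zero>) \<in> ?L"
      using kernel_L[of "\<lambda>i. \<zero>"] N.below_zero uniformizer(2) by (simp add: pO_eq K.VR_iff)
    then show "?L \<noteq> {}" by blast
    show "\<ominus>\<^bsub>PK.A\<^esub> x \<in> ?L" if "x \<in> ?L" for x
    proof -
      have "\<ominus>\<^bsub>PK.A\<^esub> x = (\<lambda>i. (\<ominus> \<one>) \<otimes> x i)"
        using LB(1)[OF that] sub L_OK[OF that] OK_carrier by (auto simp: PK.petit_neg K.l_minus)
      then show ?thesis using L_smult[OF _ that, of "\<ominus> \<one>"] by (simp add: K.VR_iff)
    qed
    show "x \<oplus>\<^bsub>PK.A\<^esub> y \<in> ?L" if "x \<in> ?L" "y \<in> ?L" for x y
      using L_add[OF that] by (simp add: PK.petit_simps(5))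
  qed
  show ?thesis
  proof (intro petit_lattice.intro petit_lattice_axioms.intro ext petit_algebra_K)
    show "\<sigma> (\<phi> a) = \<phi> a" if "a \<in> carrier E" for a using sigma(2) F[OF that] by blast
    show "0 < m" by (rule m_pos)
    show "subgroup ?L (add_monoid PK.A)" by (rule subgrp)
    show "\<phi> a \<odot>\<^bsub>PK.A\<^esub> x \<in> ?L" if "a \<in> E'.R" "x \<in> ?L" for a x
      using L_smult[OF _ that(2), of "\<phi> a"] that(1) by (simp add: PK.petit_simps(6) E'.R_iff K.VR_iff)
    show "x i \<in> OK" if "x \<in> ?L" for x i using L_OK[OF that] .
    show "\<phi> E'.unif \<odot>\<^bsub>PK.A\<^esub> x \<in> ?L" if x: "x \<in> PK.Below" "\<And>i. x i \<in> OK" for x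
    proof -
      \<comment> \<open>The uniformizer meant here is that of E. It maps into F with value below 1,
        hence into the maximal ideal of F, even if it does not generate that ideal.\<close>
      have u: "\<phi> E'.unif \<in> pF"
        using F[OF E'.uniformizer(1)] E'.uniformizer(3) by (simp add: max_ideal_def)
      then have uO: "\<phi> E'.unif \<in> OK" "\<phi> E'.unif \<in> pO"
        using pF_OK O.genideal_self[of pF] by auto
      have xB: "x \<in> N.Below" using x(2) PK.below_above[OF x(1)] by (intro N.belowI) simp_all
      have "(\<lambda>i. \<phi> E'.unif \<otimes> x i) \<in> ?L"
      proof (rule kernel_L)
        show "(\<lambda>i. \<phi> E'.unif \<otimes> x i) \<in> N.Below" using N.below_smult[OF _ xB, of "\<phi> E'.unif"] uO by simp
        show "\<phi> E'.unif \<otimes> x i \<in> pO" for i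
          using ideal.I_r_closed[OF pO_ideal uO(2), of "x i"] x(2) by simp
      qed
      then show ?thesis by (simp add: PK.petit_simps(6))
    qed
  qed
qed

text \<open>A single \<open>n\<close> serves both clauses, which ties the rank of the lattice to the
  rank of O_K over the integers of E.\<close>

lemma full_lattice_over:
  assumes "principal_left_ideal N.A g I" "local_extension K \<nu> \<pi> E \<phi>"
    "\<And>a. a \<in> carrier E \<Longrightarrow> \<phi> a \<in> F"
  shows "\<exists>n. free_of_rank (val_ring E (\<lambda>x. \<nu> (\<phi> x))) (pull_scalars \<phi> (self_module OKR)) n \<and>
    full_lattice_of_rank (val_ring E (\<lambda>x. \<nu> (\<phi> x))) E (pull_scalars \<phi> (petit K \<sigma> f)) (preimage I) (m * n)"
proof -
  interpret PL: petit_lattice K \<nu> \<pi> E \<phi> \<sigma> f m "preimage I"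
    by (rule preimage_petit_lattice[OF assms])
  show ?thesis using PL.integers_free PL.full_lattice by blast
qed

end

lemma is_complete_abs_pullback:
  assumes E: "ring E" and H: "ring H" and iso: "\<phi> \<in> ring_iso E H"
    and complete: "is_complete_abs H \<nu>"
  shows "is_complete_abs E (\<lambda>x. \<nu> (\<phi> x))"
proof -
  interpret E: ring E by fact
  interpret H: ring H by fact
  have hom: "\<phi> \<in> ring_hom E H" and bij: "bij_betw \<phi> (carrier E) (carrier H)"
    using iso by (auto simp: ring_iso_def)
  interpret hom: ring_hom_ring E H \<phi> by (rule ring_hom_ringI2[OF E H hom])
  have minus: "\<phi> (x \<ominus>\<^bsub>E\<^esub> y) = \<phi> x \<ominus>\<^bsub>H\<^esub> \<phi> y" if "x \<in> carrier E" "y \<in> carrier E" for x y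
    using that by (simp add: a_minus_def)
  show ?thesis
    unfolding is_complete_abs_def
  proof (intro allI impI, elim conjE)
    fix s :: "nat \<Rightarrow> _"
    assume s: "\<forall>n. s n \<in> carrier E"
      and cauchy: "\<forall>\<epsilon>>0. \<exists>n0. \<forall>i\<ge>n0. \<forall>j\<ge>n0. \<nu> (\<phi> (s i \<ominus>\<^bsub>E\<^esub> s j)) < \<epsilon>"
    have "\<exists>l\<in>carrier H. (\<lambda>n. \<nu> (\<phi> (s n) \<ominus>\<^bsub>H\<^esub> l)) \<longlonglongrightarrow> 0"
      using complete[unfolded is_complete_abs_def, rule_format, of "\<lambda>n. \<phi> (s n)"] s cauchy
      by (simp add: minus)
    then obtain l where l: "l \<in> carrier H" "(\<lambda>n. \<nu> (\<phi> (s n) \<ominus>\<^bsub>H\<^esub> l)) \<longlonglongrightarrow> 0" by blast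
    obtain l' where "l' \<in> carrier E" "l = \<phi> l'" using l(1) bij by (auto simp: bij_betw_def)
    then show "\<exists>l\<in>carrier E. (\<lambda>n. \<nu> (\<phi> (s n \<ominus>\<^bsub>E\<^esub> l))) \<longlonglongrightarrow> 0"
      using l(2) s by (intro bexI[of _ l']) (simp_all add: minus)
  qed
qed

text \<open>A value \<open>c powi k\<close> with c between 0 and 1 is at most 1 exactly for
  nonnegative k, and a Laurent series of nonnegative subdegree is a power series. The second
  assumption covers the zero series, whose value \<open>is_laurent_iso\<close> leaves open.\<close>

lemma laurent_val_ring:
  assumes "is_laurent_iso \<phi> H \<nu>" "\<nu> (\<phi> 0) = 0"
  shows "val_ring ring_of_type_algebra (\<lambda>x. \<nu> (\<phi> x)) = range fps_to_fls"
proof -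
  obtain c where c: "0 < c" "c < 1" "\<And>x. x \<noteq> 0 \<Longrightarrow> \<nu> (\<phi> x) = c powi fls_subdegree x"
    using assms(1) unfolding is_laurent_iso_def by blast
  have "\<nu> (\<phi> x) \<le> 1 \<longleftrightarrow> x \<in> range fps_to_fls" for x
  proof (cases "x = 0")
    case True
    then show ?thesis using assms(2) by (auto intro: range_eqI[of _ _ 0])
  next
    case False
    have "fls_subdegree x \<ge> 0 \<longleftrightarrow> x \<in> range fps_to_fls"
    proof
      assume "fls_subdegree x \<ge> 0"
      then have "x = fps_to_fls (fls_regpart x)" by simp
      then show "x \<in> range fps_to_fls" by (rule range_eqI)
    qed (auto simp: fls_subdegree_fls_to_fps_gt0)
    then show ?thesis using powi_le_one_iff[OF c(1,2)] c(3)[OF False] by simp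
  qed
  then show ?thesis by (simp add: val_ring_def ring_of_type_algebra_def)
qed



text \<open>The clause on cyclicity and dimension carries right divisibility as its premise because
  the definition of a cyclic code asks for a monic right divisor. Ranks are stated as
  \<open>m * n\<close> together with the freeness of O_K of rank n over the same ring.\<close>

theorem mainTheorem1:
  fixes K :: "('a, 'k) ring_scheme"
    and \<nu> :: "'a \<Rightarrow> real"
    and F :: "'a set"
    and \<sigma> :: "'a \<Rightarrow> 'a"
    and f g :: "nat \<Rightarrow> 'a"
    and m :: nat
  assumes K: "nonarch_local_field K \<nu>"
    and F: "nonarch_local_field (K\<lparr>carrier := F\<rparr>) \<nu>"
    and galois: "finite_galois K F"
    and \<sigma>: "\<sigma> \<in> Gal K F"
    and OK: "OK = K\<lparr>carrier := val_ring K \<nu>\<rparr>"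
    and OF: "OF = val_ring (K\<lparr>carrier := F\<rparr>) \<nu>"
    and p: "\<pp> = max_ideal (K\<lparr>carrier := F\<rparr>) \<nu>"
    and f: "monic_poly OK f" "deg OK f = m"
    and Sf: "Sf = petit K \<sigma> f"
    and \<Lambda>: "\<Lambda> = petit OK \<sigma> f"
    and pOK: "pOK = Idl\<^bsub>OK\<^esub> \<pp>"
    and p\<Lambda>: "p\<Lambda> = ideal_times \<pp> \<Lambda>"
    and Rbar: "Rbar = OK Quot pOK"
    and \<sigma>bar: "\<sigma>bar = induced_map OK pOK \<sigma>"
    and fbar: "fbar = reduce_poly OK pOK f"
    and gbar: "gbar = reduce_poly OK pOK g"
    and Sfbar: "Sfbar = petit Rbar \<sigma>bar fbar"
    and \<Psi>: "\<Psi> = on_cosets (reduce_poly OK pOK)"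
    and \<rho>: "\<rho> = (\<lambda>x. \<Psi> (p\<Lambda> +>\<^bsub>\<Lambda>\<^esub> x))"
    and I: "principal_left_ideal \<Lambda> g I"
    and g: "monic_poly OK g"
    and p_I: "const_poly OK ` \<pp> \<subseteq> I"
    and I_mod: "I_mod = (\<lambda>x. p\<Lambda> +>\<^bsub>\<Lambda>\<^esub> x) ` I"
    and C: "C = coords m ` \<Psi> ` I_mod"
    and L: "L = {x \<in> carrier \<Lambda>. \<rho> x \<in> \<Psi> ` I_mod}"
  shows
    "principal_left_ideal (\<Lambda> Quot p\<Lambda>) (p\<Lambda> +>\<^bsub>\<Lambda>\<^esub> g) I_mod \<and>
     I_mod \<noteq> {\<zero>\<^bsub>\<Lambda> Quot p\<Lambda>\<^esub>} \<and>
     principal_left_ideal Sfbar gbar (\<Psi> ` I_mod) \<and>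
     monic_poly Rbar gbar \<and>
     submodule (\<Psi> ` I_mod) Rbar Sfbar \<and>
     deg Rbar fbar = m \<and>
     linear_code Rbar m C \<and>
     linear_iso Rbar (Sfbar\<lparr>carrier := \<Psi> ` I_mod\<rparr>) ((vec Rbar m)\<lparr>carrier := C\<rparr>) (coords m) \<and>
     (right_divides Rbar \<sigma>bar gbar fbar \<longrightarrow>
        cyclic_code_gen_by Rbar \<sigma>bar fbar gbar C \<and>
        cyclic_code Rbar \<sigma>bar fbar C \<and> code_dimension Rbar m C (m - deg Rbar gbar)) \<and>
     (\<exists>n. free_of_rank OF (self_module OK) n \<and>
        full_lattice_of_rank OF (K\<lparr>carrier := F\<rparr>) Sf L (m * n)) \<and>
     (\<forall>(p::nat) Qp Zp.
        Factorial_Ring.prime p \<and> is_padic_numbers p K \<nu> Qp \<and> Qp \<subseteq> F \<and>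
        ring.finite_dimension K Qp F \<and> ring.finite_dimension K Qp (carrier K) \<and>
        Zp = val_ring (K\<lparr>carrier := Qp\<rparr>) \<nu> \<longrightarrow>
        (\<exists>n. free_of_rank Zp (self_module OK) n \<and>
           full_lattice_of_rank Zp (K\<lparr>carrier := Qp\<rparr>) Sf L (m * n))) \<and>
     (\<forall>(\<phi> :: 'c::{Fields.field,finite} fls \<Rightarrow> 'a) (\<psi> :: 'd::{Fields.field,finite} fls \<Rightarrow> 'a).
        is_laurent_iso \<phi> (K\<lparr>carrier := F\<rparr>) \<nu> \<and> is_laurent_iso \<psi> K \<nu> \<longrightarrow>
        (\<exists>n. free_of_rank (range fps_to_fls) (pull_scalars \<phi> (self_module OK)) n \<and>
           full_lattice_of_rank (range fps_to_fls) ring_of_type_algebra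
             (pull_scalars \<phi> Sf) L (m * n)))"
proof -
  have Kfield: "Ring.field K" and residue: "finite (carrier ((K\<lparr>carrier := val_ring K \<nu>\<rparr>) Quot (max_ideal K \<nu>)))"
    using K by (auto simp: nonarch_local_field_def)
  interpret KF: Ring.field K by (rule Kfield)
  have F_field: "Ring.field (K\<lparr>carrier := F\<rparr>)" and F_complete: "is_complete_abs (K\<lparr>carrier := F\<rparr>) \<nu>"
    and F_nontriv: "\<exists>x\<in>F. 0 < \<nu> x \<and> \<nu> x < 1"
    using F by (auto simp: nonarch_local_field_def)
  have F_subfield: "subfield F K" using galois by (simp add: finite_galois_def)
  have F_sub: "F \<subseteq> carrier K" using subfieldE(3)[OF F_subfield] .
  obtain \<pi> where disc: "discrete_valued_field K \<nu> \<pi>" using nonarch_local_field_discrete[OF K] by blast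
  have ext: "local_extension K \<nu> \<pi> (K\<lparr>carrier := H\<rparr>) (\<lambda>x. x)"
    if "subfield H K" "is_complete_abs (K\<lparr>carrier := H\<rparr>) \<nu>" "\<exists>x\<in>H. 0 < \<nu> x \<and> \<nu> x < 1" for H
    using that disc residue KF.subfield_iff(2)[OF that(1)] subring_inclusion_hom[OF subfieldE(1)[OF that(1)]]
    by (simp add: local_extension_def local_extension_axioms_def)
  have sigma: "\<sigma> \<in> ring_hom K K" "\<And>a. a \<in> F \<Longrightarrow> \<sigma> a = a"
    using \<sigma> by (auto simp: Gal_def ring_iso_def)
  have g_below: "g \<in> polys_below OK m"
    using I f(2) by (simp add: principal_left_ideal_def \<Lambda> petit_def)
  \<comment> \<open>For m = 0 the only polynomial available is zero, which is not monic since 1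
    differs from 0 in K; but the monic \<open>g\<close> lies in \<Lambda>.\<close>
  have m_pos: "0 < m"
  proof (rule ccontr)
    assume "\<not> 0 < m"
    then have "g (deg OK g) = \<zero>\<^bsub>OK\<^esub>" using g_below by (simp add: polys_below_def)
    then show False using g KF.one_not_zero by (simp add: monic_poly_def OK)
  qed
  have order: "natural_order K \<nu> \<pi> F \<sigma> f m"
    using ext[OF F_subfield F_complete F_nontriv] sigma f m_pos
    by (simp add: natural_order_def natural_order_axioms_def OK)
  interpret NO: natural_order K \<nu> \<pi> F \<sigma> f m by (rule order)
  have pOK_eq: "pOK = NO.pO" by (simp add: pOK OK p)
  have p\<Lambda>_eq: "p\<Lambda> = NO.Rd.red_kernel" using NO.ideal_times_eq by (simp add: p\<Lambda> p \<Lambda> OK)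
  have \<Lambda>_eq: "\<Lambda> = NO.N.A" by (simp add: \<Lambda> OK)
  have red: "reduce_poly OK pOK = (\<lambda>h i. NO.pO +>\<^bsub>NO.OKR\<^esub> h i)"
    unfolding OK pOK_eq by (rule NO.reduce_poly_eq)
  have Rbar_eq: "Rbar = NO.OKR Quot NO.pO" by (simp add: Rbar OK pOK_eq)
  have \<sigma>bar_eq: "\<sigma>bar = induced_map NO.OKR NO.pO \<sigma>" by (simp add: \<sigma>bar OK pOK_eq)
  have fbar_eq: "fbar = NO.Rd.red f" and gbar_eq: "gbar = NO.Rd.red g" by (simp_all add: fbar gbar red)
  have Sfbar_eq: "Sfbar = NO.Rd.T.A" by (simp add: Sfbar Rbar_eq \<sigma>bar_eq fbar_eq)
  have I': "principal_left_ideal NO.N.A g I" using I by (simp add: \<Lambda>_eq)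
  have g': "monic_poly NO.OKR g" using g by (simp add: OK)
  have I_left: "left_ideal I NO.N.A" and I_eq: "I = {h \<otimes>\<^bsub>NO.N.A\<^esub> g | h. h \<in> carrier NO.N.A}"
    and gB: "g \<in> NO.N.Below"
    using I' unfolding principal_left_ideal_def NO.N.petit_simps(1) by auto
  have IB: "I \<subseteq> NO.N.Below"
    using I_left subgroup.subset[of I "add_monoid NO.N.A"] by (simp add: left_ideal_def NO.N.petit_simps(1))
  have \<Psi>_coset: "\<Psi> (p\<Lambda> +>\<^bsub>\<Lambda>\<^esub> x) = NO.Rd.red x" if "x \<in> NO.N.Below" for x
    unfolding \<Psi> red p\<Lambda>_eq \<Lambda>_eq by (rule NO.Rd.on_cosets_red[OF that])
  have \<Psi>_image: "\<Psi> ` I_mod = (\<lambda>x. NO.Rd.red x) ` I"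
    unfolding I_mod image_image by (rule image_cong[OF refl]) (use IB \<Psi>_coset in blast)
  have J: "principal_left_ideal NO.Rd.T.A (NO.Rd.red g) (\<Psi> ` I_mod)"
    unfolding \<Psi>_image by (rule NO.Rd.red_principal_left_ideal[OF I'])
  have J_sub: "submodule (\<Psi> ` I_mod) (NO.OKR Quot NO.pO) NO.Rd.T.A"
    using J unfolding principal_left_ideal_def by (intro NO.Rd.T.left_ideal_submodule m_pos) (elim conjE)
  have L_eq: "L = NO.preimage I"
    unfolding L NO.preimage_def \<Psi>_image \<rho> using \<Psi>_coset by (auto simp: \<Lambda>_eq NO.N.petit_simps(1))
  have c1: "principal_left_ideal (\<Lambda> Quot p\<Lambda>) (p\<Lambda> +>\<^bsub>\<Lambda>\<^esub> g) I_mod"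
    unfolding I_mod p\<Lambda>_eq \<Lambda>_eq by (rule NO.Rd.quotient_principal_left_ideal[OF I'])
  have c2: "I_mod \<noteq> {\<zero>\<^bsub>\<Lambda> Quot p\<Lambda>\<^esub>}"
  proof
    assume "I_mod = {\<zero>\<^bsub>\<Lambda> Quot p\<Lambda>\<^esub>}"
    then have z: "I_mod = {p\<Lambda>}" by (simp add: FactRing_def)
    have gK: "g i \<in> carrier K" for i using NO.N.below_coeff[OF gB, of i] NO.OK_carrier by simp
    \<comment> \<open>The generator is its own product with the unit and so belongs to
      \<open>I\<close>. If \<open>I\<close> were trivial modulo p\<Lambda>, all coefficients of
      \<open>g\<close> would lie in pO_K, including the leading 1.\<close>
    have "g = const_poly NO.OKR \<one>\<^bsub>NO.OKR\<^esub> \<otimes>\<^bsub>NO.N.A\<^esub> g"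
      using NO.N.petit_const_mult(1)[OF m_pos NO.N.one_closed gB] gK by (simp add: NO.N.petit_simps(6))
    moreover have "const_poly NO.OKR \<one>\<^bsub>NO.OKR\<^esub> \<in> carrier NO.N.A"
      using NO.N.const_below[OF m_pos NO.N.one_closed] by (simp only: NO.N.petit_simps(1))
    ultimately have "g \<in> I" unfolding I_eq by blast
    then have "p\<Lambda> +>\<^bsub>\<Lambda>\<^esub> g = p\<Lambda>" using z I_mod by blast
    moreover have "g \<in> p\<Lambda> +>\<^bsub>\<Lambda>\<^esub> g"
      unfolding p\<Lambda>_eq \<Lambda>_eq using NO.Rd.red_coset_eq[OF gB] gB by blast
    ultimately have "g \<in> NO.Rd.red_kernel" by (simp add: p\<Lambda>_eq)
    then have "g (deg NO.OKR g) \<in> NO.pO" using NO.red_kernel_iff by blast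
    then show False using g' NO.uniformizer(3) by (simp add: monic_poly_def NO.pO_eq)
  qed
  have c9: "cyclic_code_gen_by Rbar \<sigma>bar fbar gbar C \<and> cyclic_code Rbar \<sigma>bar fbar C \<and>
      code_dimension Rbar m C (m - deg Rbar gbar)"
    if rd: "right_divides Rbar \<sigma>bar gbar fbar"
  proof -
    note code = NO.Rd.T.divisor_code[OF NO.Rd.nontrivial NO.Rd.red_monic(1)[OF g'] _ J m_pos]
    have "cyclic_code_gen_by Rbar \<sigma>bar fbar gbar C" "code_dimension Rbar m C (m - deg Rbar gbar)"
      using code rd unfolding Rbar_eq \<sigma>bar_eq fbar_eq gbar_eq C by blast+
    then show ?thesis unfolding cyclic_code_def by blast
  qed
  \<comment> \<open>\<open>H\<close> will be F or the field of p-adic numbers. Containment in F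
    ensures that \<sigma> fixes \<open>H\<close>.\<close>
  have lattice: "\<exists>n. free_of_rank (val_ring (K\<lparr>carrier := H\<rparr>) \<nu>) (self_module OK) n \<and>
      full_lattice_of_rank (val_ring (K\<lparr>carrier := H\<rparr>) \<nu>) (K\<lparr>carrier := H\<rparr>) Sf L (m * n)"
    if "subfield H K" "is_complete_abs (K\<lparr>carrier := H\<rparr>) \<nu>" "\<exists>x\<in>H. 0 < \<nu> x \<and> \<nu> x < 1" "H \<subseteq> F" for H
    using NO.full_lattice_over[OF I' ext[OF that(1-3)]] that(4)
    unfolding pull_scalars_id L_eq Sf OK by (simp add: subset_iff)
  have c11: "\<exists>n. free_of_rank Zp (self_module OK) n \<and> full_lattice_of_rank Zp (K\<lparr>carrier := Qp\<rparr>) Sf L (m * n)"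
    if prime: "Factorial_Ring.prime p" and padic: "is_padic_numbers p K \<nu> Qp" and sub: "Qp \<subseteq> F"
      and Zp: "Zp = val_ring (K\<lparr>carrier := Qp\<rparr>) \<nu>" for p :: nat and Qp Zp
  proof -
    have Qp: "subfield Qp K" "is_complete_abs (K\<lparr>carrier := Qp\<rparr>) \<nu>"
      using padic by (auto simp: is_padic_numbers_def)
    obtain c where c: "0 < c" "c < 1"
        "\<And>n::int. n \<noteq> 0 \<Longrightarrow> \<nu> (add_pow K n \<one>\<^bsub>K\<^esub>) = c ^ multiplicity (int p) n"
      using padic unfolding is_padic_numbers_def by blast
    have "p > 1" using prime prime_gt_1_nat by blast
    \<comment> \<open>The prime itself is the witness for nontriviality of the absolute value: its
      multiplicity is 1, so its value is \<open>c\<close>.\<close>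
    then have "multiplicity (int p) (int p) = 1" by (intro multiplicity_self) auto
    then have "\<nu> (add_pow K (int p) \<one>\<^bsub>K\<^esub>) = c" using c(3)[of "int p"] \<open>p > 1\<close> by simp
    moreover have "add_pow K (int p) \<one>\<^bsub>K\<^esub> \<in> Qp"
    proof -
      have "subgroup Qp (add_monoid K)" "\<one>\<^bsub>K\<^esub> \<in> Qp"
        using subfieldE(1)[OF Qp(1)] subring.axioms(1) subringE(3) by auto
      then show ?thesis
        using group.subgroup_int_pow_closed[OF KF.a_group] by (simp add: add_pow_def)
    qed
    ultimately show ?thesis unfolding Zp using c(1,2) by (intro lattice[OF Qp _ sub]) auto
  qed
  have c12: "\<exists>n. free_of_rank (range fps_to_fls) (pull_scalars \<phi> (self_module OK)) n \<and>
      full_lattice_of_rank (range fps_to_fls) ring_of_type_algebra (pull_scalars \<phi> Sf) L (m * n)"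
    if iso: "is_laurent_iso \<phi> (K\<lparr>carrier := F\<rparr>) \<nu>" for \<phi> :: "'e::{Fields.field,finite} fls \<Rightarrow> 'a"
  proof -
    let ?E = "ring_of_type_algebra :: 'e fls ring"
    have E: "Ring.field ?E" by (rule field_from_type_algebra)
    then have E_ring: "ring ?E" by (intro cring.axioms(1) domain.axioms(1) field.axioms(1))
    have F_ring: "ring (K\<lparr>carrier := F\<rparr>)" using F_field by (intro cring.axioms(1) domain.axioms(1) field.axioms(1))
    have ri: "\<phi> \<in> ring_iso ?E (K\<lparr>carrier := F\<rparr>)" using iso by (simp add: is_laurent_iso_def)
    then have rh: "\<phi> \<in> ring_hom ?E (K\<lparr>carrier := F\<rparr>)" by (simp add: ring_iso_def)
    have phiF: "\<phi> a \<in> F" for a using ring_hom_closed[OF rh, of a] by (simp add: ring_of_type_algebra_def)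
    have hom: "\<phi> \<in> ring_hom ?E K" using rh F_sub by (auto simp: ring_hom_def)
    have zero: "\<phi> 0 = \<zero>\<^bsub>K\<^esub>" using ring_hom_zero[OF hom E_ring KF.ring_axioms] by (simp add: ring_of_type_algebra_def)
    obtain c where c: "0 < c" "c < 1" "\<And>x. x \<noteq> 0 \<Longrightarrow> \<nu> (\<phi> x) = c powi fls_subdegree x"
      using iso unfolding is_laurent_iso_def by blast
    \<comment> \<open>The variable u of the Laurent series has subdegree 1 and is the element of
      value strictly between 0 and 1.\<close>
    have "\<nu> (\<phi> fls_X) = c" using c(3)[of fls_X] by simp
    then have nontriv: "\<exists>x\<in>carrier ?E. 0 < \<nu> (\<phi> x) \<and> \<nu> (\<phi> x) < 1"
      using c(1,2) by (intro bexI[of _ fls_X]) (simp_all add: ring_of_type_algebra_def)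
    have "local_extension K \<nu> \<pi> ?E \<phi>"
      using disc E hom is_complete_abs_pullback[OF E_ring F_ring ri F_complete] nontriv residue
      by (simp add: local_extension_def local_extension_axioms_def)
    then have "\<exists>n. free_of_rank (val_ring ?E (\<lambda>x. \<nu> (\<phi> x))) (pull_scalars \<phi> (self_module NO.OKR)) n \<and>
      full_lattice_of_rank (val_ring ?E (\<lambda>x. \<nu> (\<phi> x))) ?E (pull_scalars \<phi> (petit K \<sigma> f)) (NO.preimage I) (m * n)"
      by (rule NO.full_lattice_over[OF I']) (rule phiF)
    then show ?thesis
      unfolding L_eq Sf OK using laurent_val_ring[OF iso] zero NO.K.val_zero by simp
  qed
  show ?thesis
  proof (intro conjI)
    show "principal_left_ideal Sfbar gbar (\<Psi> ` I_mod)" unfolding Sfbar_eq gbar_eq by (rule J)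
    show "monic_poly Rbar gbar" unfolding Rbar_eq gbar_eq by (rule NO.Rd.red_monic(1)[OF g'])
    show "submodule (\<Psi> ` I_mod) Rbar Sfbar" unfolding Rbar_eq Sfbar_eq by (rule J_sub)
    show "deg Rbar fbar = m" unfolding Rbar_eq fbar_eq by (rule NO.Rd.T.degree)
    show "linear_code Rbar m C"
      unfolding linear_code_def Rbar_eq C by (rule NO.Rd.T.coords_linear_iso(2)[OF J_sub])
    show "linear_iso Rbar (Sfbar\<lparr>carrier := \<Psi> ` I_mod\<rparr>) ((vec Rbar m)\<lparr>carrier := C\<rparr>) (coords m)"
      unfolding Rbar_eq Sfbar_eq C by (rule NO.Rd.T.coords_linear_iso(1)[OF J_sub])
    show "\<exists>n. free_of_rank OF (self_module OK) n \<and>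
        full_lattice_of_rank OF (K\<lparr>carrier := F\<rparr>) Sf L (m * n)"
      unfolding OF by (rule lattice[OF F_subfield F_complete F_nontriv order_refl])
  qed (use c1 c2 c9 c11 c12 in blast)+
qed


end
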